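(* If a one-way quantum states generator exists, then there exists a one-time secure digital signature scheme with quantum public keys (with message space $\{0,1\}$ and perfect correctness).
   Context: Conventions. QPT means (uniform) quantum polynomial time and PPT classical probabilistic polynomial time. A function $f$ is negligible if for every constant $c>0$, $f(\lambda)<\lambda^{-c}$ for all large enough $\lambda$; $\mathsf{negl}$ denotes a negligible function. $k\leftarrow\{0,1\}^n$ means $k$ is sampled uniformly at random. One-way quantum states generator (OWSG). Let $G$ be a QPT algorithm that, on input $k\in\{0,1\}^n$, outputs a quantum state $|\phi_k\rangle$. Standing convention: the output is pure and no ancilla is left over, i.e. on input $k$, $G$ computes in classical polynomial time a description of a unitary quantum circuit $U_k$ and outputs $|\phi_k\rangle=U_k|0\ldots0\rangle$. Consider the game $\mathsf{Exp}$ between a challenger $\mathcal{C}$ and an adversary $\mathcal{A}$: (1) $\mathcal{C}$ chooses $k\leftarrow\{0,1\}^n$. (2) $\mathcal{C}$ runs $|\phi_k\rangle\leftarrow G(k)$ $t+1$ times. (3) $\mathcal{C}$ sends $|\phi_k\rangle^{\otimes t}$ to $\mathcal{A}$. (4) $\mathcal{A}$ sends $\sigma\in\{0,1\}^n$ to $\mathcal{C}$. (5) $\mathcal{C}$ measures the remaining copy of $|\phi_k\rangle$ with $\{|\phi_\sigma\rangle\langle\phi_\sigma|,I-|\phi_\sigma\rangle\langle\phi_\sigma|\}$; the output is 1 if the result is $|\phi_\sigma\rangle\langle\phi_\sigma|$ and 0 otherwise. $G$ is a OWSG if for every $t=\mathrm{poly}(n)$ and every QPT $\mathcal{A}$ there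 is a negligible function with $\Pr[\mathsf{Exp}=1]\le\mathsf{negl}(n)$. Digital signature scheme with quantum public keys. A tuple $(\mathsf{Gen}_1,\mathsf{Gen}_2,\mathsf{Sign},\mathsf{Verify})$ where: $\mathsf{Gen}_1(1^\lambda)$ is a classical PPT algorithm that outputs a classical secret key $sk$; $\mathsf{Gen}_2(sk)$ is a QPT algorithm that outputs a quantum public key $pk$ (a quantum state); $\mathsf{Sign}(sk,m)$ is a classical deterministic polynomial-time algorithm that outputs a classical signature $\sigma$ on message $m$; $\mathsf{Verify}(pk,m,\sigma)$ is a QPT algorithm that outputs $\top$ or $\bot$. Perfect correctness: for all messages $m$, $\Pr[\top\leftarrow\mathsf{Verify}(pk,m,\sigma): sk\leftarrow\mathsf{Gen}_1(1^\lambda),\,pk\leftarrow\mathsf{Gen}_2(sk),\,\sigma\leftarrow\mathsf{Sign}(sk,m)]=1$. One-time security. Consider the game $\mathsf{Exp}$ between a challenger $\mathcal{C}$ and an adversary $\mathcal{A}$: (1) $\mathcal{C}$ runs $sk\leftarrow\mathsf{Gen}_1(1^\lambda)$. (2) $\mathcal{A}$ can query $pk\leftarrow\mathsf{Gen}_2(sk)$ polynomially many (in $\lambda$) times, i.e. receives polynomially many copies of the public key. (3) $\mathcal{A}$ sends a message $m$ to $\mathcal{C}$. (4) $\mathcal{C}$ runs $\sigma\leftarrow\mathsf{Sign}(sk,m)$ and sends $\sigma$ to $\mathcal{A}$. (5) $\mathcal{A}$ sends $\sigma'$ and $m'$ to $\mathcal{C}$. (6) $\mathcal{C}$ runs $v\leftarrow\mathsf{Verify}(pk,m',\sigma')$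 (with $pk\leftarrow\mathsf{Gen}_2(sk)$); the output of the game is 1 if $m'\ne m$ and $v=\top$, and 0 otherwise. The scheme is one-time secure if for every QPT $\mathcal{A}$ there is a negligible function with $\Pr[\mathsf{Exp}=1]\le\mathsf{negl}(\lambda)$. *)

theory Defs
  imports Complex_Main "HOL-Computational_Algebra.Polynomial"
begin

type_synonym bits = "bool list"

definition bitstrings :: "nat \<Rightarrow> bits set" where
  "bitstrings n = {x. length x = n}"

abbreviation unary :: "nat \<Rightarrow> bits" where
  "unary n \<equiv> replicate n True"

text \<open>Expectation over a uniformly random string of length \<open>n\<close>.\<close>

definition avg :: "nat \<Rightarrow> (bits \<Rightarrow> 'a) \<Rightarrow> 'a::real_normed_field" where
  "avg n f = (\<Sum>r\<in>bitstrings n. f r) / 2 ^ n"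

definition negligible :: "(nat \<Rightarrow> real) \<Rightarrow> bool" where
  "negligible f \<longleftrightarrow> (\<forall>c>0. \<exists>N. \<forall>n\<ge>N. f n < real n powr (- c))"


section \<open>Classical polynomial time\<close>

text \<open>
  The machine model is that of programs over finitely many stacks of bits with constant-time
  stack operations. Up to constant factors in the running time, such programs and multi-tape Turing
  machines simulate each other: a tape is a pair of stacks, and a stack is a tape. Every primitive operation and every
  test costs one step.
\<close>

type_synonym store = "nat \<Rightarrow> bits"

datatype com =
    Skip
  | Push bool nat
  | Pop nat
  | Seq com com
  | Branch nat com com com  \<comment> \<open>stack is empty / top is \<open>False\<close> / top is \<open>True\<close>\<close>
  | While nat com           \<comment> \<open>loop as long as the stack is nonempty\<close>

inductive exec :: "com \<Rightarrow> store \<Rightarrow> nat \<Rightarrow> store \<Rightarrow> bool" where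
  Skip: "exec Skip s 1 s"
| Push: "exec (Push b i) s 1 (s(i := b # s i))"
| Pop: "exec (Pop i) s 1 (s(i := tl (s i)))"
| Seq: "exec c s n s' \<Longrightarrow> exec d s' n' s'' \<Longrightarrow> exec (Seq c d) s (n + n') s''"
| Branch_empty: "s i = [] \<Longrightarrow> exec c s n s' \<Longrightarrow> exec (Branch i c d e) s (Suc n) s'"
| Branch_False: "s i = False # x \<Longrightarrow> exec d s n s' \<Longrightarrow> exec (Branch i c d e) s (Suc n) s'"
| Branch_True: "s i = True # x \<Longrightarrow> exec e s n s' \<Longrightarrow> exec (Branch i c d e) s (Suc n) s'"
| While_end: "s i = [] \<Longrightarrow> exec (While i c) s 1 s"
| While_step: "s i \<noteq> [] \<Longrightarrow> exec c s n s' \<Longrightarrow> exec (While i c) s' n' s'' \<Longrightarrow>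
    exec (While i c) s (Suc (n + n')) s''"

definition init_store :: "bits list \<Rightarrow> store" where
  "init_store xs = (\<lambda>i. if i < length xs then xs ! i else [])"

text \<open>A function of \<open>k\<close> bit strings; the inputs are in stacks \<open>0, \<dots>, k - 1\<close>, the output in
  stack \<open>0\<close>, and the time bound is a polynomial in the total input length.\<close>

definition poly_time :: "nat \<Rightarrow> (bits list \<Rightarrow> bits) \<Rightarrow> bool" where
  "poly_time k f \<longleftrightarrow> (\<exists>c (p :: nat poly). \<forall>xs. length xs = k \<longrightarrow>
     (\<exists>n s. exec c (init_store xs) n s \<and> s 0 = f xs \<and> n \<le> poly p (sum_list (map length xs))))"


section \<open>Quantum circuits\<close>

text \<open>The last argument of \<open>Cnot\<close> and \<open>Toffoli\<close> is the target. The Toffoli gate is redundant: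
  it is exactly a product of the other gates.\<close>

datatype gate = Hadamard nat | Tgate nat | Cnot nat nat | Toffoli nat nat nat

text \<open>\<open>Circ a w gs\<close>: append \<open>a\<close> qubits in state zero to the input register, apply \<open>gs\<close> from left to
  right, and output the first \<open>w\<close> qubits.\<close>

datatype circ = Circ (ancillas: nat) (outputs: nat) (gates: "gate list")

definition enc_nat :: "nat \<Rightarrow> bits" where
  "enc_nat n = unary n @ [False]"

fun enc_gate :: "gate \<Rightarrow> bits" where
  "enc_gate (Hadamard i) = [False, False] @ enc_nat i"
| "enc_gate (Tgate i) = [False, True] @ enc_nat i"
| "enc_gate (Cnot i j) = [True, False] @ enc_nat i @ enc_nat j"
| "enc_gate (Toffoli i j k) = [True, True] @ enc_nat i @ enc_nat j @ enc_nat k"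

text \<open>Numbers are in unary, so that a circuit computed in polynomial time has polynomially many
  qubits.\<close>

fun enc_circ :: "circ \<Rightarrow> bits" where
  "enc_circ (Circ a w gs) = enc_nat a @ enc_nat w @ concat (map enc_gate gs)"

lemma enc_nat_append_eq: "enc_nat m @ x = enc_nat n @ y \<longleftrightarrow> m = n \<and> x = y"
  unfolding enc_nat_def
proof (induction m arbitrary: n)
  case 0
  then show ?case by (cases n) auto
next
  case (Suc m)
  then show ?case by (cases n) auto
qed

lemma enc_gate_append_eq: "enc_gate g @ x = enc_gate h @ y \<longleftrightarrow> g = h \<and> x = y"
  by (cases g; cases h) (auto simp: enc_nat_append_eq)

lemma enc_gates_eq: "concat (map enc_gate gs) = concat (map enc_gate hs) \<longleftrightarrow> gs = hs"
proof (induction gs arbitrary: hs)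
  case Nil
  have "enc_gate h \<noteq> []" for h by (cases h) auto
  then show ?case by (cases hs) auto
next
  case (Cons g gs)
  have "enc_gate g \<noteq> []" by (cases g) auto
  with Cons show ?case by (cases hs) (auto simp: enc_gate_append_eq)
qed

lemma inj_enc_circ: "inj enc_circ"
proof (rule injI)
  fix c d assume "enc_circ c = enc_circ d"
  then show "c = d" by (cases c; cases d) (simp add: enc_nat_append_eq enc_gates_eq)
qed

text \<open>
  A vector of an \<open>n\<close>-qubit space is given by its amplitudes in the computational basis, indexed
  by the bit strings of length \<open>n\<close>; an operator by its matrix in that basis. Values at strings
  of other lengths are irrelevant. Qubit \<open>0\<close> is the head of the string. A gate that does
  not address distinct qubits of the register acts as the identity.
\<close>

type_synonym qvec = "bits \<Rightarrow> complex"
type_synonym qop = "bits \<Rightarrow> bits \<Rightarrow> complex"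

fun apply_gate :: "gate \<Rightarrow> qvec \<Rightarrow> qvec" where
  "apply_gate (Hadamard i) \<psi> x =
     (if i < length x
      then (\<psi> (x[i := False]) + (if x ! i then - 1 else 1) * \<psi> (x[i := True])) / complex_of_real (sqrt 2)
      else \<psi> x)"
| "apply_gate (Tgate i) \<psi> x =
     (if i < length x \<and> x ! i then cis (pi / 4) * \<psi> x else \<psi> x)"
| "apply_gate (Cnot i j) \<psi> x =
     (if i < length x \<and> j < length x \<and> i \<noteq> j \<and> x ! i then \<psi> (x[j := \<not> x ! j]) else \<psi> x)"
| "apply_gate (Toffoli i j k) \<psi> x =
     (if i < length x \<and> j < length x \<and> k < length x \<and> distinct [i, j, k] \<and> x ! i \<and> x ! j
      then \<psi> (x[k := \<not> x ! k]) else \<psi> x)"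

definition apply_gates :: "gate list \<Rightarrow> qvec \<Rightarrow> qvec" where
  "apply_gates gs \<psi> = fold apply_gate gs \<psi>"

text \<open>\<open>\<rho> \<mapsto> U \<rho> U\<^sup>*\<close> where \<open>U\<close> is the unitary of \<open>gs\<close>.\<close>

definition conj_gates :: "gate list \<Rightarrow> qop \<Rightarrow> qop" where
  "conj_gates gs \<rho> =
     (let \<rho>' = (\<lambda>x y. apply_gates gs (\<lambda>u. \<rho> u y) x)
      in (\<lambda>x y. cnj (apply_gates gs (\<lambda>v. cnj (\<rho>' x v)) y)))"

definition zero_vec :: "nat \<Rightarrow> qvec" where
  "zero_vec n = (\<lambda>x. if x = replicate n False then 1 else 0)"

definition zero_op :: "nat \<Rightarrow> qop" where
  "zero_op n = (\<lambda>x y. zero_vec n x * cnj (zero_vec n y))"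

text \<open>The first factor lives on \<open>q\<close> qubits.\<close>

definition tensor :: "nat \<Rightarrow> qop \<Rightarrow> qop \<Rightarrow> qop" where
  "tensor q \<rho> \<sigma> = (\<lambda>x y. \<rho> (take q x) (take q y) * \<sigma> (drop q x) (drop q y))"

fun tensor_power :: "nat \<Rightarrow> qop \<Rightarrow> nat \<Rightarrow> qop" where
  "tensor_power q \<rho> 0 = zero_op 0"
| "tensor_power q \<rho> (Suc t) = tensor q \<rho> (tensor_power q \<rho> t)"

definition inner_prod :: "nat \<Rightarrow> qvec \<Rightarrow> qvec \<Rightarrow> complex" where
  "inner_prod n \<phi> \<psi> = (\<Sum>x\<in>bitstrings n. cnj (\<phi> x) * \<psi> x)"

definition proj_op :: "qvec \<Rightarrow> qop" where
  "proj_op \<phi> = (\<lambda>x y. \<phi> x * cnj (\<phi> y))"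

text \<open>State of all \<open>q + ancillas C\<close> qubits after running \<open>C\<close> on the \<open>q\<close>-qubit state \<open>\<rho>\<close>.\<close>

definition run_circ :: "nat \<Rightarrow> circ \<Rightarrow> qop \<Rightarrow> qop" where
  "run_circ q C \<rho> = conj_gates (gates C) (tensor q \<rho> (zero_op (ancillas C)))"

definition out_size :: "nat \<Rightarrow> circ \<Rightarrow> nat" where
  "out_size q C = min (outputs C) (q + ancillas C)"

text \<open>
  The output, that is, the state with all but the first \<open>out_size q C\<close> qubits traced out. It is
  extended by \<open>0\<close> to strings of other lengths; so for every string \<open>s\<close>, the probability that
  measuring the output in the computational basis yields \<open>s\<close> is the diagonal entry at \<open>s\<close>.
\<close>

definition out_circ :: "nat \<Rightarrow> circ \<Rightarrow> qop \<Rightarrow> qop" where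
  "out_circ q C \<rho> = (\<lambda>x y.
     if length x = out_size q C \<and> length y = out_size q C
     then \<Sum>z\<in>bitstrings (q + ancillas C - out_size q C). run_circ q C \<rho> (x @ z) (y @ z)
     else 0)"

definition outcome_prob :: "qop \<Rightarrow> bits \<Rightarrow> real" where
  "outcome_prob \<rho> s = Re (\<rho> s s)"

text \<open>Unnormalised state after the first qubit was measured with result \<open>b\<close>; its trace is the
  probability of that result. (On a register without qubits the result is \<open>False\<close>.)\<close>

definition measure_first :: "bool \<Rightarrow> qop \<Rightarrow> qop" where
  "measure_first b \<rho> =
     (let first = (\<lambda>x. x \<noteq> [] \<and> hd x) in
      (\<lambda>x y. if first x = b \<and> first y = b then \<rho> x y else 0))"


section \<open>Quantum polynomial time\<close>

text \<open>
  A quantum algorithm with classical inputs \<open>xs\<close> and a quantum input tosses coins \<open>r\<close>, classically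
  computes the description of a circuit from \<open>xs @ [r]\<close>, and runs it on the quantum input.
  Intermediate measurements are deferred to the end.
\<close>

definition circ_gen :: "nat \<Rightarrow> (bits list \<Rightarrow> circ) \<Rightarrow> bool" where
  "circ_gen k D \<longleftrightarrow> poly_time k (\<lambda>xs. enc_circ (D xs))"

record qalg =
  coins :: "nat poly"
  circuit :: "bits list \<Rightarrow> circ"

definition qpt :: "nat \<Rightarrow> qalg \<Rightarrow> bool" where
  "qpt k A \<longleftrightarrow> circ_gen (Suc k) (circuit A)"

definition coin_length :: "qalg \<Rightarrow> bits list \<Rightarrow> nat" where
  "coin_length A xs = poly (coins A) (sum_list (map length xs))"

definition qalg_out :: "qalg \<Rightarrow> bits list \<Rightarrow> nat \<Rightarrow> qop \<Rightarrow> qop" where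
  "qalg_out A xs q \<rho> =
     (\<lambda>x y. avg (coin_length A xs) (\<lambda>r. out_circ q (circuit A (xs @ [r])) \<rho> x y))"


section \<open>One-way quantum states generators\<close>

definition owsg_vec :: "(bits \<Rightarrow> circ) \<Rightarrow> bits \<Rightarrow> qvec" where
  "owsg_vec G k = apply_gates (gates (G k)) (zero_vec (ancillas (G k)))"

definition owsg_exp :: "(bits \<Rightarrow> circ) \<Rightarrow> nat poly \<Rightarrow> qalg \<Rightarrow> nat \<Rightarrow> real" where
  "owsg_exp G t A n =
     avg n (\<lambda>k.
       let q = ancillas (G k);
           \<rho> = tensor_power q (proj_op (owsg_vec G k)) (poly t n)
       in \<Sum>\<sigma>\<in>bitstrings n.
            outcome_prob (qalg_out A [unary n] (poly t n * q) \<rho>) \<sigma> *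
            (cmod (inner_prod q (owsg_vec G \<sigma>) (owsg_vec G k)))\<^sup>2)"

text \<open>The second conjunct says that no qubits are discarded. By the third one, the states for keys
  of the same length live in the same space, so that the final measurement makes sense.\<close>

definition owsg :: "(bits \<Rightarrow> circ) \<Rightarrow> bool" where
  "owsg G \<longleftrightarrow>
     circ_gen 1 (\<lambda>xs. G (hd xs)) \<and>
     (\<forall>k. outputs (G k) = ancillas (G k)) \<and>
     (\<forall>k k'. length k = length k' \<longrightarrow> ancillas (G k) = ancillas (G k')) \<and>
     (\<forall>t A. qpt 1 A \<longrightarrow> (\<exists>\<nu>. negligible \<nu> \<and> (\<forall>n. owsg_exp G t A n \<le> \<nu> n)))"


section \<open>Digital signatures with quantum public keys\<close>

text \<open>
  The message space is \<open>bool\<close>. Inputs of the algorithms: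
  \<open>gen1 [1\<^sup>\<lambda>, coins]\<close>, \<open>gen2 [sk]\<close>, \<open>sign [sk, [m]]\<close>, \<open>verify [1\<^sup>\<lambda>, [m], \<sigma>]\<close>,
  the last one with quantum input \<open>pk\<close>; verification accepts iff its measured output is \<open>[True]\<close>.
  Public keys for security parameter \<open>\<lambda>\<close> consist of \<open>pk_qubits \<lambda>\<close> qubits.
\<close>

record sig_scheme =
  gen1_coins :: "nat poly"
  gen1 :: "bits list \<Rightarrow> bits"
  pk_qubits :: "nat \<Rightarrow> nat"
  gen2 :: qalg
  sign :: "bits list \<Rightarrow> bits"
  verify :: qalg

definition secret_key :: "sig_scheme \<Rightarrow> nat \<Rightarrow> bits \<Rightarrow> bits" where
  "secret_key S l r = gen1 S [unary l, r]"

definition sig_wf :: "sig_scheme \<Rightarrow> bool" where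
  "sig_wf S \<longleftrightarrow>
     poly_time 2 (gen1 S) \<and> qpt 1 (gen2 S) \<and> poly_time 2 (sign S) \<and> qpt 3 (verify S) \<and>
     (\<forall>l. \<forall>r\<in>bitstrings (poly (gen1_coins S) l).
        let sk = secret_key S l r in
        \<forall>r'\<in>bitstrings (coin_length (gen2 S) [sk]).
          out_size 0 (circuit (gen2 S) [sk, r']) = pk_qubits S l)"

definition public_key :: "sig_scheme \<Rightarrow> bits \<Rightarrow> qop" where
  "public_key S sk = qalg_out (gen2 S) [sk] 0 (zero_op 0)"

text \<open>Probability that verification accepts, with a fresh copy of the public key.\<close>

definition accept_prob :: "sig_scheme \<Rightarrow> nat \<Rightarrow> bits \<Rightarrow> bool \<Rightarrow> bits \<Rightarrow> real" where
  "accept_prob S l sk m \<sigma> =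
     outcome_prob (qalg_out (verify S) [unary l, [m], \<sigma>] (pk_qubits S l) (public_key S sk)) [True]"

definition perfectly_correct :: "sig_scheme \<Rightarrow> bool" where
  "perfectly_correct S \<longleftrightarrow> (\<forall>l m.
     avg (poly (gen1_coins S) l)
       (\<lambda>r. let sk = secret_key S l r in accept_prob S l sk m (sign S [sk, [m]])) = 1)"

text \<open>
  An adversary has two stages, \<open>stage1 [1\<^sup>\<lambda>, r]\<close> and \<open>stage2 [1\<^sup>\<lambda>, r, [m], \<sigma>]\<close>, with common coins
  \<open>r\<close>. The first one acts on the copies of the public key; its first qubit is then measured and
  gives the message \<open>m\<close>. The second one acts on all qubits left by the first; its measured output
  \<open>m' # \<sigma>'\<close> is the forgery. Receiving all copies at once is no restriction, since the queries
  for public keys carry no input and all precede the message.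
\<close>

record sig_adv =
  adv_coins :: "nat poly"
  stage1 :: "bits list \<Rightarrow> circ"
  stage2 :: "bits list \<Rightarrow> circ"

definition sig_adv_qpt :: "sig_adv \<Rightarrow> bool" where
  "sig_adv_qpt A \<longleftrightarrow> circ_gen 2 (stage1 A) \<and> circ_gen 4 (stage2 A)"

definition sig_exp :: "sig_scheme \<Rightarrow> nat poly \<Rightarrow> sig_adv \<Rightarrow> nat \<Rightarrow> real" where
  "sig_exp S t A l =
     avg (poly (gen1_coins S) l) (\<lambda>r. avg (poly (adv_coins A) l) (\<lambda>r'.
       let sk = secret_key S l r;
           pks = tensor_power (pk_qubits S l) (public_key S sk) (poly t l);
           q = poly t l * pk_qubits S l;
           C = stage1 A [unary l, r'];
           \<rho> = run_circ q C pks
       in \<Sum>m\<in>UNIV.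
            let D = stage2 A [unary l, r', [m], sign S [sk, [m]]];
                q' = q + ancillas C;
                \<rho>' = out_circ q' D (measure_first m \<rho>)
            in \<Sum>s\<in>bitstrings (out_size q' D).
                 outcome_prob \<rho>' s *
                 (case s of [] \<Rightarrow> 0
                  | m' # \<sigma>' \<Rightarrow> if m' \<noteq> m then accept_prob S l sk m' \<sigma>' else 0)))"

definition one_time_secure :: "sig_scheme \<Rightarrow> bool" where
  "one_time_secure S \<longleftrightarrow> (\<forall>t A. sig_adv_qpt A \<longrightarrow>
     (\<exists>\<nu>. negligible \<nu> \<and> (\<forall>l. sig_exp S t A l \<le> \<nu> l)))"

end

theory Submission
  imports Defs
begin

text \<open>
  The scheme is Lamport's: a secret key consists of two inputs \<open>k\<^sub>0, k\<^sub>1\<close> of the one-way state generator,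
  the public key is \<open>|\<phi>\<^bsub>k\<^sub>0\<^esub>\<rangle> |\<phi>\<^bsub>k\<^sub>1\<^esub>\<rangle>\<close>, and the signature on \<open>m\<close> is \<open>k\<^sub>m\<close>. To verify \<open>\<sigma>\<close>, undo the circuit of
  \<open>G \<sigma>\<close> on the \<open>m\<close>-th half of the public key and test whether all its qubits are zero; this accepts with
  probability \<open>|\<langle>\<phi>\<^sub>\<sigma>|\<phi>\<^bsub>k\<^sub>m\<^esub>\<rangle>|\<^sup>2\<close>, which is exactly the winning condition of the one-wayness game.

  Given copies of a challenge state, the reduction guesses the message \<open>b\<close> of the forgery, plants the
  challenge in the \<open>b\<close>-th half of the public keys, and chooses the other key itself, so that it can sign
  \<open>\<not> b\<close>. A forger asks for the signature on some message and forges one on the other, so the guess is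
  right with probability \<open>1/2\<close> independently of its view, and forging is at most twice as likely as inverting.

  That all the circuits involved can be written down in polynomial time rests on closure of polynomial
  time under composition and under iteration with polynomially bounded intermediate results.
\<close>

section \<open>Programs on stacks\<close>

text \<open>Polynomial time is not closed under iteration as such: even a body that doubles a string
  makes lengths explode. Every loop below therefore comes with a bound on all intermediate stores,
  and the loops that write circuits keep the state that they read small, while their output is only
  prepended to. On the quantum side, an exact match with the one-wayness game leaves no room for
  approximation, so NOT and the inverse of the T gate are written exactly in the given gates. A
  circuit outputs an initial segment of its register, but its ancillas are appended at the end. This
  dictates the layouts: a zero qubit for the output must be present in front, either inside the
  public key or freed by swapping the challenge away, with \<open>n\<close> further zeros in case
  there are fewer than \<open>n\<close> challenge qubits. The forger measures its message between
  two stages, whereas the reduction is measured only at the end. Copying the message qubit onto a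
  zero qubit that is left alone afterwards has the same effect: each value of that qubit carries the
  unnormalised state of one outcome.\<close>

lemma poly_nat_mono: "x \<le> y \<Longrightarrow> poly p x \<le> poly p y" for p :: "nat poly"
  by (induction p) (auto intro!: add_mono mult_mono)

text \<open>Relocation makes a program usable as a subroutine: its stacks 0, 1, ... become a block
  above the stacks of the caller.\<close>

fun com_shift :: "nat \<Rightarrow> com \<Rightarrow> com" where
  "com_shift d Skip = Skip"
| "com_shift d (Push b i) = Push b (d + i)"
| "com_shift d (Pop i) = Pop (d + i)"
| "com_shift d (Seq c c') = Seq (com_shift d c) (com_shift d c')"
| "com_shift d (Branch i c c' c'') = Branch (d + i) (com_shift d c) (com_shift d c') (com_shift d c'')"
| "com_shift d (While i c) = While (d + i) (com_shift d c)"

text \<open>Only stacks that are pushed or popped count. The stacks tested by \<open>Branch\<close>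
  and \<open>While\<close> are left out, since a test changes nothing.\<close>

fun com_bound :: "com \<Rightarrow> nat" where
  "com_bound Skip = 0"
| "com_bound (Push b i) = Suc i"
| "com_bound (Pop i) = Suc i"
| "com_bound (Seq c c') = max (com_bound c) (com_bound c')"
| "com_bound (Branch i c c' c'') = max (com_bound c) (max (com_bound c') (com_bound c''))"
| "com_bound (While i c) = com_bound c"

lemma exec_com_shift:
  "exec c s n s' \<Longrightarrow> (\<And>i. S (d + i) = s i) \<Longrightarrow>
     exec (com_shift d c) S n (\<lambda>j. if j < d then S j else s' (j - d))"
proof (induction arbitrary: S rule: exec.induct)
  case (Skip s)
  have "(\<lambda>j. if j < d then S j else s (j - d)) = S"
    using Skip[symmetric] by (auto simp: fun_eq_iff)
  then show ?case using exec.Skip by simp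
next
  case (Push b i s)
  have "(\<lambda>j. if j < d then S j else (s(i := b # s i)) (j - d)) = S(d + i := b # S (d + i))"
    using Push[symmetric] by (auto simp: fun_eq_iff)
  then show ?case using exec.Push exec.Pop by simp
next
  case (Pop i s)
  have "(\<lambda>j. if j < d then S j else (s(i := tl (s i))) (j - d)) = S(d + i := tl (S (d + i)))"
    using Pop[symmetric] by (auto simp: fun_eq_iff)
  then show ?case using exec.Push exec.Pop by simp
next
  case (Seq c s n s' c' n' s'')
  let ?S' = "\<lambda>j. if j < d then S j else s' (j - d)"
  have 1: "exec (com_shift d c) S n ?S'" by (rule Seq.IH(1)) (rule Seq.prems)
  have 2: "exec (com_shift d c') ?S' n' (\<lambda>j. if j < d then ?S' j else s'' (j - d))"
    by (rule Seq.IH(2)) simp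
  have "(\<lambda>j. if j < d then ?S' j else s'' (j - d)) = (\<lambda>j. if j < d then S j else s'' (j - d))"
    by auto
  with exec.Seq[OF 1 2] show ?case by simp
next
  case (Branch_empty s i c n s' c' e)
  then show ?case by (simp add: exec.Branch_empty)
next
  case (Branch_False s i x c' n s' c e)
  then show ?case using exec.Branch_False[of S "d + i" x] by simp
next
  case (Branch_True s i x e n s' c c')
  then show ?case using exec.Branch_True[of S "d + i" x] by simp
next
  case (While_end s i c)
  have "(\<lambda>j. if j < d then S j else s (j - d)) = S"
    using While_end(2)[symmetric] by (auto simp: fun_eq_iff)
  then show ?case using While_end exec.While_end[of S "d + i"] by simp
next
  case (While_step s i c n s' n' s'')
  let ?S' = "\<lambda>j. if j < d then S j else s' (j - d)"
  have 1: "exec (com_shift d c) S n ?S'" by (rule While_step.IH(1)) (rule While_step.prems)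
  have 2: "exec (com_shift d (While i c)) ?S' n' (\<lambda>j. if j < d then ?S' j else s'' (j - d))"
    by (rule While_step.IH(2)) simp
  have eq: "(\<lambda>j. if j < d then ?S' j else s'' (j - d)) = (\<lambda>j. if j < d then S j else s'' (j - d))"
    by auto
  have "S (d + i) \<noteq> []" using While_step by simp
  from exec.While_step[OF this 1 2[simplified]] show ?case by (simp add: eq)
qed

lemma exec_frame: "exec c s n s' \<Longrightarrow> com_bound c \<le> i \<Longrightarrow> s' i = s i"
  by (induction rule: exec.induct) auto

text \<open>A step pushes at most one bit. So a program that runs in polynomial time leaves a store
  of polynomial size, and a second program started on it is again polynomial in the original
  input.\<close>

lemma exec_size: "exec c s n s' \<Longrightarrow> (\<Sum>i<d. length (s' i)) \<le> (\<Sum>i<d. length (s i)) + n"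
proof (induction rule: exec.induct)
  case (Push b i s)
  have "(\<Sum>j<d. length ((s(i := b # s i)) j)) \<le> (\<Sum>j<d. length (s j) + (if j = i then 1 else 0))"
    by (intro sum_mono) auto
  also have "\<dots> \<le> (\<Sum>j<d. length (s j)) + 1" by (simp add: sum.distrib)
  finally show ?case .
next
  case (Pop i s)
  have "(\<Sum>j<d. length ((s(i := tl (s i))) j)) \<le> (\<Sum>j<d. length (s j))"
    by (intro sum_mono) auto
  then show ?case by simp
qed auto

lemma exec_out_size: "exec c s n s' \<Longrightarrow> length (s' i) \<le> length (s i) + n"
proof (induction arbitrary: i rule: exec.induct)
  case (Seq c s n s' d n' s'')
  show ?case using Seq.IH[of i] by simp
next
  case (While_step s i c n s' n' s'' j)
  show ?case using While_step.IH[of j] by simp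
qed (auto simp: le_Suc_eq)

section \<open>Upper bounds on running times; moving, copying and clearing stacks\<close>

definition exec_within :: "com \<Rightarrow> store \<Rightarrow> nat \<Rightarrow> store \<Rightarrow> bool" where
  "exec_within c s t s' \<longleftrightarrow> (\<exists>n\<le>t. exec c s n s')"

lemma exec_within_mono: "exec_within c s t s' \<Longrightarrow> t \<le> t' \<Longrightarrow> exec_within c s t' s'"
  unfolding exec_within_def by (meson le_trans)

lemma exec_within_Seq:
  "exec_within c s t s' \<Longrightarrow> exec_within c' s' t' s'' \<Longrightarrow> exec_within (Seq c c') s (t + t') s''"
  unfolding exec_within_def by (meson add_mono exec.Seq)

definition rev_move :: "nat \<Rightarrow> nat \<Rightarrow> com" where
  "rev_move i j = While i (Branch i Skip (Seq (Push False j) (Pop i)) (Seq (Push True j) (Pop i)))"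

text \<open>Each bit costs a loop test, a branch, a push and a pop; the failing last test gives the
  \<open>+ 1\<close>. The empty case of the branch is never reached inside the loop.\<close>

lemma exec_rev_move:
  assumes "i \<noteq> j"
  shows "exec_within (rev_move i j) s (4 * length (s i) + 1) (s(j := rev (s i) @ s j, i := []))"
proof -
  have "exec (rev_move i j) s (4 * length x + 1) (s(j := rev x @ s j, i := []))" if "s i = x" for x
    using that
  proof (induction x arbitrary: s)
    case Nil
    then have "s(j := rev [] @ s j, i := []) = s" by (auto simp: fun_eq_iff)
    then show ?case using Nil exec.While_end by (simp add: rev_move_def)
  next
    case (Cons b x)
    define s1 where "s1 = s(j := b # s j, i := x)"
    have s1: "s1 = (s(j := b # s j))(i := tl ((s(j := b # s j)) i))"
      using Cons.prems assms by (auto simp: s1_def)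
    have P: "exec (Seq (Push b j) (Pop i)) s (1 + 1) s1"
      unfolding s1 by (rule exec.Seq[OF exec.Push exec.Pop])
    have B: "exec (Branch i Skip (Seq (Push False j) (Pop i)) (Seq (Push True j) (Pop i))) s (Suc (1 + 1)) s1"
    proof (cases b)
      case True
      show ?thesis
        by (rule exec.Branch_True[of _ _ x]) (use Cons.prems P True in auto)
    next
      case False
      show ?thesis
        by (rule exec.Branch_False[of _ _ x]) (use Cons.prems P False in auto)
    qed
    have IH: "exec (rev_move i j) s1 (4 * length x + 1) (s1(j := rev x @ s1 j, i := []))"
      by (rule Cons.IH) (simp add: s1_def)
    have eq: "s1(j := rev x @ s1 j, i := []) = s(j := rev (b # x) @ s j, i := [])"
      using assms by (auto simp: s1_def fun_eq_iff)
    have "exec (rev_move i j) s (Suc (Suc (1 + 1) + (4 * length x + 1))) (s1(j := rev x @ s1 j, i := []))"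
      unfolding rev_move_def
      by (rule exec.While_step[OF _ B]) (use Cons.prems IH in \<open>auto simp: rev_move_def\<close>)
    moreover have "Suc (Suc (1 + 1) + (4 * length x + 1)) = 4 * length (b # x) + 1" by simp
    ultimately show ?case unfolding eq by metis
  qed
  then show ?thesis unfolding exec_within_def by blast
qed

definition rev_move2 :: "nat \<Rightarrow> nat \<Rightarrow> nat \<Rightarrow> com" where
  "rev_move2 i j k = While i (Branch i Skip
     (Seq (Seq (Push False j) (Push False k)) (Pop i)) (Seq (Seq (Push True j) (Push True k)) (Pop i)))"

lemma exec_rev_move2:
  assumes "i \<noteq> j" "i \<noteq> k" "j \<noteq> k"
  shows "exec_within (rev_move2 i j k) s (5 * length (s i) + 1)
     (s(j := rev (s i) @ s j, k := rev (s i) @ s k, i := []))"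
proof -
  have "exec (rev_move2 i j k) s (5 * length x + 1) (s(j := rev x @ s j, k := rev x @ s k, i := []))"
    if "s i = x" for x
    using that
  proof (induction x arbitrary: s)
    case Nil
    then have "s(j := rev [] @ s j, k := rev [] @ s k, i := []) = s" by (auto simp: fun_eq_iff)
    then show ?case using Nil exec.While_end by (simp add: rev_move2_def)
  next
    case (Cons b x)
    define s0 where "s0 = s(j := b # s j, k := b # s k)"
    define s1 where "s1 = s(j := b # s j, k := b # s k, i := x)"
    have s0: "s0 = (s(j := b # s j))(k := b # (s(j := b # s j)) k)"
      using assms by (auto simp: s0_def)
    have s1: "s1 = s0(i := tl (s0 i))"
      using Cons.prems assms by (auto simp: s1_def s0_def)
    have P0: "exec (Seq (Push b j) (Push b k)) s (1 + 1) s0"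
      unfolding s0 by (rule exec.Seq[OF exec.Push exec.Push])
    have P: "exec (Seq (Seq (Push b j) (Push b k)) (Pop i)) s (1 + 1 + 1) s1"
      unfolding s1 by (rule exec.Seq[OF P0 exec.Pop])
    have B: "exec (Branch i Skip (Seq (Seq (Push False j) (Push False k)) (Pop i))
       (Seq (Seq (Push True j) (Push True k)) (Pop i))) s (Suc (1 + 1 + 1)) s1"
    proof (cases b)
      case True
      show ?thesis
        by (rule exec.Branch_True[of _ _ x]) (use Cons.prems P True in auto)
    next
      case False
      show ?thesis
        by (rule exec.Branch_False[of _ _ x]) (use Cons.prems P False in auto)
    qed
    have IH: "exec (rev_move2 i j k) s1 (5 * length x + 1)
        (s1(j := rev x @ s1 j, k := rev x @ s1 k, i := []))"
      by (rule Cons.IH) (simp add: s1_def)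
    have eq: "s1(j := rev x @ s1 j, k := rev x @ s1 k, i := [])
        = s(j := rev (b # x) @ s j, k := rev (b # x) @ s k, i := [])"
      using assms by (auto simp: s1_def fun_eq_iff)
    have "exec (rev_move2 i j k) s (Suc (Suc (1 + 1 + 1) + (5 * length x + 1)))
        (s1(j := rev x @ s1 j, k := rev x @ s1 k, i := []))"
      unfolding rev_move2_def
      by (rule exec.While_step[OF _ B]) (use Cons.prems IH in \<open>auto simp: rev_move2_def\<close>)
    moreover have "Suc (Suc (1 + 1 + 1) + (5 * length x + 1)) = 5 * length (b # x) + 1" by simp
    ultimately show ?case unfolding eq by metis
  qed
  then show ?thesis unfolding exec_within_def by blast
qed

definition clear :: "nat \<Rightarrow> com" where
  "clear i = While i (Pop i)"

lemma exec_clear: "exec_within (clear i) s (2 * length (s i) + 1) (s(i := []))"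
proof -
  have "exec (clear i) s (2 * length x + 1) (s(i := []))" if "s i = x" for x
    using that
  proof (induction x arbitrary: s)
    case Nil
    then have "s(i := []) = s" by auto
    then show ?case using Nil exec.While_end by (simp add: clear_def)
  next
    case (Cons b x)
    have IH: "exec (clear i) (s(i := tl (s i))) (2 * length x + 1) ((s(i := tl (s i)))(i := []))"
      by (rule Cons.IH) (simp add: Cons.prems)
    have "exec (clear i) s (Suc (1 + (2 * length x + 1))) ((s(i := tl (s i)))(i := []))"
      unfolding clear_def
      by (rule exec.While_step[OF _ exec.Pop]) (use Cons.prems IH in \<open>auto simp: clear_def\<close>)
    moreover have "Suc (1 + (2 * length x + 1)) = 2 * length (b # x) + 1" by simp
    ultimately show ?case unfolding fun_upd_upd by metis
  qed
  then show ?thesis unfolding exec_within_def by blast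
qed

fun clear_range :: "nat \<Rightarrow> nat \<Rightarrow> com" where
  "clear_range i 0 = Skip"
| "clear_range i (Suc n) = Seq (clear_range i n) (clear (i + n))"

lemma exec_clear_range:
  "exec_within (clear_range i n) s (2 * (\<Sum>j<n. length (s (i + j))) + n + 1)
     (\<lambda>j. if i \<le> j \<and> j < i + n then [] else s j)"
proof (induction n)
  case 0
  have "exec_within Skip s 1 s" unfolding exec_within_def by (blast intro: exec.intros)
  moreover have "(\<lambda>j. if i \<le> j \<and> j < i then [] else s j) = s" by (auto simp: fun_eq_iff)
  ultimately show ?case by simp
next
  case (Suc n)
  let ?s = "\<lambda>j. if i \<le> j \<and> j < i + n then [] else s j"
  have eq: "?s(i + n := []) = (\<lambda>j. if i \<le> j \<and> j < i + Suc n then [] else s j)"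
    by (auto simp: fun_eq_iff)
  from exec_within_Seq[OF Suc exec_clear[of "i + n"]] show ?case
    unfolding eq by (auto elim!: exec_within_mono)
qed

text \<open>Moving a stack destroys and reverses it. Hence the detour: everything goes to the
  scratch stack \<open>k\<close>, and from there back to \<open>i\<close> and \<open>j\<close> at
  once, which also undoes the reversal.\<close>

definition copy :: "nat \<Rightarrow> nat \<Rightarrow> nat \<Rightarrow> com" where
  "copy i j k = Seq (rev_move i k) (rev_move2 k i j)"

lemma exec_copy:
  assumes "i \<noteq> j" "i \<noteq> k" "j \<noteq> k" "s j = []" "s k = []"
  shows "exec_within (copy i j k) s (9 * length (s i) + 2) (s(j := s i))"
proof -
  let ?s = "s(k := rev (s i) @ s k, i := [])"
  have 1: "exec_within (rev_move i k) s (4 * length (s i) + 1) ?s"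
    by (rule exec_rev_move) (use assms in auto)
  have 2: "exec_within (rev_move2 k i j) ?s (5 * length (?s k) + 1)
     (?s(i := rev (?s k) @ ?s i, j := rev (?s k) @ ?s j, k := []))"
    by (rule exec_rev_move2) (use assms in auto)
  have eq: "?s(i := rev (?s k) @ ?s i, j := rev (?s k) @ ?s j, k := []) = s(j := s i)"
    using assms by (auto simp: fun_eq_iff)
  from exec_within_Seq[OF 1 2] show ?thesis
    unfolding eq copy_def using assms by (auto elim!: exec_within_mono)
qed

fun copies :: "nat list \<Rightarrow> nat \<Rightarrow> nat \<Rightarrow> com" where
  "copies [] d k = Skip"
| "copies (j # js) d k = Seq (copy j d k) (copies js (Suc d) k)"

lemma exec_copies:
  assumes "\<forall>j\<in>set js. j < d" "d + length js \<le> k" "\<And>i. d \<le> i \<Longrightarrow> i < d + length js \<Longrightarrow> s i = []" "s k = []"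
  shows "exec_within (copies js d k) s (9 * (\<Sum>j\<leftarrow>js. length (s j)) + 2 * length js + 1)
     (\<lambda>i. if d \<le> i \<and> i < d + length js then s (js ! (i - d)) else s i)"
  using assms
proof (induction js arbitrary: d s)
  case Nil
  have "exec_within Skip s 1 s" unfolding exec_within_def by (blast intro: exec.intros)
  moreover have "(\<lambda>i. if d \<le> i \<and> i < d then s ([] ! (i - d)) else s i) = s" by (auto simp: fun_eq_iff)
  ultimately show ?case by simp
next
  case (Cons j js)
  let ?s = "s(d := s j)"
  have 1: "exec_within (copy j d k) s (9 * length (s j) + 2) ?s"
    by (rule exec_copy) (use Cons.prems in auto)
  have 2: "exec_within (copies js (Suc d) k) ?s (9 * (\<Sum>j\<leftarrow>js. length (?s j)) + 2 * length js + 1)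
     (\<lambda>i. if Suc d \<le> i \<and> i < Suc d + length js then ?s (js ! (i - Suc d)) else ?s i)"
    by (rule Cons.IH) (use Cons.prems in \<open>auto simp: less_Suc_eq\<close>)
  \<comment> \<open>The sources lie below \<open>d\<close>, so filling stack \<open>d\<close> does
    not disturb the sources that are still to be copied.\<close>
  have m: "map (\<lambda>j. length (?s j)) js = map (\<lambda>j. length (s j)) js"
    using Cons.prems(1) by auto
  have eq: "(\<lambda>i. if Suc d \<le> i \<and> i < Suc d + length js then ?s (js ! (i - Suc d)) else ?s i)
     = (\<lambda>i. if d \<le> i \<and> i < d + length (j # js) then s ((j # js) ! (i - d)) else s i)"
  proof
    fix i
    consider "i = d" | "Suc d \<le> i" "i < Suc d + length js" | "i < d \<or> i \<ge> Suc d + length js" by linarith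
    then show "(if Suc d \<le> i \<and> i < Suc d + length js then ?s (js ! (i - Suc d)) else ?s i)
     = (if d \<le> i \<and> i < d + length (j # js) then s ((j # js) ! (i - d)) else s i)"
    proof cases
      case 2
      then have "js ! (i - Suc d) \<in> set js" by auto
      then have "js ! (i - Suc d) < d" using Cons.prems(1) by auto
      moreover have "i - d = Suc (i - Suc d)" using 2 by simp
      ultimately show ?thesis using 2 by auto
    qed auto
  qed
  from exec_within_Seq[OF 1 2[unfolded m]] show ?case
    unfolding eq by (auto elim!: exec_within_mono)
qed

text \<open>Stacks \<open>d, d + 1, \<dots>\<close> are scratch space, empty before and after.\<close>

definition clean :: "nat \<Rightarrow> store \<Rightarrow> bool" where
  "clean d s \<longleftrightarrow> (\<forall>i\<ge>d. s i = [])"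

section \<open>Polynomial-time transformations of clean stores\<close>

definition poly_com :: "nat \<Rightarrow> (store \<Rightarrow> store) \<Rightarrow> bool" where
  "poly_com d f \<longleftrightarrow> (\<exists>c (p :: nat poly). \<forall>s. clean d s \<longrightarrow>
     clean d (f s) \<and> exec_within c s (poly p (\<Sum>i<d. length (s i))) (f s))"

lemma sum_length_init_store:
  assumes "length xs \<le> d"
  shows "(\<Sum>i<d. length (init_store xs i)) = sum_list (map length xs)"
proof -
  have "(\<Sum>i<d. length (init_store xs i)) = (\<Sum>i<length xs. length (init_store xs i))"
    using assms by (intro sum.mono_neutral_right) (auto simp: init_store_def)
  also have "\<dots> = (\<Sum>i<length xs. length (xs ! i))"
    by (simp add: init_store_def)
  finally show ?thesis by (simp add: sum_list_sum_nth atLeast0LessThan)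
qed

lemma clean_init_store: "length xs \<le> d \<Longrightarrow> clean d (init_store xs)"
  by (auto simp: clean_def init_store_def)

lemma poly_timeI:
  assumes "\<And>xs. length xs = k \<Longrightarrow> exec_within c (init_store xs) (poly p (sum_list (map length xs))) (s xs)"
    and "\<And>xs. length xs = k \<Longrightarrow> s xs 0 = f xs"
  shows "poly_time k f"
  using assms unfolding poly_time_def exec_within_def by metis

lemma poly_time_poly_com:
  assumes "poly_com d f" "k \<le> d"
  shows "poly_time k (\<lambda>xs. f (init_store xs) 0)"
proof -
  from assms(1) obtain c p where c: "\<And>s. clean d s \<Longrightarrow> exec_within c s (poly p (\<Sum>i<d. length (s i))) (f s)"
    unfolding poly_com_def by blast
  show ?thesis
  proof (rule poly_timeI)
    fix xs :: "bits list" assume "length xs = k"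
    with assms(2) have "length xs \<le> d" by simp
    from c[OF clean_init_store[OF this]]
    show "exec_within c (init_store xs) (poly p (sum_list (map length xs))) (f (init_store xs))"
      unfolding sum_length_init_store[OF \<open>length xs \<le> d\<close>] .
  qed (rule refl)
qed

lemma poly_com_seq:
  assumes "poly_com d f" "poly_com d g"
  shows "poly_com d (\<lambda>s. g (f s))"
proof -
  from assms(1) obtain c p where c: "\<And>s. clean d s \<Longrightarrow> clean d (f s) \<and> exec_within c s (poly p (\<Sum>i<d. length (s i))) (f s)"
    unfolding poly_com_def by blast
  from assms(2) obtain c' p' where c': "\<And>s. clean d s \<Longrightarrow> clean d (g s) \<and> exec_within c' s (poly p' (\<Sum>i<d. length (s i))) (g s)"
    unfolding poly_com_def by blast
  show ?thesis unfolding poly_com_def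
  proof (intro exI allI impI)
    fix s assume s: "clean d s"
    let ?n = "\<Sum>i<d. length (s i)"
    note cs = c[OF s]
    then have "(\<Sum>i<d. length (f s i)) \<le> ?n + poly p ?n"
      unfolding exec_within_def using exec_size by (meson add_left_mono le_trans)
    then have "poly p' (\<Sum>i<d. length (f s i)) \<le> poly p' (?n + poly p ?n)"
      by (rule poly_nat_mono)
    moreover have "exec_within (Seq c c') s (poly p ?n + poly p' (\<Sum>i<d. length (f s i))) (g (f s))"
      using cs c' by (blast intro: exec_within_Seq)
    ultimately have "exec_within (Seq c c') s (poly (p + pcompose p' ([:0, 1:] + p)) ?n) (g (f s))"
      by (auto simp: poly_pcompose elim!: exec_within_mono)
    with cs c' show "clean d (g (f s)) \<and> exec_within (Seq c c') s (poly (p + pcompose p' ([:0, 1:] + p)) ?n) (g (f s))"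
      by blast
  qed
qed

text \<open>Turns a polynomial-time function into an assignment. The arguments are copied to fresh
  stacks from \<open>d\<close> on, the relocated program runs there, its output travels from
  \<open>d\<close> via \<open>d + B\<close> to \<open>i\<close> (reversed twice, hence intact), and
  the whole block is cleared. The arguments survive, apart from stack \<open>i\<close>
  itself.\<close>

lemma poly_com_assign:
  assumes "poly_time k f" "length js = k" "\<And>j. j \<in> set js \<Longrightarrow> j < d" "i < d"
  shows "poly_com d (\<lambda>s. s(i := f (map s js)))"
proof -
  from assms(1) obtain c p where c: "\<And>xs. length xs = k \<Longrightarrow>
     (\<exists>n s. exec c (init_store xs) n s \<and> s 0 = f xs \<and> n \<le> poly p (sum_list (map length xs)))"
    unfolding poly_time_def by blast
  \<comment> \<open>Larger than the number of arguments and than every stack that \<open>c\<close>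
    writes, so stack \<open>d + B\<close> stays empty during the subroutine and can serve as
    auxiliary stack before and after it.\<close>
  define B where "B = Suc (max k (com_bound c))"
  have B: "k < B" "com_bound c < B" by (auto simp: B_def)
  define C where "C = Seq (copies js d (d + B)) (Seq (com_shift d c) (Seq (clear i)
     (Seq (rev_move d (d + B)) (Seq (rev_move (d + B) i) (clear_range d B)))))"
  show ?thesis unfolding poly_com_def
  proof (intro exI allI impI)
    fix s assume s: "clean d s"
    then have s0: "s j = []" if "d \<le> j" for j using that by (auto simp: clean_def)
    let ?N = "\<Sum>i<d. length (s i)"
    let ?xs = "map s js"
    have len: "length (s j) \<le> ?N" if "j < d" for j
      by (rule member_le_sum) (use that in auto)
    have ssum: "(\<Sum>j\<leftarrow>js. length (s j)) \<le> k * ?N"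
      using sum_list_mono[of js "\<lambda>j. length (s j)" "\<lambda>_. ?N"] len assms(2,3) by (simp add: sum_list_triv)
    obtain n s' where s': "exec c (init_store ?xs) n s'" "s' 0 = f ?xs" "n \<le> poly p (sum_list (map length ?xs))"
      using c[of ?xs] assms(2) by auto
    have "sum_list (map length ?xs) \<le> k * ?N" using ssum by (simp add: comp_def)
    then have n: "n \<le> poly p (k * ?N)" using s'(3) poly_nat_mono le_trans by blast
    define s1 where "s1 = (\<lambda>j. if d \<le> j \<and> j < d + length js then s (js ! (j - d)) else s j)"
    have e1: "exec_within (copies js d (d + B)) s (9 * (\<Sum>j\<leftarrow>js. length (s j)) + 2 * length js + 1) s1"
      unfolding s1_def by (rule exec_copies) (use assms B s0 in auto)
    have s1d: "s1 (d + j) = init_store ?xs j" for j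
      by (auto simp: s1_def init_store_def s0)
    define s2 where "s2 = (\<lambda>j. if j < d then s1 j else s' (j - d))"
    have e2: "exec_within (com_shift d c) s1 n s2"
      unfolding exec_within_def s2_def using exec_com_shift[OF s'(1), of s1 d] s1d by blast
    define s3 where "s3 = s2(i := [])"
    have e3: "exec_within (clear i) s2 (2 * length (s2 i) + 1) s3"
      unfolding s3_def by (rule exec_clear)
    define s4 where "s4 = s3(d + B := rev (s3 d) @ s3 (d + B), d := [])"
    have e4: "exec_within (rev_move d (d + B)) s3 (4 * length (s3 d) + 1) s4"
      unfolding s4_def by (rule exec_rev_move) (use B in auto)
    define s5 where "s5 = s4(i := rev (s4 (d + B)) @ s4 i, d + B := [])"
    have e5: "exec_within (rev_move (d + B) i) s4 (4 * length (s4 (d + B)) + 1) s5"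
      unfolding s5_def by (rule exec_rev_move) (use assms(4) in auto)
    define s6 where "s6 = (\<lambda>j. if d \<le> j \<and> j < d + B then [] else s5 j)"
    have e6: "exec_within (clear_range d B) s5 (2 * (\<Sum>j<B. length (s5 (d + j))) + B + 1) s6"
      unfolding s6_def by (rule exec_clear_range)
    have s'B: "s' j = []" if "B \<le> j" for j
      using exec_frame[OF s'(1), of j] that B assms(2) by (auto simp: init_store_def)
    have lens': "length (s' j) \<le> n + k * ?N" for j
    proof -
      have "length (init_store ?xs j) \<le> k * ?N"
      proof (cases "j < length js")
        case True
        then have "length (init_store ?xs j) \<le> ?N" using len assms(3) by (auto simp: init_store_def)
        also have "\<dots> \<le> k * ?N" using True assms(2) by (cases k) auto
        finally show ?thesis .
      qed (auto simp: init_store_def)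
      then show ?thesis using exec_out_size[OF s'(1), of j] by simp
    qed
    have out: "s3 d = f ?xs" using assms(4) s'(2) by (simp add: s3_def s2_def)
    have s3B: "s3 (d + B) = []" using assms(4) s'B by (simp add: s3_def s2_def)
    have s4B: "s4 (d + B) = rev (f ?xs)" using B out s3B by (simp add: s4_def)
    have eq: "s6 = s(i := f ?xs)"
    proof
      fix j
      consider "j = i" | "j < d" "j \<noteq> i" | "d \<le> j" "j < d + B" | "j = d + B" | "j > d + B" by linarith
      then show "s6 j = (s(i := f ?xs)) j"
        by cases (use assms(4) s4B s0 s'B in \<open>auto simp: s6_def s5_def s4_def s3_def s2_def s1_def\<close>)
    qed
    have len5: "(\<Sum>j<B. length (s5 (d + j))) \<le> B * (n + k * ?N)"
    proof -
      have "length (s5 (d + j)) \<le> n + k * ?N" if "j < B" for j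
        using that lens'[of j] assms(4) by (auto simp: s5_def s4_def s3_def s2_def)
      then have "(\<Sum>j<B. length (s5 (d + j))) \<le> (\<Sum>j<B. n + k * ?N)" by (intro sum_mono) auto
      then show ?thesis by simp
    qed
    have len2: "length (s2 i) \<le> ?N" using assms(4) len by (simp add: s2_def s1_def)
    have lenf: "length (f ?xs) \<le> n + k * ?N" using lens'[of 0] s'(2) by simp
    have run: "exec_within C s (9 * (\<Sum>j\<leftarrow>js. length (s j)) + 2 * length js + 1 + (n + (2 * length (s2 i) + 1 +
       (4 * length (s3 d) + 1 + (4 * length (s4 (d + B)) + 1 + (2 * (\<Sum>j<B. length (s5 (d + j))) + B + 1)))))) s6"
      unfolding C_def by (rule exec_within_Seq[OF e1 exec_within_Seq[OF e2 exec_within_Seq[OF e3 exec_within_Seq[OF e4 exec_within_Seq[OF e5 e6]]]]])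
    have "9 * (\<Sum>j\<leftarrow>js. length (s j)) + 2 * length js + 1 + (n + (2 * length (s2 i) + 1 +
       (4 * length (s3 d) + 1 + (4 * length (s4 (d + B)) + 1 + (2 * (\<Sum>j<B. length (s5 (d + j))) + B + 1)))))
       \<le> 9 * (k * ?N) + 2 * k + 1 + (n + (2 * ?N + 1 + (4 * (n + k * ?N) + 1 + (4 * (n + k * ?N) + 1 +
          (2 * (B * (n + k * ?N)) + B + 1)))))"
      using ssum assms(2) len2 lenf out s4B len5 by (intro add_mono mult_mono) auto
    also have "\<dots> \<le> 9 * (k * ?N) + 2 * k + 1 + (poly p (k * ?N) + (2 * ?N + 1 + (4 * (poly p (k * ?N) + k * ?N) + 1 + (4 * (poly p (k * ?N) + k * ?N) + 1 +
          (2 * (B * (poly p (k * ?N) + k * ?N)) + B + 1)))))"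
      using n by (intro add_mono mult_mono) auto
    also have "\<dots> = poly (smult (9 * k) [:0, 1:] + [:2 * k + 1:] + (pcompose p [:0, k:] + ([:1, 2:] + 
      (smult 4 (pcompose p [:0, k:] + [:0, k:]) + [:1:] + (smult 4 (pcompose p [:0, k:] + [:0, k:]) + [:1:]
       + (smult (2 * B) (pcompose p [:0, k:] + [:0, k:]) + [:B + 1:])))))) ?N" (is "_ = poly ?P ?N")
      by (simp add: poly_pcompose algebra_simps)
    finally have "exec_within C s (poly ?P ?N) s6"
      by (rule exec_within_mono[OF run])
    then show "clean d (s(i := f ?xs)) \<and> exec_within C s (poly ?P ?N) (s(i := f ?xs))"
      using s assms(4) by (auto simp: eq clean_def)
  qed
qed

text \<open>Stack 0 is a counter that loses one bit per round. The bound \<open>q\<close> on the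
  size after \<open>j\<close> rounds does not depend on \<open>j\<close>; this makes each round cost
  at most \<open>poly p (poly q N)\<close> on a store of size \<open>N\<close>, where the time bound
  of the body alone would only give an iterated polynomial.\<close>

lemma poly_com_while:
  assumes f: "poly_com d f" and tl: "\<And>s. clean d s \<Longrightarrow> f s 0 = tl (s 0)"
    and q: "\<And>s j. clean d s \<Longrightarrow> j \<le> length (s 0) \<Longrightarrow>
       (\<Sum>i<d. length ((f ^^ j) s i)) \<le> poly q (\<Sum>i<d. length (s i))"
    and d: "0 < d"
  shows "poly_com d (\<lambda>s. (f ^^ length (s 0)) s)"
proof -
  from f obtain c p where c: "\<And>s. clean d s \<Longrightarrow> clean d (f s) \<and> exec_within c s (poly p (\<Sum>i<d. length (s i))) (f s)"
    unfolding poly_com_def by blast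
  have W: "clean d ((f ^^ L) s) \<and> exec_within (While 0 c) s (L * (poly p Z + 1) + 1) ((f ^^ L) s)"
    if "clean d s" "length (s 0) = L" "\<And>j. j \<le> L \<Longrightarrow> (\<Sum>i<d. length ((f ^^ j) s i)) \<le> Z" for s L Z
    using that
  proof (induction L arbitrary: s)
    case 0
    then show ?case using exec.While_end[of s 0 c] by (auto simp: exec_within_def)
  next
    case (Suc L)
    have IH: "clean d ((f ^^ L) (f s)) \<and> exec_within (While 0 c) (f s) (L * (poly p Z + 1) + 1) ((f ^^ L) (f s))"
    proof (rule Suc.IH)
      show "clean d (f s)" using c Suc.prems by blast
      show "length (f s 0) = L" using tl Suc.prems by simp
      show "(\<Sum>i<d. length ((f ^^ j) (f s) i)) \<le> Z" if "j \<le> L" for j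
        using Suc.prems(3)[of "Suc j"] that by (simp add: funpow_swap1)
    qed
    obtain n where n: "n \<le> poly p (\<Sum>i<d. length (s i))" "exec c s n (f s)"
      using c[OF Suc.prems(1)] unfolding exec_within_def by blast
    have "n \<le> poly p Z" using n(1) poly_nat_mono[OF Suc.prems(3)[of 0]] le_trans by fastforce
    obtain n' where n': "n' \<le> L * (poly p Z + 1) + 1" "exec (While 0 c) (f s) n' ((f ^^ L) (f s))"
      using IH unfolding exec_within_def by blast
    have "s 0 \<noteq> []" using Suc.prems(2) by auto
    from exec.While_step[OF this n(2) n'(2)]
    have "exec (While 0 c) s (Suc (n + n')) ((f ^^ Suc L) s)" by (simp add: funpow_swap1)
    moreover have "Suc (n + n') \<le> Suc L * (poly p Z + 1) + 1" using \<open>n \<le> poly p Z\<close> n'(1) by simp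
    ultimately have "exec_within (While 0 c) s (Suc L * (poly p Z + 1) + 1) ((f ^^ Suc L) s)"
      unfolding exec_within_def by blast
    then show ?case using IH by (simp add: funpow_swap1)
  qed
  show ?thesis unfolding poly_com_def
  proof (intro exI allI impI)
    fix s assume s: "clean d s"
    let ?N = "\<Sum>i<d. length (s i)"
    have w: "clean d ((f ^^ length (s 0)) s) \<and> exec_within (While 0 c) s (length (s 0) * (poly p (poly q ?N) + 1) + 1) ((f ^^ length (s 0)) s)"
      by (rule W) (use s q in auto)
    have "length (s 0) \<le> ?N" by (rule member_le_sum) (use d in auto)
    then have "length (s 0) * (poly p (poly q ?N) + 1) + 1 \<le> ?N * (poly p (poly q ?N) + 1) + 1"
      by (intro add_mono mult_mono) auto
    also have "\<dots> = poly ([:0, 1:] * (pcompose p q + [:1:]) + [:1:]) ?N"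
      by (simp add: poly_pcompose)
    finally show "clean d ((f ^^ length (s 0)) s) \<and> exec_within (While 0 c) s (poly ([:0, 1:] * (pcompose p q + [:1:]) + [:1:]) ?N) ((f ^^ length (s 0)) s)"
      using w exec_within_mono by blast
  qed
qed

section \<open>Closure properties of polynomial time\<close>

lemma poly_time_cong:
  assumes "\<And>xs. length xs = k \<Longrightarrow> f xs = g xs"
  shows "poly_time k f \<longleftrightarrow> poly_time k g"
proof -
  have "poly_time k g" if "poly_time k f" "\<And>xs. length xs = k \<Longrightarrow> f xs = g xs" for f g
    using that unfolding poly_time_def by metis
  then show ?thesis using assms by metis
qed

lemma poly_time_hd:
  assumes "0 < k"
  shows "poly_time k (\<lambda>xs. xs ! 0)"
proof (rule poly_timeI[where p = "[:1:]"])
  fix xs :: "bits list"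
  show "exec_within Skip (init_store xs) (poly [:1:] (sum_list (map length xs))) (init_store xs)"
    using exec.Skip[of "init_store xs"] by (auto simp: exec_within_def)
next
  show "init_store xs 0 = xs ! 0" if "length xs = k" for xs :: "bits list"
    using that assms by (auto simp: init_store_def)
qed

lemma poly_time_Cons_hd: "poly_time 1 (\<lambda>xs. b # xs ! 0)"
proof (rule poly_timeI[where p = "[:1:]"])
  fix xs :: "bits list"
  show "exec_within (Push b 0) (init_store xs) (poly [:1:] (sum_list (map length xs)))
      ((init_store xs)(0 := b # init_store xs 0))"
    using exec.Push[of b 0 "init_store xs"] by (auto simp: exec_within_def)
next
  show "((init_store xs)(0 := b # init_store xs 0)) 0 = b # xs ! 0" if "length xs = 1" for xs :: "bits list"
    using that by (auto simp: init_store_def)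
qed

lemma poly_time_tl_hd: "poly_time 1 (\<lambda>xs. tl (xs ! 0))"
proof (rule poly_timeI[where p = "[:1:]"])
  fix xs :: "bits list"
  show "exec_within (Pop 0) (init_store xs) (poly [:1:] (sum_list (map length xs)))
      ((init_store xs)(0 := tl (init_store xs 0)))"
    using exec.Pop[of 0 "init_store xs"] by (auto simp: exec_within_def)
next
  show "((init_store xs)(0 := tl (init_store xs 0))) 0 = tl (xs ! 0)" if "length xs = 1" for xs :: "bits list"
    using that by (auto simp: init_store_def)
qed

lemma poly_time_Nil: "poly_time k (\<lambda>xs. [])"
proof (rule poly_timeI[where p = "[:1, 2:]"])
  fix xs :: "bits list"
  have "length (init_store xs 0) \<le> sum_list (map length xs)"
    by (cases xs) (auto simp: init_store_def)
  then show "exec_within (clear 0) (init_store xs) (poly [:1, 2:] (sum_list (map length xs))) ((init_store xs)(0 := []))"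
    using exec_clear[of 0 "init_store xs"] by (auto elim!: exec_within_mono)
qed simp

lemma poly_time_length_bound:
  assumes "poly_time k f"
  obtains p :: "nat poly" where
    "\<And>xs. length xs = k \<Longrightarrow> length (f xs) \<le> poly p (sum_list (map length xs))"
proof -
  from assms obtain c and p :: "nat poly" where c: "\<And>xs. length xs = k \<Longrightarrow>
      (\<exists>n s. exec c (init_store xs) n s \<and> s 0 = f xs \<and> n \<le> poly p (sum_list (map length xs)))"
    unfolding poly_time_def by blast
  have "length (f xs) \<le> poly ([:0, 1:] + p) (sum_list (map length xs))" if xs: "length xs = k" for xs
  proof -
    obtain n s where s: "exec c (init_store xs) n s" "s 0 = f xs" "n \<le> poly p (sum_list (map length xs))"
      using c[OF xs] by blast
    have "length (init_store xs 0) \<le> sum_list (map length xs)"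
      by (cases xs) (auto simp: init_store_def)
    then show ?thesis using exec_out_size[OF s(1), of 0] s(2,3) by simp
  qed
  then show ?thesis using that by blast
qed

lemma poly_com_id: "poly_com d (\<lambda>s. s)"
proof -
  have "exec_within Skip s (poly [:1:] N) s" for s N
    unfolding exec_within_def using exec.Skip[of s] by auto
  then show ?thesis unfolding poly_com_def by blast
qed

lemma poly_com_pop:
  assumes "i < d"
  shows "poly_com d (\<lambda>s. s(i := tl (s i)))"
  using poly_com_assign[OF poly_time_tl_hd, of "[i]" d i] assms by simp

lemma poly_com_branch:
  assumes "poly_com d f" "poly_com d g" "poly_com d h"
  shows "poly_com d (\<lambda>s. case s i of [] \<Rightarrow> f s | b # _ \<Rightarrow> if b then h s else g s)" (is "poly_com d ?b")
proof -
  from assms(1) obtain c1 p1 where c1: "\<And>s. clean d s \<Longrightarrow> clean d (f s) \<and> exec_within c1 s (poly p1 (\<Sum>i<d. length (s i))) (f s)"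
    unfolding poly_com_def by blast
  from assms(2) obtain c2 p2 where c2: "\<And>s. clean d s \<Longrightarrow> clean d (g s) \<and> exec_within c2 s (poly p2 (\<Sum>i<d. length (s i))) (g s)"
    unfolding poly_com_def by blast
  from assms(3) obtain c3 p3 where c3: "\<And>s. clean d s \<Longrightarrow> clean d (h s) \<and> exec_within c3 s (poly p3 (\<Sum>i<d. length (s i))) (h s)"
    unfolding poly_com_def by blast
  show ?thesis unfolding poly_com_def
  proof (intro exI allI impI)
    fix s assume s: "clean d s"
    let ?N = "\<Sum>i<d. length (s i)"
    obtain n1 where n1: "n1 \<le> poly p1 ?N" "exec c1 s n1 (f s)" using c1[OF s] by (auto simp: exec_within_def)
    obtain n2 where n2: "n2 \<le> poly p2 ?N" "exec c2 s n2 (g s)" using c2[OF s] by (auto simp: exec_within_def)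
    obtain n3 where n3: "n3 \<le> poly p3 ?N" "exec c3 s n3 (h s)" using c3[OF s] by (auto simp: exec_within_def)
    have "\<exists>n \<le> Suc (n1 + n2 + n3). exec (Branch i c1 c2 c3) s n (?b s)"
    proof (cases "s i")
      case Nil
      from exec.Branch_empty[OF Nil n1(2)] show ?thesis by (intro exI[of _ "Suc n1"]) (auto simp: Nil)
    next
      case (Cons b x)
      show ?thesis
      proof (cases b)
        case True
        show ?thesis
          using exec.Branch_True[of s i x, OF _ n3(2)] True Cons by (intro exI[of _ "Suc n3"]) auto
      next
        case False
        show ?thesis
          using exec.Branch_False[of s i x, OF _ n2(2)] False Cons by (intro exI[of _ "Suc n2"]) auto
      qed
    qed
    moreover have "Suc (n1 + n2 + n3) \<le> poly ([:1:] + p1 + p2 + p3) ?N" using n1 n2 n3 by simp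
    ultimately have "exec_within (Branch i c1 c2 c3) s (poly ([:1:] + p1 + p2 + p3) ?N) (?b s)"
      unfolding exec_within_def by (meson le_trans)
    moreover have "clean d (?b s)" using c1[OF s] c2[OF s] c3[OF s] by (auto split: list.split)
    ultimately show "clean d (?b s) \<and> exec_within (Branch i c1 c2 c3) s (poly ([:1:] + p1 + p2 + p3) ?N) (?b s)"
      by blast
  qed
qed

text \<open>All targets lie above all arguments, so assignments made one after the other amount to a
  simultaneous one.\<close>

lemma poly_com_assigns:
  assumes "\<And>j. j < m \<Longrightarrow> poly_time k (\<lambda>xs. F j xs)" "length js = k" "\<And>j. j \<in> set js \<Longrightarrow> j < a" "a + m \<le> d"
  shows "poly_com d (\<lambda>s i. if a \<le> i \<and> i < a + m then F (i - a) (map s js) else s i)"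
  using assms(1,4)
proof (induction m)
  case 0
  have "(\<lambda>s i. if a \<le> i \<and> i < a + 0 then F (i - a) (map s js) else s i) = (\<lambda>s :: store. s)"
    by (auto simp: fun_eq_iff)
  then show ?case using poly_com_id by simp
next
  case (Suc m)
  let ?A = "\<lambda>(s :: store) i. if a \<le> i \<and> i < a + m then F (i - a) (map s js) else s i"
  have 1: "poly_com d ?A" using Suc by simp
  have 2: "poly_com d (\<lambda>s. s(a + m := F m (map s js)))"
    by (rule poly_com_assign[where k = k and f = "F m" and js = js]) (use Suc.prems assms(2,3) in force)+
  have "map (?A s) js = map s js" for s using assms(3) by force
  then have "(\<lambda>s. (?A s)(a + m := F m (map (?A s) js))) =
      (\<lambda>s. (?A s)(a + m := F m (map s js)))" by metis
  also have "\<dots> = (\<lambda>s i. if a \<le> i \<and> i < a + Suc m then F (i - a) (map s js) else s i)"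
    by (auto simp: fun_eq_iff)
  finally have "(\<lambda>s. (?A s)(a + m := F m (map (?A s) js))) =
      (\<lambda>s i. if a \<le> i \<and> i < a + Suc m then F (i - a) (map s js) else s i)" .
  with poly_com_seq[OF 1 2] show ?case by simp
qed

text \<open>The intermediate values go to stacks above the inputs, so that every \<open>g j\<close>
  still finds the inputs unchanged.\<close>

lemma poly_time_comp:
  assumes f: "poly_time m f" and g: "\<And>j. j < m \<Longrightarrow> poly_time k (\<lambda>xs. g j xs)"
  shows "poly_time k (\<lambda>xs. f (map (\<lambda>j. g j xs) [0..<m]))"
proof -
  \<comment> \<open>The successor keeps stack 0 available for the result even if \<open>k\<close>
    and \<open>m\<close> are both zero.\<close>
  let ?d = "Suc (k + m)"
  let ?A = "\<lambda>(s :: store) i. if k \<le> i \<and> i < k + m then g (i - k) (map s [0..<k]) else s i"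
  have 1: "poly_com ?d ?A" by (rule poly_com_assigns[where F = g and js = "[0..<k]" and a = k and m = m]) (use g in auto)
  have 2: "poly_com ?d (\<lambda>s. s(0 := f (map s [k..<k + m])))"
    by (rule poly_com_assign[OF f, of "[k..<k + m]"]) auto
  have 3: "poly_time k (\<lambda>xs. ((?A (init_store xs))(0 := f (map (?A (init_store xs)) [k..<k + m]))) 0)"
    by (rule poly_time_poly_com[OF poly_com_seq[OF 1 2]]) auto
  show ?thesis
  proof (rule poly_time_cong[THEN iffD1, OF _ 3])
    fix xs :: "bits list" assume that: "length xs = k"
    have eq: "map (init_store xs) [0..<k] = xs"
      using that by (intro nth_equalityI) (auto simp: init_store_def)
    have "map (?A (init_store xs)) [k..<k + m] = map (\<lambda>j. g j xs) [0..<m]"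
      by (rule nth_equalityI) (simp_all add: eq)
    then show "((?A (init_store xs))(0 := f (map (?A (init_store xs)) [k..<k + m]))) 0 =
        f (map (\<lambda>j. g j xs) [0..<m])" by (simp only: fun_upd_same)
  qed
qed

lemma poly_time_comp_list:
  assumes "poly_time (length gs) f" "\<And>g. g \<in> set gs \<Longrightarrow> poly_time k g"
  shows "poly_time k (\<lambda>xs. f (map (\<lambda>g. g xs) gs))"
proof -
  have "map (\<lambda>j. (gs ! j) xs) [0..<length gs] = map (\<lambda>g. g xs) gs" for xs
    by (rule nth_equalityI) auto
  then show ?thesis using poly_time_comp[OF assms(1), of k "\<lambda>j. gs ! j"] assms(2) by simp
qed

lemma poly_time_comp1: "poly_time 1 f \<Longrightarrow> poly_time k g \<Longrightarrow> poly_time k (\<lambda>xs. f [g xs])"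
  using poly_time_comp_list[of "[g]" f k] by simp

lemma poly_time_comp2:
  "poly_time 2 f \<Longrightarrow> poly_time k g1 \<Longrightarrow> poly_time k g2 \<Longrightarrow> poly_time k (\<lambda>xs. f [g1 xs, g2 xs])"
  by (rule poly_time_comp_list[of "[g1, g2]" f k, simplified]) (auto simp: eval_nat_numeral)

lemma poly_time_comp3:
  "poly_time 3 f \<Longrightarrow> poly_time k g1 \<Longrightarrow> poly_time k g2 \<Longrightarrow> poly_time k g3 \<Longrightarrow>
    poly_time k (\<lambda>xs. f [g1 xs, g2 xs, g3 xs])"
  by (rule poly_time_comp_list[of "[g1, g2, g3]" f k, simplified]) (auto simp: eval_nat_numeral)

lemma poly_time_comp4:
  "poly_time 4 f \<Longrightarrow> poly_time k g1 \<Longrightarrow> poly_time k g2 \<Longrightarrow> poly_time k g3 \<Longrightarrow> poly_time k g4 \<Longrightarrow>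
    poly_time k (\<lambda>xs. f [g1 xs, g2 xs, g3 xs, g4 xs])"
  by (rule poly_time_comp_list[of "[g1, g2, g3, g4]" f k, simplified]) (auto simp: eval_nat_numeral)

lemma poly_time_nth:
  assumes "i < k"
  shows "poly_time k (\<lambda>xs. xs ! i)"
proof -
  have "poly_com k (\<lambda>s. s(0 := map s [i] ! 0))"
    by (rule poly_com_assign[OF poly_time_hd[of 1]]) (use assms in auto)
  from poly_time_poly_com[OF this, of k] have "poly_time k (\<lambda>xs. init_store xs i)" by simp
  then show ?thesis
    by (rule poly_time_cong[THEN iffD1, rotated]) (use assms in \<open>auto simp: init_store_def\<close>)
qed

lemma poly_time_tl_args:
  assumes "poly_time k f"
  shows "poly_time (Suc k) (\<lambda>xs. f (tl xs))"
proof -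
  have "poly_time (Suc k) (\<lambda>xs. f (map (\<lambda>j. xs ! Suc j) [0..<k]))"
    by (rule poly_time_comp[OF assms]) (auto intro: poly_time_nth)
  then show ?thesis
    by (rule poly_time_cong[THEN iffD1, rotated])
      (auto intro!: arg_cong[where f = f] nth_equalityI simp: nth_tl)
qed

text \<open>Replaces the first argument by several values computed from it and the other arguments.
  It serves to pass the decoded qubit indices of a gate in front of the remaining
  parameters.\<close>

lemma poly_time_append_args:
  assumes "poly_time (length gs + k) f" "\<And>g. g \<in> set gs \<Longrightarrow> poly_time (Suc k) g"
  shows "poly_time (Suc k) (\<lambda>xs. f (map (\<lambda>g. g xs) gs @ tl xs))"
proof -
  have "poly_time (Suc k) (\<lambda>xs. f (map (\<lambda>g. g xs) (gs @ map (\<lambda>j xs. xs ! Suc j) [0..<k])))"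
    by (rule poly_time_comp_list) (use assms in \<open>auto intro: poly_time_nth\<close>)
  then show ?thesis
  proof (rule poly_time_cong[THEN iffD1, rotated])
    fix xs :: "bits list" assume "length xs = Suc k"
    then have "map (\<lambda>j. xs ! Suc j) [0..<k] = tl xs"
      by (intro nth_equalityI) (auto simp: nth_tl)
    then show "f (map (\<lambda>g. g xs) (gs @ map (\<lambda>j xs. xs ! Suc j) [0..<k])) = f (map (\<lambda>g. g xs) gs @ tl xs)"
      by (simp add: comp_def)
  qed
qed

lemma poly_time_Cons: "poly_time k f \<Longrightarrow> poly_time k (\<lambda>xs. b # f xs)"
  using poly_time_comp1[OF poly_time_Cons_hd] by simp

lemma poly_time_tl: "poly_time k f \<Longrightarrow> poly_time k (\<lambda>xs. tl (f xs))"
  using poly_time_comp1[OF poly_time_tl_hd] by simp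

lemma poly_time_const: "poly_time k (\<lambda>xs. x)"
  by (induction x) (auto intro: poly_time_Nil poly_time_Cons)

text \<open>All three results are computed in advance and placed in stacks 1 to 3, with the string
  to be tested in stack 0. This costs only polynomially more than choosing first, and reduces the
  choice to a branch between copies.\<close>

lemma poly_time_case:
  assumes "poly_time k c" "poly_time k f" "poly_time k g" "poly_time k h"
  shows "poly_time k (\<lambda>xs. case c xs of [] \<Rightarrow> f xs | b # _ \<Rightarrow> if b then h xs else g xs)"
proof -
  have A: "poly_com 4 (\<lambda>s. s(0 := s i))" if "i < 4" for i
    using poly_com_assign[OF poly_time_hd[of 1], of "[i]" 4 0] that by auto
  let ?f = "\<lambda>s :: store. case s 0 of [] \<Rightarrow> s(0 := s 1) | b # _ \<Rightarrow> if b then s(0 := s 3) else s(0 := s 2)"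
  have "poly_com 4 ?f"
    by (intro poly_com_branch A) auto
  from poly_time_poly_com[OF this, of 4] have "poly_time 4 (\<lambda>xs. ?f (init_store xs) 0)" by simp
  from poly_time_comp4[OF this assms]
  have P: "poly_time k (\<lambda>xs. ?f (init_store [c xs, f xs, g xs, h xs]) 0)" .
  have "?f (init_store [u, v, w, z]) 0 = (case u of [] \<Rightarrow> v | b # _ \<Rightarrow> if b then z else w)" for u v w z :: bits
    by (auto simp: init_store_def split: list.split)
  with P show ?thesis by simp
qed

lemma sum_lessThan_split3: "(\<Sum>i<Suc (2 * m). f i) = f 0 + (\<Sum>i<m. f (Suc i)) + (\<Sum>i<m. f (Suc m + i))"
  for f :: "nat \<Rightarrow> nat"
proof -
  have "(\<Sum>i<m + n. g i) = (\<Sum>i<m. g i) + (\<Sum>i<n. g (m + i))" for n and g :: "nat \<Rightarrow> nat"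
    by (induction n) auto
  from this[of "\<lambda>i. f (Suc i)" m]
  show ?thesis by (simp add: sum.lessThan_Suc_shift mult_2 del: sum.lessThan_Suc)
qed

text \<open>Stack 0 holds the counter, the next \<open>m\<close> stacks the current vector and
  \<open>m\<close> more the next vector. Two blocks are used because every component of the new
  vector may depend on every component of the old one, which must not be overwritten too early. The
  size bound may depend on the number of rounds, since the counter is itself an input.\<close>

lemma poly_time_funpow:
  assumes len: "\<And>v. length v = m \<Longrightarrow> length (step v) = m"
    and step: "\<And>i. i < m \<Longrightarrow> poly_time m (\<lambda>v. step v ! i)"
    and q: "\<And>n v. length v = m \<Longrightarrow>
      sum_list (map length ((step ^^ n) v)) \<le> poly q (n + sum_list (map length v))"
    and i: "i < m"
  shows "poly_time (Suc m) (\<lambda>xs. (step ^^ length (hd xs)) (tl xs) ! i)"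
proof -
  let ?d = "Suc (2 * m)"
  define st where "st = (\<lambda>s :: store. map s [1..<Suc m])"
  have st: "length (st s) = m" "\<And>j. j < m \<Longrightarrow> st s ! j = s (Suc j)" for s
    by (auto simp: st_def simp del: upt_Suc)
  define A where "A = (\<lambda>(s :: store) i. if Suc m \<le> i \<and> i < Suc m + m then step (st s) ! (i - Suc m) else s i)"
  define B where "B = (\<lambda>(s :: store) i. if 1 \<le> i \<and> i < 1 + m then s (m + i) else s i)"
  define f where "f = (\<lambda>s. B (A (s(0 := tl (s 0)))))"
  have pA: "poly_com ?d A"
    unfolding A_def st_def
    by (rule poly_com_assigns[where F = "\<lambda>j v. step v ! j" and js = "[1..<Suc m]" and a = "Suc m" and m = m])
      (use step in auto)
  have pB: "poly_com ?d (\<lambda>s i. if 1 \<le> i \<and> i < 1 + r then s (m + i) else s i)" if "r \<le> m" for r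
    using that
  proof (induction r)
    case 0
    have "(\<lambda>s i. if 1 \<le> i \<and> i < 1 + 0 then s (m + i) else s i) = (\<lambda>s :: store. s)"
      by (auto simp: fun_eq_iff)
    then show ?case using poly_com_id by simp
  next
    case (Suc r)
    have 1: "poly_com ?d (\<lambda>s i. if 1 \<le> i \<and> i < 1 + r then s (m + i) else s i)" using Suc by simp
    have 2: "poly_com ?d (\<lambda>s. s(Suc r := s (m + Suc r)))"
      using poly_com_assign[OF poly_time_hd[of 1], of "[m + Suc r]" ?d "Suc r"] Suc.prems by simp
    have "(\<lambda>(s :: store) i. if 1 \<le> i \<and> i < 1 + Suc r then s (m + i) else s i) =
       (\<lambda>s. (\<lambda>s. s(Suc r := s (m + Suc r))) ((\<lambda>s i. if 1 \<le> i \<and> i < 1 + r then s (m + i) else s i) s))"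
      using Suc.prems by (auto simp: fun_eq_iff)
    with poly_com_seq[OF 1 2] show ?case by simp
  qed
  have pf: "poly_com ?d f"
    unfolding f_def
    by (rule poly_com_seq[OF poly_com_seq[OF poly_com_pop pA] pB[OF order.refl, folded B_def]]) simp
  have st_pop: "st (s(0 := x)) = st s" for s x
    by (auto simp: st_def)
  have f0: "f s 0 = tl (s 0)" for s
    by (simp add: f_def A_def B_def)
  have f1: "f s (Suc j) = step (st s) ! j" if "j < m" for s j
    using that by (simp add: f_def A_def B_def st_pop)
  have f2: "f s (Suc m + j) = step (st s) ! j" if "j < m" for s j
    using that by (simp add: f_def A_def B_def st_pop)
  have stf: "st (f s) = step (st s)" for s
    using f1 by (intro nth_equalityI) (auto simp: st len)
  have fn0: "length ((f ^^ n) s 0) \<le> length (s 0)" for n s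
    by (induction n) (auto simp: f0)
  have stfn: "st ((f ^^ n) s) = (step ^^ n) (st s)" for n s
    by (induction n) (auto simp: stf)
  have sz: "(\<Sum>j<m. length (s (Suc j))) = sum_list (map length (st s))" for s
    by (simp add: st sum_list_sum_nth atLeast0LessThan)
  have "poly_com ?d (\<lambda>s. (f ^^ length (s 0)) s)"
  proof (rule poly_com_while[OF pf f0])
    fix s j assume s: "clean ?d s" "j \<le> length (s 0)"
    let ?N = "\<Sum>i<?d. length (s i)"
    \<comment> \<open>After at least one round both blocks hold the same vector, whence the factor
      2; the linear summand covers the counter, and also the initial store, whose second block is
      arbitrary.\<close>
    show "(\<Sum>i<?d. length ((f ^^ j) s i)) \<le> poly ([:0, 1:] + smult 2 q) ?N"
    proof (cases j)
      case (Suc j')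
      have 1: "(\<Sum>i<m. length ((f ^^ j) s (Suc i))) = sum_list (map length ((step ^^ j) (st s)))"
        unfolding sz stfn ..
      have "(\<Sum>i<m. length ((f ^^ j) s (Suc m + i))) = (\<Sum>i<m. length ((f ^^ j) s (Suc i)))"
        unfolding Suc using f1 f2 by (intro sum.cong) auto
      moreover have "length ((f ^^ j) s 0) \<le> ?N"
        using fn0[of j s] unfolding sum_lessThan_split3 by simp
      moreover have "sum_list (map length ((step ^^ j) (st s))) \<le> poly q (j + sum_list (map length (st s)))"
        by (rule q) (rule st)
      moreover have "j + sum_list (map length (st s)) \<le> ?N"
        using s(2) unfolding sz[symmetric] sum_lessThan_split3 by simp
      then have "poly q (j + sum_list (map length (st s))) \<le> poly q ?N" by (rule poly_nat_mono)
      ultimately show ?thesis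
        unfolding sum_lessThan_split3[of "\<lambda>i. length ((f ^^ j) s i)"] using 1 by simp
    qed simp
  qed simp
  from poly_com_seq[OF this poly_com_assign[OF poly_time_hd[of 1], of "[Suc i]" ?d 0]] i
  have "poly_com ?d (\<lambda>s. ((f ^^ length (s 0)) s)(0 := (f ^^ length (s 0)) s (Suc i)))"
    by simp
  from poly_time_poly_com[OF this, of "Suc m"] i
  have "poly_time (Suc m) (\<lambda>xs. (f ^^ length (init_store xs 0)) (init_store xs) (Suc i))" by simp
  then show ?thesis
  proof (rule poly_time_cong[THEN iffD1, rotated])
    fix xs :: "bits list" assume xs: "length xs = Suc m"
    then have "st (init_store xs) = tl xs"
      by (intro nth_equalityI) (auto simp: st init_store_def nth_tl)
    moreover have "init_store xs 0 = hd xs" using xs by (cases xs) (auto simp: init_store_def)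
    ultimately show "(f ^^ length (init_store xs 0)) (init_store xs) (Suc i) = (step ^^ length (hd xs)) (tl xs) ! i"
      using stfn st(2)[OF i] by metis
  qed
qed

lemma poly_time_if_hd:
  assumes "poly_time k c" "poly_time k f" "poly_time k g"
  shows "poly_time k (\<lambda>xs. if c xs \<noteq> [] \<and> hd (c xs) then f xs else g xs)"
proof -
  have "(case u of [] \<Rightarrow> w | b # _ \<Rightarrow> if b then v else w) = (if u \<noteq> [] \<and> hd u then v else w)" for u and v w :: bits
    by (auto split: list.split)
  then show ?thesis using poly_time_case[OF assms(1,3,3,2)] by simp
qed

lemma poly_time_if_Nil:
  assumes "poly_time k c" "poly_time k f" "poly_time k g"
  shows "poly_time k (\<lambda>xs. if c xs = [] then f xs else g xs)"
proof -
  have "(case u of [] \<Rightarrow> v | b # _ \<Rightarrow> if b then w else w) = (if u = [] then v else w)" for u and v w :: bits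
    by (auto split: list.split)
  then show ?thesis using poly_time_case[OF assms(1,2,3,3)] by simp
qed

lemma poly_time_rev_append:
  assumes "poly_time k f" "poly_time k g"
  shows "poly_time k (\<lambda>xs. rev (f xs) @ g xs)"
proof -
  define step :: "bits list \<Rightarrow> bits list" where
    "step v = [tl (v ! 0), if v ! 0 = [] then v ! 1 else if v ! 0 \<noteq> [] \<and> hd (v ! 0) then True # v ! 1 else False # v ! 1]" for v
  have step: "(step ^^ length x) [x, y] = [[], rev x @ y]" for x y
  proof (induction x arbitrary: y)
    case (Cons b x)
    have "step [b # x, y] = [x, b # y]" by (simp add: step_def)
    with Cons show ?case by (simp add: funpow_swap1)
  qed simp
  have "poly_time (Suc 2) (\<lambda>xs. (step ^^ length (hd xs)) (tl xs) ! 1)"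
  \<comment> \<open>A step moves one bit or does nothing, so the total length never grows and the
    identity polynomial bounds it.\<close>
  proof (rule poly_time_funpow[where q = "[:0, 1:]"])
    show "poly_time 2 (\<lambda>v. step v ! i)" if "i < 2" for i
    proof -
      have "i = 0 \<or> i = 1" using that by linarith
      then show ?thesis
      proof
        assume "i = 0"
        then show ?thesis unfolding step_def by (simp add: poly_time_tl poly_time_nth)
      next
        assume "i = 1"
        have "poly_time 2 (\<lambda>v. if v ! 0 = [] then v ! 1 else if v ! 0 \<noteq> [] \<and> hd (v ! 0) then True # v ! 1 else False # v ! 1)"
          by (intro poly_time_if_Nil poly_time_if_hd poly_time_Cons poly_time_nth) auto
        then show ?thesis unfolding step_def \<open>i = 1\<close> by (simp only: nth_Cons_Suc nth_Cons_0 One_nat_def)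
      qed
    qed
    show "sum_list (map length ((step ^^ n) v)) \<le> poly [:0, 1:] (n + sum_list (map length v))"
      if "length v = 2" for n and v :: "bits list"
    proof -
      have "length ((step ^^ n) v) = 2 \<and> sum_list (map length ((step ^^ n) v)) \<le> sum_list (map length v)"
      proof (induction n)
        case (Suc n)
        then obtain a b where ab: "(step ^^ n) v = [a, b]" by (auto simp: length_Suc_conv numeral_2_eq_2)
        show ?case using Suc unfolding funpow.simps comp_def ab by (cases a) (auto simp: step_def)
      qed (use that in auto)
      then show ?thesis by simp
    qed
  qed (auto simp: step_def)
  then have "poly_time 3 (\<lambda>xs. (step ^^ length (hd xs)) (tl xs) ! 1)" by (simp add: eval_nat_numeral)
  from poly_time_comp3[OF this assms(1) assms(1) assms(2)] show ?thesis by (simp add: step)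
qed

lemma poly_time_rev: "poly_time k f \<Longrightarrow> poly_time k (\<lambda>xs. rev (f xs))"
  using poly_time_rev_append[OF _ poly_time_Nil, of k f] by simp

lemma poly_time_append: "poly_time k f \<Longrightarrow> poly_time k g \<Longrightarrow> poly_time k (\<lambda>xs. f xs @ g xs)"
  using poly_time_rev_append[OF poly_time_rev, of k f g] by simp

text \<open>The common shape of the loops that follow: a state \<open>e\<close>, fixed parameters
  \<open>xs\<close>, and an output that grows at its front. Neither \<open>E\<close> nor
  \<open>H\<close> sees the output \<open>a\<close>, so its growth cannot feed back into the
  loop.\<close>

definition accum :: "(bits list \<Rightarrow> bits) \<Rightarrow> (bits list \<Rightarrow> bits) \<Rightarrow> bits list \<Rightarrow> bits \<times> bits \<Rightarrow> bits \<times> bits" where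
  "accum E H xs = (\<lambda>(e, a). (E (e # xs), H (e # xs) @ a))"

lemma accum_simps:
  "accum E H xs (e, a) = (E (e # xs), H (e # xs) @ a)"
  "fst (accum E H xs r) = E (fst r # xs)"
  "snd (accum E H xs r) = H (fst r # xs) @ snd r"
  by (auto simp: accum_def split_beta)

text \<open>If the state grows by at most one bit per round, then after \<open>i\<close> rounds it
  has at most \<open>i\<close> extra bits, each round emits polynomially much, and the output is at
  most \<open>i\<close> times as long. One bit per round is enough for a state that counts in
  unary.\<close>

lemma
  assumes E: "poly_time (Suc k) E" and H: "poly_time (Suc k) H"
    and len: "\<And>e xs. length xs = k \<Longrightarrow> length (E (e # xs)) \<le> Suc (length e)"
    and n: "poly_time k n" and e: "poly_time k e"
  shows poly_time_accum_fst: "poly_time k (\<lambda>xs. fst ((accum E H xs ^^ length (n xs)) (e xs, [])))" (is ?thesis1)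
    and poly_time_accum: "poly_time k (\<lambda>xs. snd ((accum E H xs ^^ length (n xs)) (e xs, [])))" (is ?thesis2)
proof -
  define step :: "bits list \<Rightarrow> bits list" where
    "step v = E (v ! 0 # drop 2 v) # (H (v ! 0 # drop 2 v) @ v ! 1) # drop 2 v" for v
  let ?m = "Suc (Suc k)"
  obtain p :: "nat poly" where p: "\<And>xs. length xs = Suc k \<Longrightarrow> length (H xs) \<le> poly p (sum_list (map length xs))"
    using poly_time_length_bound[OF H] by blast
  have args: "poly_time ?m (\<lambda>v. f (v ! 0 # drop 2 v))" if f: "poly_time (Suc k) f" for f
  proof -
    have "poly_time ?m (\<lambda>v. f (map (\<lambda>g. g v) ((\<lambda>v. v ! 0) # map (\<lambda>i v. v ! Suc (Suc i)) [0..<k])))"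
      by (rule poly_time_comp_list) (use f in \<open>auto intro: poly_time_nth\<close>)
    then show ?thesis
    proof (rule poly_time_cong[THEN iffD1, rotated])
      fix v :: "bits list" assume "length v = ?m"
      then have "map (\<lambda>i. v ! Suc (Suc i)) [0..<k] = drop 2 v"
        by (intro nth_equalityI) auto
      then show "f (map (\<lambda>g. g v) ((\<lambda>v. v ! 0) # map (\<lambda>i v. v ! Suc (Suc i)) [0..<k])) = f (v ! 0 # drop 2 v)"
        by (simp add: comp_def)
    qed
  qed
  have iter: "(step ^^ i) (e # a # xs) = (let r = (accum E H xs ^^ i) (e, a) in fst r # snd r # xs)" for i e a xs
    by (induction i) (auto simp: step_def accum_simps Let_def)
  have bound: "length (fst ((accum E H xs ^^ i) (e, a))) \<le> length e + i \<and>
     length (snd ((accum E H xs ^^ i) (e, a))) \<le> length a + i * poly p (length e + i + sum_list (map length xs))"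
    if xs: "length xs = k" for i e a xs
  proof (induction i)
    case (Suc i)
    obtain e' a' where r: "(accum E H xs ^^ i) (e, a) = (e', a')" by fastforce
    have e': "length e' \<le> length e + i"
      and a': "length a' \<le> length a + i * poly p (length e + i + sum_list (map length xs))"
      using Suc by (auto simp: r)
    have "length (E (e' # xs)) \<le> length e + Suc i" using len[OF xs, of e'] e' by linarith
    moreover have "length (H (e' # xs)) \<le> poly p (length e + Suc i + sum_list (map length xs))"
      using p[of "e' # xs"] xs e' by (auto intro: le_trans[OF _ poly_nat_mono])
    moreover have "i * poly p (length e + i + sum_list (map length xs)) \<le> i * poly p (length e + Suc i + sum_list (map length xs))"
      by (intro mult_left_mono poly_nat_mono) auto
    ultimately have "length (E (e' # xs)) \<le> length e + Suc i \<and>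
        length (H (e' # xs)) + length a' \<le> length a + Suc i * poly p (length e + Suc i + sum_list (map length xs))"
      using a' unfolding mult_Suc by linarith
    then show ?case by (simp add: r accum_simps)
  qed simp
  have P: "poly_time (Suc ?m) (\<lambda>xs. (step ^^ length (hd xs)) (tl xs) ! j)" if "j < 2" for j
  proof (rule poly_time_funpow[where q = "[:0, 1:] + [:0, 1:] * p"])
    show "length (step v) = ?m" if "length v = ?m" for v
      using that by (simp add: step_def)
    show "poly_time ?m (\<lambda>v. step v ! i)" if "i < ?m" for i
    proof -
      consider "i = 0" | "i = 1" | j where "i = Suc (Suc j)" by (metis One_nat_def old.nat.exhaust)
      then show ?thesis
      proof cases
        case 1
        then show ?thesis using args[OF E] by (simp add: step_def)
      next
        case 2
        have "poly_time ?m (\<lambda>v. H (v ! 0 # drop 2 v) @ v ! 1)"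
          by (intro poly_time_append args H poly_time_nth) auto
        then show ?thesis using 2 by (simp add: step_def)
      next
        case (3 j)
        have "poly_time ?m (\<lambda>v. v ! i)" by (rule poly_time_nth) (use that in auto)
        then show ?thesis
          by (rule poly_time_cong[THEN iffD1, rotated]) (use that in \<open>auto simp: step_def 3\<close>)
      qed
    qed
    show "sum_list (map length ((step ^^ n) v)) \<le> poly ([:0, 1:] + [:0, 1:] * p) (n + sum_list (map length v))"
      if v2: "length v = ?m" for n and v :: "bits list"
    proof -
      obtain e a xs where v: "v = e # a # xs" and xs: "length xs = k"
        using v2 by (cases v; cases "tl v") auto
      have "n * poly p (length e + n + sum_list (map length xs)) \<le> (n + sum_list (map length v)) * poly p (n + sum_list (map length v))"
        by (intro mult_mono poly_nat_mono) (auto simp: v)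
      then show ?thesis using bound[OF xs, of n e a] by (simp add: v iter Let_def)
    qed
  qed (use that in auto)
  have "poly_time k (\<lambda>xs. (step ^^ length (n xs)) (e xs # [] # xs) ! j)" if "j < 2" for j
  proof -
    have "poly_time k (\<lambda>xs. (\<lambda>xs. (step ^^ length (hd xs)) (tl xs) ! j)
        (map (\<lambda>g. g xs) (n # e # (\<lambda>_. []) # map (\<lambda>i v. v ! i) [0..<k])))"
      by (rule poly_time_comp_list) (use P[OF that] n e in \<open>auto intro: poly_time_nth poly_time_Nil\<close>)
    then show ?thesis
    proof (rule poly_time_cong[THEN iffD1, rotated])
      fix xs :: "bits list" assume "length xs = k"
      then have "map (\<lambda>i. xs ! i) [0..<k] = xs"
        by (intro nth_equalityI) auto
      then show "(\<lambda>xs. (step ^^ length (hd xs)) (tl xs) ! j)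
        (map (\<lambda>g. g xs) (n # e # (\<lambda>_. []) # map (\<lambda>i v. v ! i) [0..<k])) = (step ^^ length (n xs)) (e xs # [] # xs) ! j"
        by (simp add: comp_def)
    qed
  qed
  from this[of 0] this[of 1] show ?thesis1 ?thesis2 by (simp_all add: iter Let_def)
qed

section \<open>Unary numbers, predicates and gate lists\<close>

definition poly_nat :: "nat \<Rightarrow> (bits list \<Rightarrow> nat) \<Rightarrow> bool" where
  "poly_nat k f \<longleftrightarrow> poly_time k (\<lambda>xs. unary (f xs))"

definition poly_pred :: "nat \<Rightarrow> (bits list \<Rightarrow> bool) \<Rightarrow> bool" where
  "poly_pred k P \<longleftrightarrow> poly_time k (\<lambda>xs. [P xs])"

definition poly_gates :: "nat \<Rightarrow> (bits list \<Rightarrow> gate list) \<Rightarrow> bool" where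
  "poly_gates k f \<longleftrightarrow> poly_time k (\<lambda>xs. concat (map enc_gate (f xs)))"

lemma poly_time_if:
  assumes "poly_pred k P" "poly_time k f" "poly_time k g"
  shows "poly_time k (\<lambda>xs. if P xs then f xs else g xs)"
  using poly_time_if_hd[OF assms(1)[unfolded poly_pred_def] assms(2,3)] by simp

lemma poly_nat_if:
  "poly_pred k P \<Longrightarrow> poly_nat k f \<Longrightarrow> poly_nat k g \<Longrightarrow> poly_nat k (\<lambda>xs. if P xs then f xs else g xs)"
  unfolding poly_nat_def using poly_time_if[of k P "\<lambda>xs. unary (f xs)" "\<lambda>xs. unary (g xs)"]
  by (simp add: if_distrib[where f = "\<lambda>n. unary n"])

lemma circ_gen_if:
  "poly_pred k P \<Longrightarrow> circ_gen k f \<Longrightarrow> circ_gen k g \<Longrightarrow> circ_gen k (\<lambda>xs. if P xs then f xs else g xs)"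
  unfolding circ_gen_def using poly_time_if[of k P "\<lambda>xs. enc_circ (f xs)" "\<lambda>xs. enc_circ (g xs)"]
  by (simp add: if_distrib[where f = "enc_circ"])

lemma poly_pred_not:
  assumes "poly_pred k P"
  shows "poly_pred k (\<lambda>xs. \<not> P xs)"
proof -
  have "(if P xs then [False] else [True]) = [\<not> P xs]" for xs by auto
  with poly_time_if[OF assms poly_time_const[of k "[False]"] poly_time_const[of k "[True]"]]
  show ?thesis by (simp add: poly_pred_def)
qed

lemma poly_pred_conj:
  assumes "poly_pred k P" "poly_pred k Q"
  shows "poly_pred k (\<lambda>xs. P xs \<and> Q xs)"
proof -
  have "(if P xs then [Q xs] else [False]) = [P xs \<and> Q xs]" for xs by auto
  with poly_time_if[OF assms(1) assms(2)[unfolded poly_pred_def] poly_time_const[of k "[False]"]]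
  show ?thesis by (simp add: poly_pred_def)
qed

lemma poly_pred_Nil:
  assumes "poly_time k f"
  shows "poly_pred k (\<lambda>xs. f xs = [])"
proof -
  have "(if f xs = [] then [True] else [False]) = [f xs = []]" for xs by auto
  with poly_time_if_Nil[OF assms poly_time_const[of k "[True]"] poly_time_const[of k "[False]"]]
  show ?thesis by (simp add: poly_pred_def)
qed

lemma poly_pred_hd:
  assumes "poly_time k f"
  shows "poly_pred k (\<lambda>xs. f xs \<noteq> [] \<and> hd (f xs))"
proof -
  have "(if f xs \<noteq> [] \<and> hd (f xs) then [True] else [False]) = [f xs \<noteq> [] \<and> hd (f xs)]" for xs by auto
  with poly_time_if_hd[OF assms poly_time_const[of k "[True]"] poly_time_const[of k "[False]"]]
  show ?thesis by (simp add: poly_pred_def)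
qed

lemma poly_nat_add: "poly_nat k f \<Longrightarrow> poly_nat k g \<Longrightarrow> poly_nat k (\<lambda>xs. f xs + g xs)"
  unfolding poly_nat_def by (simp add: replicate_add poly_time_append)

lemma poly_nat_const: "poly_nat k (\<lambda>xs. c)"
  unfolding poly_nat_def by (rule poly_time_const)

lemma poly_nat_Suc: "poly_nat k f \<Longrightarrow> poly_nat k (\<lambda>xs. Suc (f xs))"
  unfolding poly_nat_def by (simp add: poly_time_Cons)

lemma poly_nat_length:
  assumes "poly_time k f"
  shows "poly_nat k (\<lambda>xs. length (f xs))"
proof -
  have "(accum E (\<lambda>_. [True]) xs ^^ n) (e, a) = (((\<lambda>e. E (e # xs)) ^^ n) e, unary n @ a)" for E xs e a n
    by (induction n) (auto simp: accum_simps)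
  with poly_time_accum[OF poly_time_Nil poly_time_const _ assms poly_time_Nil, of "[True]"]
  show ?thesis by (simp add: poly_nat_def)
qed

lemma poly_nat_mult:
  assumes "poly_nat k f" "poly_nat k g"
  shows "poly_nat k (\<lambda>xs. f xs * g xs)"
proof -
  have "snd ((accum E (\<lambda>xs. unary (g (tl xs))) xs ^^ n) (e, [])) = unary (n * g xs)" for E xs e n
    by (induction n) (auto simp: accum_simps replicate_add)
  with poly_time_accum[OF poly_time_Nil poly_time_tl_args[OF assms(2)[unfolded poly_nat_def]]
      _ assms(1)[unfolded poly_nat_def] poly_time_Nil]
  show ?thesis by (simp add: poly_nat_def)
qed

lemma poly_nat_poly: "poly_nat k f \<Longrightarrow> poly_nat k (\<lambda>xs. poly p (f xs))"
  by (induction p) (auto intro: poly_nat_const poly_nat_add poly_nat_mult)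

lemma poly_time_drop:
  assumes "poly_nat k n" "poly_time k f"
  shows "poly_time k (\<lambda>xs. drop (n xs) (f xs))"
proof -
  have "fst ((accum (\<lambda>xs. tl (xs ! 0)) H xs ^^ n) (e, a)) = drop n e" for H xs e a n
    by (induction n) (auto simp: accum_simps drop_Suc drop_tl)
  with poly_time_accum_fst[OF poly_time_tl[OF poly_time_nth[of 0]] poly_time_Nil
      _ assms(1)[unfolded poly_nat_def] assms(2)]
  show ?thesis by (simp add: le_diff_conv)
qed

lemma poly_time_take:
  assumes "poly_nat k n" "poly_time k f"
  shows "poly_time k (\<lambda>xs. take (n xs) (f xs))"
proof -
  \<comment> \<open>What \<open>drop\<close> leaves over has exactly the length that has to be cut
    off at the end.\<close>
  have "rev (drop (length (drop (n xs) (f xs))) (rev (f xs))) = take (n xs) (f xs)" for xs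
    by (cases "n xs \<le> length (f xs)") (auto simp: drop_rev)
  moreover have "poly_time k (\<lambda>xs. rev (drop (length (drop (n xs) (f xs))) (rev (f xs))))"
    by (intro poly_time_rev poly_time_drop poly_nat_length assms)
  ultimately show ?thesis by simp
qed

text \<open>On unary numbers \<open>drop\<close> is truncated subtraction, so comparing means
  testing whether something is left.\<close>

lemma poly_pred_less:
  assumes "poly_nat k f" "poly_nat k g"
  shows "poly_pred k (\<lambda>xs. f xs < g xs)"
  using poly_pred_not[OF poly_pred_Nil[OF poly_time_drop[OF assms(1) assms(2)[unfolded poly_nat_def]]]]
  by (simp add: not_le)

lemma poly_pred_eq:
  assumes "poly_nat k f" "poly_nat k g"
  shows "poly_pred k (\<lambda>xs. f xs = g xs)"
proof -
  have "(\<lambda>xs. f xs = g xs) = (\<lambda>xs. \<not> f xs < g xs \<and> \<not> g xs < f xs)" by (auto simp: fun_eq_iff)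
  then show ?thesis using assms by (auto intro!: poly_pred_conj poly_pred_not poly_pred_less)
qed

text \<open>Reads off the number at the front of a string that starts with an
  \<open>enc_nat\<close>. The length of the string bounds the number of rounds; once the top bit is
  not \<open>True\<close>, the loop idles.\<close>

lemma poly_nat_takeWhile:
  assumes "poly_time k f"
  shows "poly_nat k (\<lambda>xs. length (takeWhile (\<lambda>b. b) (f xs)))"
proof -
  let ?E = "\<lambda>xs :: bits list. if xs ! 0 \<noteq> [] \<and> hd (xs ! 0) then tl (xs ! 0) else xs ! 0"
  let ?H = "\<lambda>xs :: bits list. if xs ! 0 \<noteq> [] \<and> hd (xs ! 0) then [True] else []"
  have acc: "snd ((accum ?E ?H xs ^^ n) (e, a)) = unary (length (takeWhile (\<lambda>b. b) e)) @ a" if "length e \<le> n" for xs e a n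
    using that
  proof (induction n arbitrary: e a)
    case (Suc n)
    show ?case
    proof (cases "e \<noteq> [] \<and> hd e")
      case True
      then obtain e' where e: "e = True # e'" by (cases e) auto
      have "accum ?E ?H xs (e, a) = (e', True # a)" by (simp add: accum_simps e)
      then have "snd ((accum ?E ?H xs ^^ Suc n) (e, a)) = unary (length (takeWhile (\<lambda>b. b) e')) @ True # a"
        using Suc.IH[of e' "True # a"] Suc.prems by (simp add: funpow_swap1 e)
      moreover have "takeWhile (\<lambda>b. b) (True # e') = True # takeWhile (\<lambda>b. b) e'" by simp
      ultimately show ?thesis by (simp only: e length_Cons replicate_Suc replicate_app_Cons_same append_Cons)
    next
      case False
      then have "accum ?E ?H xs (e, a) = (e, a)" by (auto simp: accum_simps)
      then have "(accum ?E ?H xs ^^ m) (e, a) = (e, a)" for m by (induction m) (simp_all add: funpow_swap1)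
      from this[of "Suc n"] moreover have "takeWhile (\<lambda>b. b) e = []" using False by (cases e) auto
      ultimately show ?thesis by (simp del: funpow.simps)
    qed
  qed simp
  have "poly_time k (\<lambda>xs. snd ((accum ?E ?H xs ^^ length (f xs)) (f xs, [])))"
    by (rule poly_time_accum) (use assms in \<open>auto intro!: poly_time_if_hd poly_time_tl poly_time_nth poly_time_const\<close>)
  then show ?thesis by (simp add: acc poly_nat_def)
qed

lemma poly_gates_Nil: "poly_gates k (\<lambda>xs. [])"
  unfolding poly_gates_def by (simp add: poly_time_Nil)

lemma poly_gates_append: "poly_gates k f \<Longrightarrow> poly_gates k g \<Longrightarrow> poly_gates k (\<lambda>xs. f xs @ g xs)"
  unfolding poly_gates_def by (simp add: poly_time_append)

lemma poly_time_enc_nat: "poly_nat k f \<Longrightarrow> poly_time k (\<lambda>xs. enc_nat (f xs))"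
  unfolding poly_nat_def enc_nat_def by (intro poly_time_append poly_time_const)

lemma poly_gates_Hadamard:
  "poly_nat k f \<Longrightarrow> poly_gates k g \<Longrightarrow> poly_gates k (\<lambda>xs. Hadamard (f xs) # g xs)"
  unfolding poly_gates_def by (simp add: poly_time_Cons poly_time_append poly_time_enc_nat)

lemma poly_gates_Tgate:
  "poly_nat k f \<Longrightarrow> poly_gates k g \<Longrightarrow> poly_gates k (\<lambda>xs. Tgate (f xs) # g xs)"
  unfolding poly_gates_def by (simp add: poly_time_Cons poly_time_append poly_time_enc_nat)

lemma poly_gates_Cnot:
  "poly_nat k f \<Longrightarrow> poly_nat k f' \<Longrightarrow> poly_gates k g \<Longrightarrow> poly_gates k (\<lambda>xs. Cnot (f xs) (f' xs) # g xs)"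
  unfolding poly_gates_def by (simp add: poly_time_Cons poly_time_append poly_time_enc_nat)

lemma poly_gates_Toffoli:
  "poly_nat k f \<Longrightarrow> poly_nat k f' \<Longrightarrow> poly_nat k f'' \<Longrightarrow> poly_gates k g \<Longrightarrow>
    poly_gates k (\<lambda>xs. Toffoli (f xs) (f' xs) (f'' xs) # g xs)"
  unfolding poly_gates_def by (simp add: poly_time_Cons poly_time_append poly_time_enc_nat)

lemma takeWhile_enc_nat: "takeWhile (\<lambda>b. b) (enc_nat n @ y) = unary n"
  by (induction n) (auto simp: enc_nat_def)

lemma drop_enc_nat: "drop (Suc (length (takeWhile (\<lambda>b. b) (enc_nat n @ y)))) (enc_nat n @ y) = y"
  unfolding takeWhile_enc_nat by (simp add: enc_nat_def)

lemma enc_circ_eq: "enc_circ C = enc_nat (ancillas C) @ enc_nat (outputs C) @ concat (map enc_gate (gates C))"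
  by (cases C) simp

lemma circ_gen_Circ:
  "poly_nat k a \<Longrightarrow> poly_nat k w \<Longrightarrow> poly_gates k gs \<Longrightarrow> circ_gen k (\<lambda>xs. Circ (a xs) (w xs) (gs xs))"
  unfolding poly_gates_def circ_gen_def by (simp add: poly_time_append poly_time_enc_nat)

lemma poly_nat_ancillas:
  assumes "circ_gen k C"
  shows "poly_nat k (\<lambda>xs. ancillas (C xs))"
  using poly_nat_takeWhile[OF assms[unfolded circ_gen_def]]
  unfolding enc_circ_eq takeWhile_enc_nat by simp

lemma poly_gates_gates:
  assumes "circ_gen k C"
  shows "poly_gates k (\<lambda>xs. gates (C xs))"
proof -
  let ?d = "\<lambda>y :: bits. drop (Suc (length (takeWhile (\<lambda>b. b) y))) y"
  have d: "poly_time k (\<lambda>xs. ?d (f xs))" if "poly_time k f" for f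
    using that by (intro poly_time_drop poly_nat_Suc poly_nat_takeWhile)
  have "poly_time k (\<lambda>xs. ?d (?d (enc_circ (C xs))))"
    using assms unfolding circ_gen_def by (intro d)
  then show ?thesis unfolding enc_circ_eq drop_enc_nat poly_gates_def .
qed

section \<open>Parsing and rewriting encoded circuits\<close>

definition skip_nat :: "bits \<Rightarrow> bits" where
  "skip_nat e = drop (Suc (length (takeWhile (\<lambda>b. b) e))) e"

definition dec_nat :: "bits \<Rightarrow> nat" where
  "dec_nat e = length (takeWhile (\<lambda>b. b) e)"

definition dec_gate :: "bits \<Rightarrow> gate" where
  "dec_gate e = (let e0 = drop 2 e; e1 = skip_nat e0; e2 = skip_nat e1 in
     if e \<noteq> [] \<and> hd e
     then if tl e \<noteq> [] \<and> hd (tl e) then Toffoli (dec_nat e0) (dec_nat e1) (dec_nat e2) else Cnot (dec_nat e0) (dec_nat e1)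
     else if tl e \<noteq> [] \<and> hd (tl e) then Tgate (dec_nat e0) else Hadamard (dec_nat e0))"

text \<open>The empty string is mapped to itself, so a loop that consumes gates idles once they are
  exhausted.\<close>

definition skip_gate :: "bits \<Rightarrow> bits" where
  "skip_gate e = (let e1 = skip_nat (drop 2 e); e2 = skip_nat e1 in
     if e \<noteq> [] \<and> hd e then if tl e \<noteq> [] \<and> hd (tl e) then skip_nat e2 else e2 else e1)"

lemma skip_nat_enc: "skip_nat (enc_nat n @ y) = y"
  unfolding skip_nat_def by (rule drop_enc_nat)

lemma dec_nat_enc: "dec_nat (enc_nat n @ y) = n"
  unfolding dec_nat_def by (simp add: takeWhile_enc_nat)

lemma dec_gate_enc: "dec_gate (enc_gate g @ y) = g"
  by (cases g) (auto simp: dec_gate_def skip_nat_enc dec_nat_enc)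

lemma skip_gate_enc: "skip_gate (enc_gate g @ y) = y"
  by (cases g) (auto simp: skip_gate_def skip_nat_enc)

lemma poly_time_skip_nat: "poly_time k f \<Longrightarrow> poly_time k (\<lambda>xs. skip_nat (f xs))"
  unfolding skip_nat_def by (intro poly_time_drop poly_nat_Suc poly_nat_takeWhile)

lemma poly_nat_dec_nat: "poly_time k f \<Longrightarrow> poly_nat k (\<lambda>xs. dec_nat (f xs))"
  unfolding dec_nat_def by (intro poly_nat_takeWhile)

lemma length_skip_gate: "length (skip_gate e) \<le> length e"
  by (auto simp: skip_gate_def skip_nat_def Let_def)

text \<open>The loop consumes the encoding from the front and prepends the image of each gate to the
  output; this reverses the order. It runs for as many rounds as the encoding has bits, which is at
  least the number of gates. As \<open>h\<close> works on gates and not on strings, its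
  computability is stated for each kind of gate separately, with the qubit indices as lengths of
  leading arguments.\<close>

lemma poly_gates_concat_rev_map:
  assumes H: "poly_gates (Suc k) (\<lambda>ys. h (Hadamard (length (ys ! 0))) (tl ys))"
    and T: "poly_gates (Suc k) (\<lambda>ys. h (Tgate (length (ys ! 0))) (tl ys))"
    and C: "poly_gates (Suc (Suc k)) (\<lambda>ys. h (Cnot (length (ys ! 0)) (length (ys ! 1))) (drop 2 ys))"
    and F: "poly_gates (Suc (Suc (Suc k))) (\<lambda>ys. h (Toffoli (length (ys ! 0)) (length (ys ! 1)) (length (ys ! 2))) (drop 3 ys))"
    and gs: "poly_gates k gs"
  shows "poly_gates k (\<lambda>xs. concat (map (\<lambda>g. h g xs) (rev (gs xs))))"
proof -
  let ?enc = "\<lambda>gs. concat (map enc_gate gs)"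
  let ?E = "\<lambda>ys. skip_gate (ys ! 0)"
  let ?H = "\<lambda>ys. if ys ! 0 = [] then [] else ?enc (h (dec_gate (ys ! 0)) (tl ys))"
  have acc: "snd ((accum ?E ?H xs ^^ n) (?enc gs, a)) = ?enc (concat (map (\<lambda>g. h g xs) (rev gs))) @ a"
    if "length gs \<le> n" for xs gs n a
    using that
  proof (induction n arbitrary: gs a)
    case (Suc n)
    show ?case
    proof (cases gs)
      case Nil
      have "accum ?E ?H xs ([], a) = ([], a)"
        by (simp add: accum_simps skip_gate_def skip_nat_def)
      then have "(accum ?E ?H xs ^^ m) ([], a) = ([], a)" for m by (induction m) (simp_all add: funpow_swap1)
      from this[of "Suc n"] show ?thesis by (simp del: funpow.simps add: Nil)
    next
      case (Cons g gs')
      have "enc_gate g \<noteq> []" by (cases g) auto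
      then have "accum ?E ?H xs (?enc gs, a) = (?enc gs', ?enc (h g xs) @ a)"
        by (simp add: accum_simps Cons skip_gate_enc dec_gate_enc)
      then have "snd ((accum ?E ?H xs ^^ Suc n) (?enc gs, a)) = ?enc (concat (map (\<lambda>g. h g xs) (rev gs'))) @ ?enc (h g xs) @ a"
        using Suc.IH[of gs' "?enc (h g xs) @ a"] Suc.prems Cons by (simp only: funpow_Suc_right comp_def) simp
      then show ?thesis by (simp add: Cons)
    qed
  qed simp
  have len: "length gs \<le> length (?enc gs)" for gs
  proof (induction gs)
    case (Cons g gs)
    have "enc_gate g \<noteq> []" by (cases g) auto
    then have "1 \<le> length (enc_gate g)" by (cases "enc_gate g") auto
    then show ?case using Cons by simp
  qed simp
  have pH: "poly_time (Suc k) ?H"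
  proof -
    let ?e0 = "\<lambda>ys :: bits list. drop 2 (ys ! 0)"
    let ?e1 = "\<lambda>ys. skip_nat (?e0 ys)"
    let ?e2 = "\<lambda>ys. skip_nat (?e1 ys)"
    let ?u = "\<lambda>e (ys :: bits list). unary (dec_nat (e ys))"
    have u: "poly_time (Suc k) (?u e)" if "poly_time (Suc k) e" for e
      unfolding poly_nat_def[symmetric] using that by (rule poly_nat_dec_nat)
    have e: "poly_time (Suc k) ?e0" "poly_time (Suc k) ?e1" "poly_time (Suc k) ?e2"
      by (auto intro!: poly_time_skip_nat poly_time_drop poly_nat_const poly_time_nth)
    note u = e[THEN u]
    have 1: "poly_time (Suc k) (\<lambda>ys. ?enc (h (Hadamard (dec_nat (?e0 ys))) (tl ys)))"
      using poly_time_append_args[of "[?u ?e0]" k "\<lambda>ys. ?enc (h (Hadamard (length (ys ! 0))) (tl ys))"] H[unfolded poly_gates_def] u by simp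
    have 2: "poly_time (Suc k) (\<lambda>ys. ?enc (h (Tgate (dec_nat (?e0 ys))) (tl ys)))"
      using poly_time_append_args[of "[?u ?e0]" k "\<lambda>ys. ?enc (h (Tgate (length (ys ! 0))) (tl ys))"] T[unfolded poly_gates_def] u by simp
    have 3: "poly_time (Suc k) (\<lambda>ys. ?enc (h (Cnot (dec_nat (?e0 ys)) (dec_nat (?e1 ys))) (tl ys)))"
      using poly_time_append_args[of "[?u ?e0, ?u ?e1]" k "\<lambda>ys. ?enc (h (Cnot (length (ys ! 0)) (length (ys ! 1))) (drop 2 ys))"] C[unfolded poly_gates_def] u by force
    have 4: "poly_time (Suc k) (\<lambda>ys. ?enc (h (Toffoli (dec_nat (?e0 ys)) (dec_nat (?e1 ys)) (dec_nat (?e2 ys))) (tl ys)))"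
      using poly_time_append_args[of "[?u ?e0, ?u ?e1, ?u ?e2]" k "\<lambda>ys. ?enc (h (Toffoli (length (ys ! 0)) (length (ys ! 1)) (length (ys ! 2))) (drop 3 ys))"] F[unfolded poly_gates_def] u by force
    have eq: "?enc (h (dec_gate (ys ! 0)) (tl ys)) = 
       (if ys ! 0 \<noteq> [] \<and> hd (ys ! 0)
        then if tl (ys ! 0) \<noteq> [] \<and> hd (tl (ys ! 0))
          then ?enc (h (Toffoli (dec_nat (?e0 ys)) (dec_nat (?e1 ys)) (dec_nat (?e2 ys))) (tl ys))
          else ?enc (h (Cnot (dec_nat (?e0 ys)) (dec_nat (?e1 ys))) (tl ys))
        else if tl (ys ! 0) \<noteq> [] \<and> hd (tl (ys ! 0))
          then ?enc (h (Tgate (dec_nat (?e0 ys))) (tl ys))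
          else ?enc (h (Hadamard (dec_nat (?e0 ys))) (tl ys)))" for ys
      by (simp add: dec_gate_def Let_def)
    show ?thesis unfolding eq
      by (intro poly_time_if_Nil poly_time_if_hd 1 2 3 4 poly_time_Nil poly_time_nth poly_time_tl) simp_all
  qed
  have pE: "poly_time (Suc k) ?E"
    unfolding skip_gate_def Let_def
    by (intro poly_time_if_hd poly_time_skip_nat poly_time_drop poly_nat_const poly_time_nth poly_time_tl) auto
  have "poly_time k (\<lambda>xs. snd ((accum ?E ?H xs ^^ length (?enc (gs xs))) (?enc (gs xs), [])))"
    by (rule poly_time_accum[OF pE pH])
      (use gs[unfolded poly_gates_def] length_skip_gate in \<open>auto intro: le_SucI\<close>)
  then show ?thesis unfolding poly_gates_def by (simp add: acc[OF len])
qed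

lemma poly_gates_rev: "poly_gates k gs \<Longrightarrow> poly_gates k (\<lambda>xs. rev (gs xs))"
  using poly_gates_concat_rev_map[of k "\<lambda>g xs. [g]" gs]
  by (simp add: poly_gates_Hadamard poly_gates_Tgate poly_gates_Cnot poly_gates_Toffoli poly_gates_Nil
      poly_nat_length poly_time_nth)

lemma poly_gates_concat_map:
  assumes "poly_gates (Suc k) (\<lambda>ys. h (Hadamard (length (ys ! 0))) (tl ys))"
    and "poly_gates (Suc k) (\<lambda>ys. h (Tgate (length (ys ! 0))) (tl ys))"
    and "poly_gates (Suc (Suc k)) (\<lambda>ys. h (Cnot (length (ys ! 0)) (length (ys ! 1))) (drop 2 ys))"
    and "poly_gates (Suc (Suc (Suc k))) (\<lambda>ys. h (Toffoli (length (ys ! 0)) (length (ys ! 1)) (length (ys ! 2))) (drop 3 ys))"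
    and "poly_gates k gs"
  shows "poly_gates k (\<lambda>xs. concat (map (\<lambda>g. h g xs) (gs xs)))"
  using poly_gates_concat_rev_map[OF assms(1-4) poly_gates_rev[OF assms(5)]] by simp

lemma poly_gates_concat_upt:
  assumes h: "poly_gates (Suc k) (\<lambda>ys. h (length (ys ! 0)) (tl ys))" and n: "poly_nat k n"
  shows "poly_gates k (\<lambda>xs. concat (map (\<lambda>j. h j xs) [0..<n xs]))"
proof -
  let ?enc = "\<lambda>gs. concat (map enc_gate gs)"
  let ?E = "\<lambda>ys :: bits list. True # ys ! 0"
  \<comment> \<open>Since output is prepended, the loop builds the reversed list out of reversed
    blocks; a final reversal repairs both.\<close>
  let ?H = "\<lambda>ys. ?enc (rev (h (length (ys ! 0)) (tl ys)))"
  have acc: "(accum ?E ?H xs ^^ n) ([], []) = (unary n, ?enc (rev (concat (map (\<lambda>j. h j xs) [0..<n]))))" for xs n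
    by (induction n) (auto simp: accum_simps)
  have "poly_time k (\<lambda>xs. snd ((accum ?E ?H xs ^^ length (unary (n xs))) ([], [])))"
    by (rule poly_time_accum)
      (use poly_gates_rev[OF h] n in \<open>auto simp: poly_gates_def poly_nat_def intro: poly_time_Nil poly_time_Cons poly_time_nth\<close>)
  then have "poly_gates k (\<lambda>xs. rev (concat (map (\<lambda>j. h j xs) [0..<n xs])))"
    by (simp add: acc poly_gates_def)
  from poly_gates_rev[OF this] show ?thesis by simp
qed

section \<open>Circuits acting on vectors\<close>

lemma finite_bitstrings [simp, intro]: "finite (bitstrings n)"
proof -
  have "bitstrings n = {x. set x \<subseteq> UNIV \<and> length x = n}" by (auto simp: bitstrings_def)
  then show ?thesis using finite_lists_length_eq[of "UNIV :: bool set" n] by simp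
qed

lemma bitstrings_0 [simp]: "bitstrings 0 = {[]}"
  by (auto simp: bitstrings_def)

lemma sum_bitstrings_add:
  "(\<Sum>x\<in>bitstrings (m + n). f x) = (\<Sum>u\<in>bitstrings m. \<Sum>v\<in>bitstrings n. f (u @ v))"
proof -
  have "(\<Sum>x\<in>bitstrings (m + n). f x) = (\<Sum>(u, v)\<in>bitstrings m \<times> bitstrings n. f (u @ v))"
    by (rule sum.reindex_bij_witness[of _ "\<lambda>(u, v). u @ v" "\<lambda>x. (take m x, drop m x)"])
      (auto simp: bitstrings_def)
  then show ?thesis by (simp add: sum.cartesian_product)
qed

lemma bitstrings_1: "bitstrings (Suc 0) = {[False], [True]}"
  by (auto simp: bitstrings_def length_Suc_conv)

lemma sum_bitstrings_1: "(\<Sum>x\<in>bitstrings (Suc 0). f x) = f [False] + f [True]"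
  by (simp add: bitstrings_1)

lemma apply_gates_simps [simp]:
  "apply_gates [] \<psi> = \<psi>"
  "apply_gates (g # gs) \<psi> = apply_gates gs (apply_gate g \<psi>)"
  "apply_gates (gs @ hs) \<psi> = apply_gates hs (apply_gates gs \<psi>)"
  by (simp_all add: apply_gates_def)

lemma apply_gate_cong:
  assumes "\<And>y. length y = length x \<Longrightarrow> \<psi> y = \<phi> y"
  shows "apply_gate g \<psi> x = apply_gate g \<phi> x"
  by (cases g) (auto simp: assms)

text \<open>Gates preserve the length of the index. Calculations with amplitudes can thus be
  confined to strings of the right length, where equality of vectors as functions would
  fail.\<close>

lemma apply_gates_cong:
  assumes "\<And>y. length y = length x \<Longrightarrow> \<psi> y = \<phi> y"
  shows "apply_gates gs \<psi> x = apply_gates gs \<phi> x"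
  using assms
proof (induction gs arbitrary: \<psi> \<phi>)
  case (Cons g gs)
  have "apply_gate g \<psi> y = apply_gate g \<phi> y" if "length y = length x" for y
    by (rule apply_gate_cong) (metis Cons.prems that)
  then show ?case unfolding apply_gates_simps by (rule Cons.IH)
qed simp

lemma apply_gate_scale: "apply_gate g (\<lambda>x. c * \<psi> x) = (\<lambda>x. c * apply_gate g \<psi> x)"
  by (cases g) (auto simp: fun_eq_iff algebra_simps add_divide_distrib diff_divide_distrib)

lemma apply_gates_scale: "apply_gates gs (\<lambda>x. c * \<psi> x) = (\<lambda>x. c * apply_gates gs \<psi> x)"
  by (induction gs arbitrary: \<psi>) (simp_all add: apply_gate_scale)

text \<open>Once keys and coins are fixed, the states in both games are pure up to normalisation
  until qubits are traced out for the output. This reduces the analysis from operators to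
  vectors.\<close>

lemma conj_gates_proj_op: "conj_gates gs (proj_op \<psi>) = proj_op (apply_gates gs \<psi>)"
proof -
  have 1: "apply_gates gs (\<lambda>u. \<psi> u * cnj (\<psi> y)) x = apply_gates gs \<psi> x * cnj (\<psi> y)" for x y
    using apply_gates_scale[of gs "cnj (\<psi> y)" \<psi>] by (simp add: mult.commute)
  have 2: "apply_gates gs (\<lambda>v. cnj c * \<psi> v) y = cnj c * apply_gates gs \<psi> y" for c y
    by (simp add: apply_gates_scale)
  show ?thesis by (simp add: conj_gates_def proj_op_def 1 2)
qed

section \<open>Product vectors and measurement of pure states\<close>

definition tensor_vec :: "nat \<Rightarrow> qvec \<Rightarrow> qvec \<Rightarrow> qvec" where
  "tensor_vec q \<phi> \<psi> = (\<lambda>x. \<phi> (take q x) * \<psi> (drop q x))"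

fun power_vec :: "nat \<Rightarrow> qvec \<Rightarrow> nat \<Rightarrow> qvec" where
  "power_vec q \<phi> 0 = zero_vec 0"
| "power_vec q \<phi> (Suc t) = tensor_vec q \<phi> (power_vec q \<phi> t)"

lemma tensor_proj_op: "tensor q (proj_op \<phi>) (proj_op \<psi>) = proj_op (tensor_vec q \<phi> \<psi>)"
  by (simp add: tensor_def proj_op_def tensor_vec_def mult_ac)

lemma zero_op_proj_op: "zero_op n = proj_op (zero_vec n)"
  by (simp add: zero_op_def proj_op_def)

lemma tensor_power_proj_op: "tensor_power q (proj_op \<phi>) t = proj_op (power_vec q \<phi> t)"
  by (induction t) (simp_all add: zero_op_proj_op tensor_proj_op)

lemma power_vec_append:
  "length x = q \<Longrightarrow> power_vec q \<phi> (Suc t) (x @ y) = \<phi> x * power_vec q \<phi> t y"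
  by (simp add: tensor_vec_def)

text \<open>The recursion splits off the first factor, but the reduction completes public keys from
  left to right and adds the newest one at the end.\<close>

lemma power_vec_snoc:
  "length x = t * q \<Longrightarrow> length y = q \<Longrightarrow> power_vec q \<phi> (Suc t) (x @ y) = power_vec q \<phi> t x * \<phi> y"
proof (induction t arbitrary: x)
  case 0
  then show ?case by (simp add: tensor_vec_def zero_vec_def)
next
  case (Suc t)
  define x1 x2 where "x1 = take q x" and "x2 = drop q x"
  have x: "x = x1 @ x2" "length x1 = q" "length x2 = t * q" using Suc.prems by (auto simp: x1_def x2_def)
  have "power_vec q \<phi> (Suc (Suc t)) (x @ y) = \<phi> x1 * power_vec q \<phi> (Suc t) (x2 @ y)"
    unfolding x(1) append_assoc by (rule power_vec_append[OF x(2)])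
  then show ?case using Suc.IH[OF x(3) Suc.prems(2)] power_vec_append[OF x(2), of \<phi> t x2] x(1) by simp
qed

lemma run_circ_proj_op:
  "run_circ q C (proj_op \<psi>) = proj_op (apply_gates (gates C) (tensor_vec q \<psi> (zero_vec (ancillas C))))"
  by (simp add: run_circ_def zero_op_proj_op tensor_proj_op conj_gates_proj_op)

lemma proj_op_diag: "proj_op \<psi> x x = complex_of_real ((cmod (\<psi> x))\<^sup>2)"
  by (simp only: proj_op_def complex_norm_square)

lemma outcome_prob_proj_op:
  assumes "length s = out_size q C"
  shows "outcome_prob (out_circ q C (proj_op \<psi>)) s = (\<Sum>z\<in>bitstrings (q + ancillas C - out_size q C).
     (cmod (apply_gates (gates C) (tensor_vec q \<psi> (zero_vec (ancillas C))) (s @ z)))\<^sup>2)"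
  using assms by (simp add: outcome_prob_def out_circ_def run_circ_proj_op proj_op_diag)

lemma outcome_prob_proj_op_nonneg: "0 \<le> outcome_prob (out_circ q C (proj_op \<psi>)) s"
proof (cases "length s = out_size q C")
  case True
  then show ?thesis by (simp add: outcome_prob_proj_op sum_nonneg)
qed (simp add: outcome_prob_def out_circ_def)

lemma measure_first_proj_op:
  "measure_first b (proj_op \<psi>) = proj_op (\<lambda>x. if (x \<noteq> [] \<and> hd x) = b then \<psi> x else 0)"
  by (auto simp: measure_first_def proj_op_def Let_def fun_eq_iff)

lemma zero_vec_append:
  "length x = a \<Longrightarrow> zero_vec (a + b) (x @ y) = zero_vec a x * zero_vec b y"
  by (auto simp: zero_vec_def replicate_add)

lemma zero_vec_Cons: "zero_vec (Suc n) (b # x) = (if b then 0 else zero_vec n x)"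
  by (auto simp: zero_vec_def)

lemma zero_vec_Nil [simp]: "zero_vec 0 [] = 1"
  by (simp add: zero_vec_def)

text \<open>Indices below \<open>N\<close> move to \<open>s, \<dots>, s + N - 1\<close>. The others move out of the range of a register of
  at most \<open>N + M\<close> qubits, since a gate that addresses them has to act as the identity.\<close>

definition ren_qubit :: "nat \<Rightarrow> nat \<Rightarrow> nat \<Rightarrow> nat \<Rightarrow> nat" where
  "ren_qubit s N M i = (if i < N then s + i else M + i)"

fun ren_gate :: "nat \<Rightarrow> nat \<Rightarrow> nat \<Rightarrow> gate \<Rightarrow> gate" where
  "ren_gate s N M (Hadamard i) = Hadamard (ren_qubit s N M i)"
| "ren_gate s N M (Tgate i) = Tgate (ren_qubit s N M i)"
| "ren_gate s N M (Cnot i j) = Cnot (ren_qubit s N M i) (ren_qubit s N M j)"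
| "ren_gate s N M (Toffoli i j k) = Toffoli (ren_qubit s N M i) (ren_qubit s N M j) (ren_qubit s N M k)"

text \<open>An index \<open>i \<ge> N\<close> is sent to \<open>M + i\<close>, which is at least
  \<open>s + N + length w\<close>, the length of the whole register. So a gate is ineffective after
  renaming exactly if it was so on the small register.\<close>

lemma apply_ren_gate:
  assumes "length u = s" "length v = N" "s + length w \<le> M"
  shows "apply_gate (ren_gate s N M g) \<Psi> (u @ v @ w) = apply_gate g (\<lambda>y. \<Psi> (u @ y @ w)) v"
proof -
  have len: "ren_qubit s N M i < length (u @ v @ w) \<longleftrightarrow> i < N" for i
    using assms by (auto simp: ren_qubit_def)
  have nth: "(u @ v @ w) ! ren_qubit s N M i = v ! i" if "i < N" for i
    using assms that by (auto simp: ren_qubit_def nth_append)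
  have upd: "(u @ v @ w)[ren_qubit s N M i := b] = u @ v[i := b] @ w" if "i < N" for i b
    using assms that by (auto simp: ren_qubit_def list_update_append)
  have eq: "ren_qubit s N M i = ren_qubit s N M j \<longleftrightarrow> i = j" if "i < N" "j < N" for i j
    using that by (auto simp: ren_qubit_def)
  show ?thesis
    by (cases g) (simp_all only: ren_gate.simps apply_gate.simps len assms(2) nth upd eq distinct.simps
        list.set insert_iff empty_iff cong: conj_cong if_cong, (simp_all add: nth upd eq cong: conj_cong)?)
qed

lemma apply_ren_gates:
  assumes "length u = s" "length v = N" "s + length w \<le> M"
  shows "apply_gates (map (ren_gate s N M) gs) \<Psi> (u @ v @ w) = apply_gates gs (\<lambda>y. \<Psi> (u @ y @ w)) v"
proof (induction gs arbitrary: \<Psi>)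
  case (Cons g gs)
  have "apply_gates gs (\<lambda>y. apply_gate (ren_gate s N M g) \<Psi> (u @ y @ w)) v =
      apply_gates gs (apply_gate g (\<lambda>y. \<Psi> (u @ y @ w))) v"
    by (rule apply_gates_cong) (use assms apply_ren_gate in auto)
  then show ?case by (simp add: Cons)
qed simp

text \<open>The T gate has order 8, so its seventh power is its inverse; the other gates are
  involutions.\<close>

fun inv_gate :: "gate \<Rightarrow> gate list" where
  "inv_gate (Tgate i) = replicate 7 (Tgate i)"
| "inv_gate g = [g]"

definition inv_gates :: "gate list \<Rightarrow> gate list" where
  "inv_gates gs = concat (map inv_gate (rev gs))"

lemma apply_Tgates:
  "apply_gates (replicate n (Tgate i)) \<psi> x = (if i < length x \<and> x ! i then cis (pi / 4) ^ n * \<psi> x else \<psi> x)"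
  by (induction n arbitrary: \<psi>) auto

lemma sqrt2_complex: "complex_of_real (sqrt 2) * complex_of_real (sqrt 2) = 2"
  by (simp flip: of_real_mult)

lemma apply_gate_inv_gate: "apply_gate g (apply_gates (inv_gate g) \<psi>) x = \<psi> x"
proof (cases g)
  case (Hadamard i)
  show ?thesis
  proof (cases "i < length x")
    case True
    let ?a = "\<psi> (x[i := False])" and ?b = "\<psi> (x[i := True])" and ?s = "complex_of_real (sqrt 2)"
    let ?c = "if x ! i then - 1 else 1 :: complex"
    have s: "(u / ?s + c * (v / ?s)) / ?s = (u + c * v) / 2" for u v c
      by (simp only: times_divide_eq_right add_divide_distrib[symmetric] divide_divide_eq_left sqrt2_complex)
    have "apply_gate g (apply_gates (inv_gate g) \<psi>) x = ((?a + 1 * ?b) / ?s + ?c * ((?a + - 1 * ?b) / ?s)) / ?s"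
      using True by (simp only: Hadamard inv_gate.simps apply_gates_simps apply_gate.simps length_list_update
          list_update_overwrite nth_list_update_eq if_True if_False)
    also have "\<dots> = (?a + 1 * ?b + ?c * (?a + - 1 * ?b)) / 2" by (rule s)
    also have "\<dots> = \<psi> (x[i := x ! i])" by (cases "x ! i") (simp_all del: list_update_id)
    finally show ?thesis by simp
  qed (simp add: Hadamard)
next
  case (Tgate i)
  have "cis (pi / 4) ^ Suc 7 = 1" by (simp add: DeMoivre del: power_Suc)
  then have "cis (pi / 4) * cis (pi / 4) ^ 7 = 1" unfolding power_Suc .
  then show ?thesis by (simp add: Tgate apply_Tgates mult.assoc[symmetric])
next
  case (Cnot i j)
  then show ?thesis by (auto simp: nth_list_update)
next
  case (Toffoli i j k)
  then show ?thesis by (auto simp: nth_list_update)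
qed

lemma apply_gates_inv_gates: "apply_gates gs (apply_gates (inv_gates gs) \<psi>) = \<psi>"
proof (induction gs arbitrary: \<psi>)
  case (Cons g gs)
  have "apply_gate g (apply_gates (inv_gate g) \<phi>) = \<phi>" for \<phi>
    using apply_gate_inv_gate by blast
  then show ?case using Cons by (simp add: inv_gates_def)
qed (simp add: inv_gates_def)

section \<open>Classical gates as permutations of the basis\<close>

fun classical_step :: "gate \<Rightarrow> bits \<Rightarrow> bits" where
  "classical_step (Cnot i j) x =
     (if i < length x \<and> j < length x \<and> i \<noteq> j \<and> x ! i then x[j := \<not> x ! j] else x)"
| "classical_step (Toffoli i j k) x =
     (if i < length x \<and> j < length x \<and> k < length x \<and> distinct [i, j, k] \<and> x ! i \<and> x ! j
      then x[k := \<not> x ! k] else x)"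
| "classical_step _ x = x"

fun classical :: "gate \<Rightarrow> bool" where
  "classical (Cnot i j) = True"
| "classical (Toffoli i j k) = True"
| "classical _ = False"

lemma apply_classical: "classical g \<Longrightarrow> apply_gate g \<psi> x = \<psi> (classical_step g x)"
  by (cases g) auto

lemma length_classical_step [simp]: "length (classical_step g x) = length x"
  by (cases g) auto

lemma classical_step_involution [simp]: "classical_step g (classical_step g x) = x"
  by (cases g) (auto simp: nth_list_update)

lemma sum_classical_step:
  "(\<Sum>x\<in>bitstrings n. f (classical_step g x)) = (\<Sum>x\<in>bitstrings n. f x)"
  by (rule sum.reindex_bij_witness[of _ "classical_step g" "classical_step g"]) (auto simp: bitstrings_def)

section \<open>Unitarity\<close>

lemma sum_flip:
  "(\<Sum>x\<in>bitstrings n. f (x[i := \<not> x ! i])) = (\<Sum>x\<in>bitstrings n. f x)"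
proof (cases "i < n")
  case True
  show ?thesis
    by (rule sum.reindex_bij_witness[of _ "\<lambda>x. x[i := \<not> x ! i]" "\<lambda>x. x[i := \<not> x ! i]"])
      (use True in \<open>auto simp: bitstrings_def\<close>)
next
  case False
  then show ?thesis by (intro sum.cong) (auto simp: bitstrings_def list_update_beyond)
qed

lemma inner_prod_apply_gate:
  "inner_prod n (apply_gate g \<phi>) (apply_gate g \<psi>) = inner_prod n \<phi> \<psi>"
proof (cases "classical g")
  case True
  then show ?thesis
    using sum_classical_step[of "\<lambda>x. cnj (\<phi> x) * \<psi> x" g n] by (simp add: inner_prod_def apply_classical)
next
  case False
  then consider i where "g = Tgate i" | i where "g = Hadamard i" by (cases g) auto
  then show ?thesis
  proof cases
    case (1 i)
    have "cnj (cis (pi / 4)) * cis (pi / 4) = 1" by (simp add: cis_cnj cis_mult)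
    then have "cnj (cis (pi / 4) * a) * (cis (pi / 4) * b) = cnj a * b" for a b
      by (metis (no_types, lifting) complex_cnj_mult mult.assoc mult.commute mult.left_neutral)
    then show ?thesis by (auto simp: inner_prod_def 1 intro!: sum.cong)
  next
    case (2 i)
    show ?thesis
    proof (cases "i < n")
      case True
      let ?fl = "\<lambda>x. x[i := \<not> x ! i]"
      let ?F = "\<lambda>x. cnj (apply_gate g \<phi> x) * apply_gate g \<psi> x"
      let ?K = "\<lambda>x. cnj (\<phi> x) * \<psi> x"
      have h: "cnj ((a + c * b) / complex_of_real (sqrt 2)) * ((a' + c * b') / complex_of_real (sqrt 2))
          = (cnj a + cnj c * cnj b) * (a' + c * b') / 2" for a b a' b' c
        by (simp add: sqrt2_complex)
      \<comment> \<open>The Hadamard gate does not preserve single terms, only the sum over a pair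
        of strings that differ in bit \<open>i\<close>. Summing over all strings counts each pair
        twice on both sides.\<close>
      have "?F x + ?F (?fl x) = ?K x + ?K (?fl x)" if "x \<in> bitstrings n" for x
      proof -
        have i: "i < length x" using that True by (simp add: bitstrings_def)
        have "x[i := x ! i] = x" by simp
        then show ?thesis using i unfolding 2 apply_gate.simps
          by (cases "x ! i") (simp_all add: h algebra_simps add_divide_distrib diff_divide_distrib sqrt2_complex del: list_update_id)
      qed
      then have "(\<Sum>x\<in>bitstrings n. ?F x + ?F (?fl x)) = (\<Sum>x\<in>bitstrings n. ?K x + ?K (?fl x))"
        by (rule sum.cong[OF refl])
      then have "(\<Sum>x\<in>bitstrings n. ?F x) + (\<Sum>x\<in>bitstrings n. ?F x) = (\<Sum>x\<in>bitstrings n. ?K x) + (\<Sum>x\<in>bitstrings n. ?K x)"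
        unfolding sum.distrib using sum_flip[of ?F i n] sum_flip[of ?K i n] by simp
      then show ?thesis by (simp add: inner_prod_def)
    next
      case False
      then show ?thesis by (auto simp: inner_prod_def 2 bitstrings_def intro!: sum.cong)
    qed
  qed
qed

lemma inner_prod_apply_gates:
  "inner_prod n (apply_gates gs \<phi>) (apply_gates gs \<psi>) = inner_prod n \<phi> \<psi>"
  by (induction gs arbitrary: \<phi> \<psi>) (simp_all add: inner_prod_apply_gate)

lemma inner_prod_zero_vec: "inner_prod n (zero_vec n) \<psi> = \<psi> (replicate n False)"
proof -
  have "inner_prod n (zero_vec n) \<psi> = (\<Sum>x\<in>bitstrings n. if x = replicate n False then \<psi> x else 0)"
    unfolding inner_prod_def by (intro sum.cong) (auto simp: zero_vec_def)
  also have "\<dots> = \<psi> (replicate n False)" by (subst sum.delta[OF finite_bitstrings]) (simp add: bitstrings_def)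
  finally show ?thesis .
qed

lemma inner_prod_self: "inner_prod n \<psi> \<psi> = complex_of_real (\<Sum>x\<in>bitstrings n. (cmod (\<psi> x))\<^sup>2)"
  unfolding inner_prod_def of_real_sum by (intro sum.cong) (simp_all only: complex_norm_square mult.commute)

lemma norm_apply_gates_zero_vec: "(\<Sum>x\<in>bitstrings n. (cmod (apply_gates gs (zero_vec n) x))\<^sup>2) = 1"
proof -
  have "complex_of_real (\<Sum>x\<in>bitstrings n. (cmod (apply_gates gs (zero_vec n) x))\<^sup>2) = 1"
    unfolding inner_prod_self[symmetric] inner_prod_apply_gates inner_prod_zero_vec
    by (simp add: zero_vec_def)
  then show ?thesis using of_real_eq_1_iff by blast
qed

text \<open>By unitarity, \<open>\<langle>0|U\<^sup>*\<psi>\<rangle> =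
  \<langle>U0|\<psi>\<rangle>\<close>. This turns the test for all zeros after undoing a circuit
  into an overlap with the state that the circuit prepares.\<close>

lemma inv_gates_amplitude:
  "apply_gates (inv_gates gs) \<psi> (replicate n False) = inner_prod n (apply_gates gs (zero_vec n)) \<psi>"
  using inner_prod_apply_gates[of n gs "zero_vec n" "apply_gates (inv_gates gs) \<psi>"]
  by (simp add: apply_gates_inv_gates inner_prod_zero_vec)

text \<open>The fourth power of T is Z, and conjugating Z by Hadamard gates gives NOT.\<close>

definition not_gates :: "nat \<Rightarrow> gate list" where
  "not_gates i = Hadamard i # replicate 4 (Tgate i) @ [Hadamard i]"

lemma apply_not_gates:
  assumes "i < length x"
  shows "apply_gates (not_gates i) \<psi> x = \<psi> (x[i := \<not> x ! i])"
proof -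
  have "cis (pi / 4) ^ 4 = -1" by (simp add: DeMoivre)
  then have T: "apply_gates (replicate 4 (Tgate i)) \<phi> y = (if y ! i then - \<phi> y else \<phi> y)"
    if "length y = length x" for \<phi> y
    unfolding apply_Tgates using assms that by simp
  have s: "a / complex_of_real (sqrt 2) / complex_of_real (sqrt 2) = a / 2" for a
    by (simp add: sqrt2_complex)
  have "apply_gates (not_gates i) \<psi> x =
     ((\<psi> (x[i := False]) + \<psi> (x[i := True])) / complex_of_real (sqrt 2) -
      (if x ! i then -1 else 1) * ((\<psi> (x[i := False]) - \<psi> (x[i := True])) / complex_of_real (sqrt 2))) / complex_of_real (sqrt 2)"
    unfolding not_gates_def using assms by (simp add: T)
  also have "\<dots> = \<psi> (x[i := \<not> x ! i])"
    by (simp add: add_divide_distrib diff_divide_distrib s sqrt2_complex)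
  finally show ?thesis .
qed

definition classical_run :: "gate list \<Rightarrow> bits \<Rightarrow> bits" where
  "classical_run gs x = fold classical_step gs x"

text \<open>\<open>apply_gate\<close> pulls amplitudes back along a gate, whereas
  \<open>classical_run\<close> pushes basis strings forward. Each classical gate is an involution,
  so the two cancel one gate at a time.\<close>

lemma apply_gates_classical_run:
  "\<forall>g\<in>set gs. classical g \<Longrightarrow> apply_gates gs \<psi> (classical_run gs x) = \<psi> x"
proof (induction gs arbitrary: \<psi> x)
  case (Cons g gs)
  then show ?case by (simp add: classical_run_def apply_classical)
qed (simp add: classical_run_def)

lemma length_classical_run [simp]: "length (classical_run gs x) = length x"
  by (induction gs arbitrary: x) (simp_all add: classical_run_def)

lemma sum_classical_run:
  "(\<Sum>x\<in>bitstrings n. f (classical_run gs x)) = (\<Sum>x\<in>bitstrings n. f x)"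
proof (induction gs arbitrary: f)
  case (Cons g gs)
  have "(\<Sum>x\<in>bitstrings n. f (classical_run (g # gs) x)) = (\<Sum>x\<in>bitstrings n. f (classical_run gs (classical_step g x)))"
    by (simp add: classical_run_def)
  also have "\<dots> = (\<Sum>x\<in>bitstrings n. f (classical_run gs x))"
    by (rule sum_classical_step[of "\<lambda>x. f (classical_run gs x)"])
  finally show ?case using Cons by simp
qed (simp add: classical_run_def)

section \<open>The one-time signature scheme\<close>

lemma poly_time_drop_args:
  "poly_time k f \<Longrightarrow> poly_time (n + k) (\<lambda>xs. f (drop n xs))"
proof (induction n)
  case (Suc n)
  from poly_time_tl_args[OF Suc.IH[OF Suc.prems]] show ?case by (simp add: drop_Suc)
qed simp

lemma poly_nat_drop_args: "poly_nat k f \<Longrightarrow> poly_nat (n + k) (\<lambda>xs. f (drop n xs))"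
  unfolding poly_nat_def by (rule poly_time_drop_args)

lemma poly_nat_tl_args: "poly_nat k f \<Longrightarrow> poly_nat (Suc k) (\<lambda>xs. f (tl xs))"
  unfolding poly_nat_def by (rule poly_time_tl_args)

lemma poly_gates_tl_args: "poly_gates k f \<Longrightarrow> poly_gates (Suc k) (\<lambda>xs. f (tl xs))"
  unfolding poly_gates_def by (rule poly_time_tl_args)

lemma poly_pred_tl_args: "poly_pred k f \<Longrightarrow> poly_pred (Suc k) (\<lambda>xs. f (tl xs))"
  unfolding poly_pred_def by (rule poly_time_tl_args)

lemma poly_nat_ren_qubit:
  "poly_nat k s \<Longrightarrow> poly_nat k N \<Longrightarrow> poly_nat k M \<Longrightarrow> poly_nat k i \<Longrightarrow>
    poly_nat k (\<lambda>xs. ren_qubit (s xs) (N xs) (M xs) (i xs))"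
  unfolding ren_qubit_def by (intro poly_nat_if poly_pred_less poly_nat_add)

lemma poly_gates_ren:
  assumes "poly_nat k s" "poly_nat k N" "poly_nat k M" "poly_gates k gs"
  shows "poly_gates k (\<lambda>xs. map (ren_gate (s xs) (N xs) (M xs)) (gs xs))"
proof -
  have d: "poly_nat (Suc (Suc k)) (\<lambda>xs. f (drop 2 xs))" "poly_nat (Suc (Suc (Suc k))) (\<lambda>xs. f (drop 3 xs))"
    if "poly_nat k f" for f
    using poly_nat_drop_args[OF that, of 2] poly_nat_drop_args[OF that, of 3] by (simp_all add: eval_nat_numeral)
  have "poly_gates k (\<lambda>xs. concat (map (\<lambda>g. [ren_gate (s xs) (N xs) (M xs) g]) (gs xs)))"
    by (rule poly_gates_concat_map; (simp only: ren_gate.simps)?)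
      (intro poly_gates_Hadamard poly_gates_Tgate poly_gates_Cnot poly_gates_Toffoli poly_gates_Nil
        poly_nat_ren_qubit d poly_nat_tl_args poly_nat_length poly_time_nth assms; simp)+
  then show ?thesis by simp
qed

lemma poly_gates_inv_gates:
  assumes "poly_gates k gs"
  shows "poly_gates k (\<lambda>xs. inv_gates (gs xs))"
proof -
  have T: "inv_gate (Tgate i) = [Tgate i, Tgate i, Tgate i, Tgate i, Tgate i, Tgate i, Tgate i]" for i
    by (simp add: numeral_eq_Suc)
  show ?thesis unfolding inv_gates_def
    by (rule poly_gates_concat_rev_map[OF _ _ _ _ assms]; (simp only: T inv_gate.simps)?)
      (intro poly_gates_Hadamard poly_gates_Tgate poly_gates_Cnot poly_gates_Toffoli poly_gates_Nil
        poly_nat_length poly_time_nth; simp)+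
qed

text \<open>A secret key \<open>1\<^sup>l 0 k\<^sub>0 k\<^sub>1\<close> carries its own security parameter \<open>l\<close>.\<close>

definition sig_key :: "bits \<Rightarrow> bool \<Rightarrow> bits" where
  "sig_key sk m = (let n = length (takeWhile (\<lambda>b. b) sk); r = drop (Suc n) sk
     in if m then drop n r else take n r)"

text \<open>The leading zero qubit of the public key becomes the output qubit of the verification.\<close>

definition pk_circ :: "(bits \<Rightarrow> circ) \<Rightarrow> bits \<Rightarrow> circ" where
  "pk_circ G sk =
     (let C0 = G (sig_key sk False); C1 = G (sig_key sk True); q0 = ancillas C0; q1 = ancillas C1;
          w = Suc (q0 + q1)
      in Circ w w (map (ren_gate 1 q0 w) (gates C0) @ map (ren_gate (Suc q0) q1 w) (gates C1)))"

text \<open>Qubit \<open>A + i\<close> accumulates the disjunction of the qubits \<open>s, \<dots>, s + i - 1\<close>.\<close>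

definition or_gates :: "nat \<Rightarrow> nat \<Rightarrow> nat \<Rightarrow> gate list" where
  "or_gates s A q = concat (map (\<lambda>i. [Cnot (A + i) (Suc (A + i)), Cnot (s + i) (Suc (A + i)),
     Toffoli (A + i) (s + i) (Suc (A + i))]) [0..<q])"

text \<open>Layout: qubit 0 for the result, then the two halves of the key, and from
  \<open>A\<close> on the \<open>q + 1\<close> ancillas of the disjunction. Qubit
  \<open>A + q\<close> ends up telling whether the tested half is nonzero; it is copied to qubit 0,
  and the final NOT turns this into acceptance of zero. \<open>w\<close> is the size of the
  register.\<close>

definition verify_circ :: "(bits \<Rightarrow> circ) \<Rightarrow> bool \<Rightarrow> bits \<Rightarrow> circ" where
  "verify_circ G m \<sigma> =
     (let C = G \<sigma>; q = ancillas C; s = (if m then Suc q else 1); A = Suc (2 * q); w = A + Suc q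
      in Circ (Suc q) 1 (map (ren_gate s q w) (inv_gates (gates C)) @ or_gates s A q @ Cnot (A + q) 0 # not_gates 0))"

text \<open>Keys of equal length give equally many qubits, so \<open>pk_qubits\<close> may look at
  the all-zero key. For a signature of the wrong length, whose circuit might not fit, the empty
  circuit outputs the leading zero qubit of the public key and thereby rejects.\<close>

definition lamport_scheme :: "(bits \<Rightarrow> circ) \<Rightarrow> sig_scheme" where
  "lamport_scheme G =
     \<lparr>gen1_coins = [:0, 2:],
      gen1 = (\<lambda>xs. xs ! 0 @ False # xs ! 1),
      pk_qubits = (\<lambda>l. Suc (2 * ancillas (G (replicate l False)))),
      gen2 = \<lparr>coins = 0, circuit = (\<lambda>xs. pk_circ G (xs ! 0))\<rparr>,
      sign = (\<lambda>xs. sig_key (xs ! 0) (xs ! 1 \<noteq> [] \<and> hd (xs ! 1))),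
      verify = \<lparr>coins = 0, circuit = (\<lambda>xs. if length (xs ! 2) = length (xs ! 0)
        then verify_circ G (xs ! 1 \<noteq> [] \<and> hd (xs ! 1)) (xs ! 2) else Circ 0 1 [])\<rparr>\<rparr>"

lemma poly_time_sig_key:
  assumes "poly_time k f" "poly_pred k P"
  shows "poly_time k (\<lambda>xs. sig_key (f xs) (P xs))"
  unfolding sig_key_def Let_def
  by (intro poly_time_if assms poly_time_drop poly_time_take poly_nat_Suc poly_nat_takeWhile)

lemma poly_pred_const: "poly_pred k (\<lambda>xs. b)"
  unfolding poly_pred_def by (rule poly_time_const)

lemma circ_gen_comp1:
  assumes "circ_gen 1 (\<lambda>xs. G (hd xs))" "poly_time k f"
  shows "circ_gen k (\<lambda>xs. G (f xs))"
  using poly_time_comp1[OF assms(1)[unfolded circ_gen_def] assms(2)] by (simp add: circ_gen_def)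

lemma circ_gen_pk_circ:
  assumes G: "circ_gen 1 (\<lambda>xs. G (hd xs))" and f: "poly_time k f"
  shows "circ_gen k (\<lambda>xs. pk_circ G (f xs))"
  unfolding pk_circ_def Let_def
  by (intro circ_gen_Circ poly_nat_Suc poly_nat_add poly_nat_ancillas poly_gates_append poly_gates_ren
      poly_gates_gates poly_nat_const circ_gen_comp1[OF G] poly_time_sig_key f poly_pred_const)

lemma poly_gates_or_gates:
  assumes "poly_nat k s" "poly_nat k A" "poly_nat k q"
  shows "poly_gates k (\<lambda>xs. or_gates (s xs) (A xs) (q xs))"
  unfolding or_gates_def
  by (intro poly_gates_concat_upt poly_gates_Cnot poly_gates_Toffoli poly_gates_Nil poly_nat_Suc poly_nat_add
      poly_nat_tl_args assms poly_nat_length poly_time_nth zero_less_Suc)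

lemma circ_gen_verify_circ:
  assumes G: "circ_gen 1 (\<lambda>xs. G (hd xs))" and f: "poly_time k f" and P: "poly_pred k P"
  shows "circ_gen k (\<lambda>xs. verify_circ G (P xs) (f xs))"
proof -
  have "not_gates i = [Hadamard i, Tgate i, Tgate i, Tgate i, Tgate i, Hadamard i]" for i
    by (simp add: not_gates_def numeral_eq_Suc)
  then show ?thesis
    unfolding verify_circ_def Let_def
    by (simp only:) (intro circ_gen_Circ poly_nat_Suc poly_nat_add poly_nat_mult poly_nat_if poly_nat_ancillas poly_gates_append
      poly_gates_ren poly_gates_inv_gates poly_gates_or_gates poly_gates_Cnot poly_gates_Hadamard poly_gates_Tgate
      poly_gates_Nil poly_gates_gates poly_nat_const circ_gen_comp1[OF G] f P)
qed

section \<open>Averages over random strings\<close>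

lemma avg_0 [simp]: "avg 0 f = f []"
  by (simp add: avg_def)

lemma avg_add: "avg (m + n) f = avg m (\<lambda>x. avg n (\<lambda>y. f (x @ y)))"
  by (simp add: avg_def sum_bitstrings_add power_add sum_divide_distrib mult.commute)

lemma avg_const [simp]: "avg n (\<lambda>_. c) = c"
proof -
  have "card (bitstrings n) = 2 ^ n"
    using card_lists_length_eq[of "UNIV :: bool set" n] by (simp add: bitstrings_def)
  then show ?thesis by (simp add: avg_def)
qed

lemma avg_cong: "(\<And>x. length x = n \<Longrightarrow> f x = g x) \<Longrightarrow> avg n f = avg n g"
  unfolding avg_def by (metis (mono_tags, lifting) bitstrings_def mem_Collect_eq sum.cong)

lemma avg_mono:
  fixes f g :: "bits \<Rightarrow> real"
  shows "(\<And>x. length x = n \<Longrightarrow> f x \<le> g x) \<Longrightarrow> avg n f \<le> avg n g"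
  unfolding avg_def by (intro divide_right_mono sum_mono) (auto simp: bitstrings_def)

text \<open>The product of a zero qubit, \<open>\<phi>\<close> and \<open>\<psi>\<close>. It
  vanishes at strings of other lengths because \<open>out_circ\<close> does so; public keys thus
  equal its \<open>proj_op\<close> as functions.\<close>

definition key_vec :: "nat \<Rightarrow> qvec \<Rightarrow> qvec \<Rightarrow> qvec" where
  "key_vec q \<phi> \<psi> = (\<lambda>x. if length x = Suc (2 * q) \<and> \<not> hd x then \<phi> (take q (tl x)) * \<psi> (drop q (tl x)) else 0)"

lemma key_vec_append:
  "length x = q \<Longrightarrow> length y = q \<Longrightarrow> key_vec q \<phi> \<psi> (b # x @ y) = (if b then 0 else \<phi> x * \<psi> y)"
  by (simp add: key_vec_def)

lemma classical_run_append: "classical_run (gs @ hs) x = classical_run hs (classical_run gs x)"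
  by (simp add: classical_run_def)

lemma classical_or_gates: "\<forall>g\<in>set (or_gates s A q). classical g"
  by (auto simp: or_gates_def)

lemma classical_run_or_gates:
  assumes "s + q \<le> A" "A + q < length x" "\<And>i. i \<le> q \<Longrightarrow> \<not> x ! (A + i)" "p < length x"
  shows "classical_run (or_gates s A q) x ! p =
    (if A \<le> p \<and> p \<le> A + q then \<exists>j < p - A. x ! (s + j) else x ! p)"
  using assms
proof (induction q arbitrary: p)
  case 0
  then show ?case by (auto simp: or_gates_def classical_run_def)
next
  case (Suc q)
  define y where "y = classical_run (or_gates s A q) x"
  have IH: "y ! p = (if A \<le> p \<and> p \<le> A + q then \<exists>j < p - A. x ! (s + j) else x ! p)" if "p < length x" for p
    unfolding y_def by (rule Suc.IH) (use Suc.prems that in auto)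
  let ?c = "Suc (A + q)"
  have y: "length y = length x" "y ! (A + q) = (\<exists>j<q. x ! (s + j))" "y ! (s + q) = x ! (s + q)" "\<not> y ! ?c"
    using IH Suc.prems(1,2) Suc.prems(3)[of "Suc q"] by (auto simp: y_def)
  have id: "y[?c := False] = y" using y(4) by (metis (full_types) list_update_id)
  \<comment> \<open>For the bits \<open>a\<close> and \<open>b\<close> at \<open>A + q\<close> and
    \<open>s + q\<close>, the three gates add \<open>a\<close>, \<open>b\<close> and
    \<open>a b\<close> modulo 2 to the zero qubit \<open>?c\<close>, and this sum is the
    disjunction.\<close>
  have "or_gates s A (Suc q) = or_gates s A q @ [Cnot (A + q) ?c, Cnot (s + q) ?c, Toffoli (A + q) (s + q) ?c]"
    by (simp add: or_gates_def)
  then have "classical_run (or_gates s A (Suc q)) x =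
      classical_run [Cnot (A + q) ?c, Cnot (s + q) ?c, Toffoli (A + q) (s + q) ?c] y"
    by (simp add: classical_run_append y_def)
  also have "\<dots> = y[?c := y ! (A + q) \<or> y ! (s + q)]"
    using y(1,4) id Suc.prems(1,2)
    by (cases "y ! (A + q)"; cases "y ! (s + q)") (simp_all add: classical_run_def nth_list_update)
  finally have eq: "classical_run (or_gates s A (Suc q)) x = y[?c := y ! (A + q) \<or> y ! (s + q)]" .
  show ?case
  proof (cases "p = ?c")
    case True
    then show ?thesis using y Suc.prems(2) unfolding eq by (auto simp: less_Suc_eq)
  next
    case False
    then show ?thesis using IH[OF Suc.prems(4)] unfolding eq by auto
  qed
qed

section \<open>Public keys and the acceptance probability\<close>

locale one_way_generator =
  fixes G :: "bits \<Rightarrow> circ"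
  assumes owsg: "owsg G"
begin

definition qubits :: "nat \<Rightarrow> nat" where
  "qubits l = ancillas (G (replicate l False))"

lemma ancillas_G: "ancillas (G k) = qubits (length k)"
  using owsg unfolding owsg_def qubits_def by (metis length_replicate)

lemma circ_gen_G: "circ_gen 1 (\<lambda>xs. G (hd xs))"
  using owsg unfolding owsg_def by blast

definition sk_of :: "nat \<Rightarrow> bits \<Rightarrow> bits \<Rightarrow> bits" where
  "sk_of l k0 k1 = unary l @ False # k0 @ k1"

lemma sig_key_sk_of:
  assumes "length k0 = l" "length k1 = l"
  shows "sig_key (sk_of l k0 k1) m = (if m then k1 else k0)"
proof -
  have "takeWhile (\<lambda>b. b) (sk_of l k0 k1) = unary l"
    unfolding sk_of_def by (induction l) auto
  then show ?thesis using assms by (simp add: sig_key_def sk_of_def)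
qed

lemma pk_circ_sk_of:
  assumes "length k0 = l" "length k1 = l"
  shows "ancillas (pk_circ G (sk_of l k0 k1)) = Suc (2 * qubits l)"
    "outputs (pk_circ G (sk_of l k0 k1)) = Suc (2 * qubits l)"
  using assms by (simp_all add: pk_circ_def sig_key_sk_of ancillas_G Let_def)

text \<open>The two circuits act on disjoint blocks of zeros. While one block is transformed, the
  rest of the string contributes only a scalar, which linearity moves out.\<close>

lemma apply_pk_circ:
  assumes k: "length k0 = l" "length k1 = l" and x: "length x = Suc (2 * qubits l)"
  shows "apply_gates (gates (pk_circ G (sk_of l k0 k1))) (zero_vec (Suc (2 * qubits l))) x =
    key_vec (qubits l) (owsg_vec G k0) (owsg_vec G k1) x"
proof -
  let ?q = "qubits l" and ?w = "Suc (2 * qubits l)"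
  obtain b x' where "x = b # x'" using x by (cases x) auto
  moreover define x0 x1 where "x0 = take ?q x'" and "x1 = drop ?q x'"
  ultimately have x: "x = [b] @ x0 @ x1" "length x0 = ?q" "length x1 = ?q" using x by auto
  have z: "zero_vec ?w ([b] @ y @ y') = (if b then 0 else zero_vec ?q y * zero_vec ?q y')" if "length y = ?q" for y y'
    using that by (simp add: zero_vec_Cons zero_vec_append mult_2)
  have 1: "apply_gates (map (ren_gate 1 ?q ?w) (gates (G k0))) (zero_vec ?w) ([b] @ x0 @ y) =
      (if b then 0 else zero_vec ?q y) * owsg_vec G k0 x0" if y: "length y = ?q" for y
  proof -
    have "apply_gates (map (ren_gate 1 ?q ?w) (gates (G k0))) (zero_vec ?w) ([b] @ x0 @ y) =
        apply_gates (gates (G k0)) (\<lambda>v. zero_vec ?w ([b] @ v @ y)) x0"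
      by (rule apply_ren_gates) (use x y in auto)
    also have "\<dots> = apply_gates (gates (G k0)) (\<lambda>v. (if b then 0 else zero_vec ?q y) * zero_vec ?q v) x0"
      by (rule apply_gates_cong) (use x z in simp)
    also have "\<dots> = (if b then 0 else zero_vec ?q y) * owsg_vec G k0 x0"
      unfolding apply_gates_scale owsg_vec_def ancillas_G k ..
    finally show ?thesis .
  qed
  let ?\<Psi> = "apply_gates (map (ren_gate 1 ?q ?w) (gates (G k0))) (zero_vec ?w)"
  have "apply_gates (gates (pk_circ G (sk_of l k0 k1))) (zero_vec ?w) x =
      apply_gates (map (ren_gate (Suc ?q) ?q ?w) (gates (G k1))) ?\<Psi> (([b] @ x0) @ x1 @ [])"
    using k x by (simp add: pk_circ_def sig_key_sk_of ancillas_G Let_def mult_2)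
  also have "\<dots> = apply_gates (gates (G k1)) (\<lambda>v. ?\<Psi> (([b] @ x0) @ v @ [])) x1"
    by (rule apply_ren_gates) (use x in auto)
  also have "\<dots> = apply_gates (gates (G k1)) (\<lambda>v. (if b then 0 else owsg_vec G k0 x0) * zero_vec ?q v) x1"
    by (rule apply_gates_cong) (use x 1 in simp)
  also have "\<dots> = (if b then 0 else owsg_vec G k0 x0) * owsg_vec G k1 x1"
    unfolding apply_gates_scale owsg_vec_def ancillas_G k ..
  also have "\<dots> = key_vec ?q (owsg_vec G k0) (owsg_vec G k1) x"
    using x by (simp add: key_vec_append)
  finally show ?thesis .
qed

text \<open>Key generation tosses no coins and outputs its whole register, so averaging and partial
  trace are both over the empty string and the key is pure.\<close>

lemma public_key_sk_of:
  assumes k: "length k0 = l" "length k1 = l"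
  shows "public_key (lamport_scheme G) (sk_of l k0 k1) =
    proj_op (key_vec (qubits l) (owsg_vec G k0) (owsg_vec G k1))"
proof (intro ext)
  fix x y :: bits
  let ?w = "Suc (2 * qubits l)" and ?C = "pk_circ G (sk_of l k0 k1)"
  have t: "tensor_vec 0 (zero_vec 0) \<psi> = \<psi>" for \<psi>
    by (simp add: tensor_vec_def)
  have s: "out_size 0 ?C = ?w" by (simp add: out_size_def pk_circ_sk_of k)
  have z: "key_vec (qubits l) (owsg_vec G k0) (owsg_vec G k1) v = 0" if "length v \<noteq> ?w" for v
    using that by (simp add: key_vec_def)
  have r: "run_circ 0 ?C (zero_op 0) = proj_op (apply_gates (gates ?C) (zero_vec ?w))"
    by (simp add: zero_op_proj_op run_circ_proj_op t pk_circ_sk_of k)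
  have "public_key (lamport_scheme G) (sk_of l k0 k1) x y = out_circ 0 ?C (zero_op 0) x y"
    by (simp add: public_key_def qalg_out_def lamport_scheme_def coin_length_def)
  also have "\<dots> = proj_op (key_vec (qubits l) (owsg_vec G k0) (owsg_vec G k1)) x y"
    using z by (auto simp: out_circ_def s r pk_circ_sk_of k proj_op_def apply_pk_circ)
  finally show "public_key (lamport_scheme G) (sk_of l k0 k1) x y =
    proj_op (key_vec (qubits l) (owsg_vec G k0) (owsg_vec G k1)) x y" .
qed


lemma norm_owsg_vec: "(\<Sum>x\<in>bitstrings (qubits (length k)). (cmod (owsg_vec G k x))\<^sup>2) = 1"
  unfolding owsg_vec_def ancillas_G by (rule norm_apply_gates_zero_vec)

text \<open>After the inverse circuit the state is still a product. The half that is not tested has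
  norm one and sums out, the ancillas start at zero, and acceptance selects the amplitude of the
  tested half at the zero string, which \<open>inv_gates_amplitude\<close> identifies as an
  overlap.\<close>

lemma accept_prob_lamport:
  assumes k: "length k0 = l" "length k1 = l" and \<sigma>: "length \<sigma> = l"
  shows "accept_prob (lamport_scheme G) l (sk_of l k0 k1) m \<sigma> =
    (cmod (inner_prod (qubits l) (owsg_vec G \<sigma>) (owsg_vec G (if m then k1 else k0))))\<^sup>2"
proof -
  let ?q = "qubits l" and ?C = "verify_circ G m \<sigma>"
  define s A w where "s = (if m then Suc ?q else 1)" and "A = Suc (2 * ?q)" and "w = A + Suc ?q"
  define inv where "inv = inv_gates (gates (G \<sigma>))"
  \<comment> \<open>The classical part of the circuit. The final NOT is kept apart, as it is built
    from Hadamard and T gates.\<close>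
  define gs where "gs = or_gates s A ?q @ [Cnot (A + ?q) 0]"
  define pk where "pk = key_vec ?q (owsg_vec G k0) (owsg_vec G k1)"
  define \<Psi>0 where "\<Psi>0 = tensor_vec A pk (zero_vec (Suc ?q))"
  define \<Psi>1 where "\<Psi>1 = apply_gates (map (ren_gate s ?q w) inv) \<Psi>0"
  define \<Psi>3 where "\<Psi>3 = apply_gates gs \<Psi>1"
  define \<eta> where "\<eta> = apply_gates inv (owsg_vec G (if m then k1 else k0))"
  have C: "?C = Circ (Suc ?q) 1 (map (ren_gate s ?q w) inv @ gs @ not_gates 0)"
    using \<sigma> by (simp add: verify_circ_def Let_def ancillas_G s_def A_def w_def inv_def gs_def)
  have "accept_prob (lamport_scheme G) l (sk_of l k0 k1) m \<sigma> = outcome_prob (out_circ A ?C (proj_op pk)) [True]"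
    using \<sigma> public_key_sk_of[OF k]
    by (simp add: accept_prob_def qalg_out_def coin_length_def lamport_scheme_def qubits_def[symmetric] A_def pk_def)
  also have "\<dots> = (\<Sum>z\<in>bitstrings (A + ?q). (cmod (apply_gates (gates ?C) \<Psi>0 ([True] @ z)))\<^sup>2)"
    by (subst outcome_prob_proj_op) (simp_all add: C out_size_def A_def \<Psi>0_def)
  \<comment> \<open>Pulled back through the final NOT, the outcome \<open>True\<close> becomes
    \<open>False\<close>.\<close>
  also have "\<dots> = (\<Sum>z\<in>bitstrings (A + ?q). (cmod (\<Psi>3 (False # z)))\<^sup>2)"
    by (simp add: C \<Psi>3_def \<Psi>1_def apply_not_gates)
  also have "\<dots> = (\<Sum>x\<in>bitstrings (Suc 0 + (A + ?q)). if x ! 0 then 0 else (cmod (\<Psi>3 x))\<^sup>2)"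
    unfolding sum_bitstrings_add sum_bitstrings_1 by simp
  also have "\<dots> = (\<Sum>x\<in>bitstrings w. if x ! 0 then 0 else (cmod (\<Psi>3 x))\<^sup>2)"
    by (simp add: w_def)
  \<comment> \<open>The classical gates permute the basis strings; reindexing by this permutation
    expresses the probability through the amplitudes in front of them.\<close>
  also have "\<dots> = (\<Sum>y\<in>bitstrings w. if classical_run gs y ! 0 then 0 else (cmod (\<Psi>3 (classical_run gs y)))\<^sup>2)"
    by (rule sum_classical_run[of "\<lambda>x. if x ! 0 then 0 else (cmod (\<Psi>3 x))\<^sup>2", symmetric])
  also have "\<dots> = (\<Sum>y\<in>bitstrings w. if classical_run gs y ! 0 then 0 else (cmod (\<Psi>1 y))\<^sup>2)"
    unfolding \<Psi>3_def using classical_or_gates by (subst apply_gates_classical_run) (auto simp: gs_def)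
  also have "\<dots> = (\<Sum>y\<in>bitstrings (Suc 0 + (?q + (?q + Suc ?q))). if classical_run gs y ! 0 then 0 else (cmod (\<Psi>1 y))\<^sup>2)"
    by (simp add: w_def A_def mult_2 add.assoc)
  also have "\<dots> = (\<Sum>b\<in>bitstrings (Suc 0). \<Sum>x0\<in>bitstrings ?q. \<Sum>x1\<in>bitstrings ?q. \<Sum>a\<in>bitstrings (Suc ?q).
      if classical_run gs (b @ x0 @ x1 @ a) ! 0 then 0 else (cmod (\<Psi>1 (b @ x0 @ x1 @ a)))\<^sup>2)"
    unfolding sum_bitstrings_add ..
  also have "\<dots> = (\<Sum>b\<in>bitstrings (Suc 0). \<Sum>x0\<in>bitstrings ?q. \<Sum>x1\<in>bitstrings ?q. \<Sum>a\<in>bitstrings (Suc ?q).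
      if b = [False] then
        if a = replicate (Suc ?q) False then
          if m then if x1 = replicate ?q False then (cmod (owsg_vec G k0 x0))\<^sup>2 * (cmod (\<eta> x1))\<^sup>2 else 0
          else if x0 = replicate ?q False then (cmod (\<eta> x0))\<^sup>2 * (cmod (owsg_vec G k1 x1))\<^sup>2 else 0
        else 0 else 0)"
  proof (intro sum.cong refl)
    fix b x0 x1 a :: bits
    assume "b \<in> bitstrings (Suc 0)" "x0 \<in> bitstrings ?q" "x1 \<in> bitstrings ?q" "a \<in> bitstrings (Suc ?q)"
    then obtain c where b: "b = [c]" and l: "length x0 = ?q" "length x1 = ?q" "length a = Suc ?q"
      by (auto simp: bitstrings_def length_Suc_conv)
    have \<Psi>0: "\<Psi>0 ([c] @ y @ y' @ a) = (if c then 0 else owsg_vec G k0 y * owsg_vec G k1 y') * zero_vec (Suc ?q) a"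
      if "length y = ?q" "length y' = ?q" for y y'
      using that by (simp add: \<Psi>0_def tensor_vec_def A_def pk_def key_vec_append mult_2)
    have \<Psi>1: "\<Psi>1 (b @ x0 @ x1 @ a) = (if c then 0 else if m then owsg_vec G k0 x0 * \<eta> x1 else \<eta> x0 * owsg_vec G k1 x1)
        * zero_vec (Suc ?q) a"
    proof (cases m)
      case True
      have "\<Psi>1 (([c] @ x0) @ x1 @ a) = apply_gates inv (\<lambda>v. \<Psi>0 (([c] @ x0) @ v @ a)) x1"
        unfolding \<Psi>1_def by (rule apply_ren_gates) (use l True in \<open>auto simp: s_def w_def A_def\<close>)
      also have "\<dots> = apply_gates inv (\<lambda>v. ((if c then 0 else owsg_vec G k0 x0) * zero_vec (Suc ?q) a) * owsg_vec G k1 v) x1"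
        by (rule apply_gates_cong) (use l \<Psi>0 in auto)
      also have "\<dots> = ((if c then 0 else owsg_vec G k0 x0) * zero_vec (Suc ?q) a) * \<eta> x1"
        unfolding apply_gates_scale using True by (simp add: \<eta>_def)
      finally show ?thesis using True by (simp add: b)
    next
      case False
      have "\<Psi>1 ([c] @ x0 @ (x1 @ a)) = apply_gates inv (\<lambda>v. \<Psi>0 ([c] @ v @ (x1 @ a))) x0"
        unfolding \<Psi>1_def by (rule apply_ren_gates) (use l False in \<open>auto simp: s_def w_def A_def\<close>)
      also have "\<dots> = apply_gates inv (\<lambda>v. ((if c then 0 else owsg_vec G k1 x1) * zero_vec (Suc ?q) a) * owsg_vec G k0 v) x0"
        by (rule apply_gates_cong) (use l \<Psi>0 in auto)
      also have "\<dots> = ((if c then 0 else owsg_vec G k1 x1) * zero_vec (Suc ?q) a) * \<eta> x0"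
        unfolding apply_gates_scale using False by (simp add: \<eta>_def)
      finally show ?thesis using False by (simp add: b)
    qed
    let ?x = "b @ x0 @ x1 @ a"
    have run: "classical_run gs ?x ! 0 \<longleftrightarrow> \<not> (if m then x1 = replicate ?q False else x0 = replicate ?q False)"
      if "\<not> c" "a = replicate (Suc ?q) False"
    proof -
      have x: "length ?x = w" using l b by (simp add: w_def A_def)
      have a: "\<not> ?x ! (A + i)" if "i \<le> ?q" for i
        using that l b \<open>a = _\<close> by (simp add: A_def nth_append del: replicate_Suc)
      let ?y = "classical_run (or_gates s A ?q) ?x"
      have y: "?y ! p = (if A \<le> p \<and> p \<le> A + ?q then \<exists>j < p - A. ?x ! (s + j) else ?x ! p)" if "p < w" for p
        by (rule classical_run_or_gates) (use that x a in \<open>auto simp: s_def A_def w_def\<close>)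
      have "classical_run gs ?x ! 0 \<longleftrightarrow> (\<exists>j<?q. ?x ! (s + j))"
        using y[of 0] y[of "A + ?q"] x \<open>\<not> c\<close> b
        by (auto simp: gs_def classical_run_append classical_run_def[of "[_]"] w_def A_def)
      also have "\<dots> \<longleftrightarrow> (\<exists>j<?q. (if m then x1 else x0) ! j)"
        using l b by (intro ex_cong1 conj_cong refl) (auto simp: s_def nth_append)
      also have "\<dots> \<longleftrightarrow> \<not> (if m then x1 = replicate ?q False else x0 = replicate ?q False)"
        using l by (auto simp: list_eq_iff_nth_eq)
      finally show ?thesis .
    qed
    show "(if classical_run gs ?x ! 0 then 0 else (cmod (\<Psi>1 ?x))\<^sup>2) =
      (if b = [False] then
        if a = replicate (Suc ?q) False then
          if m then if x1 = replicate ?q False then (cmod (owsg_vec G k0 x0))\<^sup>2 * (cmod (\<eta> x1))\<^sup>2 else 0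
          else if x0 = replicate ?q False then (cmod (\<eta> x0))\<^sup>2 * (cmod (owsg_vec G k1 x1))\<^sup>2 else 0
        else 0 else 0)"
    proof (cases "\<not> c \<and> a = replicate (Suc ?q) False")
      case True
      have v: "\<Psi>1 ?x = (if m then owsg_vec G k0 x0 * \<eta> x1 else \<eta> x0 * owsg_vec G k1 x1)"
        unfolding \<Psi>1 using True by (simp add: zero_vec_def del: replicate_Suc)
      have "b = [False]" "a = replicate (Suc ?q) False" using True b by auto
      moreover note run
      ultimately show ?thesis using True unfolding v
        by (simp only: norm_mult power_mult_distrib if_True if_False refl simp_thms if_not_P split: if_splits) auto
    next
      case False
      then have "\<Psi>1 ?x = 0" unfolding \<Psi>1 by (auto simp: zero_vec_def)
      then show ?thesis using False b by auto
    qed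
  qed
  also have "\<dots> = (\<Sum>x0\<in>bitstrings ?q. \<Sum>x1\<in>bitstrings ?q.
          if m then if x1 = replicate ?q False then (cmod (owsg_vec G k0 x0))\<^sup>2 * (cmod (\<eta> x1))\<^sup>2 else 0
          else if x0 = replicate ?q False then (cmod (\<eta> x0))\<^sup>2 * (cmod (owsg_vec G k1 x1))\<^sup>2 else 0)"
  proof -
    have "(\<Sum>a\<in>bitstrings (Suc ?q). if a = replicate (Suc ?q) False then f else 0) = f" for f :: real
      by (subst sum.delta[OF finite_bitstrings]) (simp add: bitstrings_def)
    then show ?thesis unfolding sum_bitstrings_1 by (simp del: replicate_Suc)
  qed
  also have "\<dots> = (cmod (\<eta> (replicate ?q False)))\<^sup>2"
  proof -
    have d: "(\<Sum>x\<in>bitstrings ?q. if x = replicate ?q False then f x else 0) = f (replicate ?q False)" for f :: "bits \<Rightarrow> real"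
      by (subst sum.delta[OF finite_bitstrings]) (simp add: bitstrings_def)
    show ?thesis
    proof (cases m)
      case True
      then show ?thesis using norm_owsg_vec[of k0] k
        by (simp add: d sum_distrib_right[symmetric])
    next
      case False
      have "(\<Sum>x0\<in>bitstrings ?q. \<Sum>x1\<in>bitstrings ?q.
          if x0 = replicate ?q False then (cmod (\<eta> x0))\<^sup>2 * (cmod (owsg_vec G k1 x1))\<^sup>2 else 0) =
          (\<Sum>x1\<in>bitstrings ?q. (cmod (\<eta> (replicate ?q False)))\<^sup>2 * (cmod (owsg_vec G k1 x1))\<^sup>2)"
        by (subst sum.swap) (simp add: d)
      then show ?thesis using norm_owsg_vec[of k1] k False
        by (simp add: sum_distrib_left[symmetric])
    qed
  qed
  also have "\<eta> (replicate ?q False) = inner_prod ?q (owsg_vec G \<sigma>) (owsg_vec G (if m then k1 else k0))"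
    unfolding \<eta>_def inv_def inv_gates_amplitude owsg_vec_def[of G \<sigma>] ancillas_G \<sigma> ..
  finally show ?thesis .
qed

text \<open>The measured qubit is the leading one of the public key, where \<open>key_vec\<close>
  has no amplitude on \<open>True\<close>. So only forgeries of \<open>l\<close> bits matter to the
  reduction.\<close>

lemma accept_prob_wrong_length:
  assumes k: "length k0 = l" "length k1 = l" and \<sigma>: "length \<sigma> \<noteq> l"
  shows "accept_prob (lamport_scheme G) l (sk_of l k0 k1) m \<sigma> = 0"
proof -
  let ?A = "Suc (2 * qubits l)"
  define pk where "pk = key_vec (qubits l) (owsg_vec G k0) (owsg_vec G k1)"
  have "accept_prob (lamport_scheme G) l (sk_of l k0 k1) m \<sigma> = outcome_prob (out_circ ?A (Circ 0 1 []) (proj_op pk)) [True]"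
    using \<sigma> public_key_sk_of[OF k]
    by (simp add: accept_prob_def qalg_out_def coin_length_def lamport_scheme_def qubits_def[symmetric] pk_def)
  also have "\<dots> = 0"
    by (subst outcome_prob_proj_op)
      (auto simp: out_size_def tensor_vec_def pk_def key_vec_def bitstrings_def intro!: sum.neutral)
  finally show ?thesis .
qed

end

section \<open>Reduction of forging to inverting\<close>

definition swap_gates :: "nat \<Rightarrow> nat \<Rightarrow> nat \<Rightarrow> gate list" where
  "swap_gates a b q = concat (map (\<lambda>i. [Cnot (a + i) (b + i), Cnot (b + i) (a + i), Cnot (a + i) (b + i)]) [0..<q])"

lemma apply_swap:
  assumes "a < length x" "b < length x" "a \<noteq> b"
  shows "apply_gates [Cnot a b, Cnot b a, Cnot a b] \<psi> x = \<psi> (x[a := x ! b, b := x ! a])"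
proof -
  have "x[a := x ! a] = x" "x[b := x ! b] = x" by simp_all
  then show ?thesis using assms
    by (cases "x ! a"; cases "x ! b") (auto simp: nth_list_update list_update_swap)
qed

lemma apply_swap_gates:
  assumes "length u = a" "length v = q" "length v' = q" "length (u @ v @ w) = b"
  shows "apply_gates (swap_gates a b q) \<Psi> (u @ v @ w @ v' @ z) = \<Psi> (u @ v' @ w @ v @ z)"
  using assms
proof (induction q arbitrary: v v' w z)
  case 0
  then show ?case by (simp add: swap_gates_def)
next
  case (Suc q)
  obtain v1 c where v: "v = v1 @ [c]" "length v1 = q" using Suc.prems(2) by (cases v rule: rev_cases) auto
  obtain v1' c' where v': "v' = v1' @ [c']" "length v1' = q" using Suc.prems(3) by (cases v' rule: rev_cases) auto
  let ?x = "(u @ v1) @ c # (w @ v1') @ c' # z"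
  have b: "b = Suc (a + q + length w)" using Suc.prems v by simp
  have n: "?x ! (a + q) = c" "?x ! (b + q) = c'" "?x[a + q := c', b + q := c] = (u @ v1) @ c' # (w @ v1') @ c # z"
    using Suc.prems(1) v(2) v'(2) by (auto simp: b nth_append list_update_append)
  have "swap_gates a b (Suc q) = swap_gates a b q @ [Cnot (a + q) (b + q), Cnot (b + q) (a + q), Cnot (a + q) (b + q)]"
    by (simp add: swap_gates_def)
  then have "apply_gates (swap_gates a b (Suc q)) \<Psi> ?x =
      apply_gates [Cnot (a + q) (b + q), Cnot (b + q) (a + q), Cnot (a + q) (b + q)] (apply_gates (swap_gates a b q) \<Psi>) ?x"
    by (simp only: apply_gates_simps(3))
  also have "\<dots> = apply_gates (swap_gates a b q) \<Psi> (?x[a + q := ?x ! (b + q), b + q := ?x ! (a + q)])"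
    by (rule apply_swap) (use Suc.prems(1) v(2) v'(2) b in auto)
  also have "\<dots> = apply_gates (swap_gates a b q) \<Psi> (u @ v1 @ (c' # w) @ v1' @ (c # z))"
    unfolding n by simp
  also have "\<dots> = \<Psi> (u @ v1' @ (c' # w) @ v1 @ (c # z))"
    by (rule Suc.IH) (use Suc.prems v(2) v'(2) b in auto)
  finally show ?case by (simp add: v(1) v'(1))
qed

definition copy_gates :: "nat \<Rightarrow> nat \<Rightarrow> gate list" where
  "copy_gates a n = concat (map (\<lambda>i. [Cnot (a + i) i]) [0..<n])"

text \<open>Strings with two equal blocks are exactly those that arise from copying onto zeros, and
  only their amplitudes enter the lower bound for the reduction.\<close>

lemma apply_copy_gates:
  assumes "length h = n" "length (h @ w) = a"
  shows "apply_gates (copy_gates a n) \<Psi> (h @ w @ h @ z) = \<Psi> (replicate n False @ w @ h @ z)"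
  using assms
proof (induction n arbitrary: h w z)
  case 0
  then show ?case by (simp add: copy_gates_def)
next
  case (Suc n)
  obtain h1 c where h: "h = h1 @ [c]" "length h1 = n" using Suc.prems(1) by (cases h rule: rev_cases) auto
  let ?x = "h1 @ c # w @ h1 @ c # z"
  have a: "a = Suc (n + length w)" using Suc.prems h by simp
  have n: "?x ! (a + n) = c" "?x ! n = c" "?x[n := False] = h1 @ False # w @ h1 @ c # z"
    using h(2) by (auto simp: a nth_append list_update_append)
  have "apply_gate (Cnot (a + n) n) \<psi> ?x = \<psi> (h1 @ False # w @ h1 @ c # z)" for \<psi>
    using h(2) n a by (cases c) auto
  moreover have "copy_gates a (Suc n) = copy_gates a n @ [Cnot (a + n) n]"
    by (simp add: copy_gates_def)
  ultimately have "apply_gates (copy_gates a (Suc n)) \<Psi> ?x = apply_gates (copy_gates a n) \<Psi> (h1 @ (False # w) @ h1 @ (c # z))"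
    by simp
  also have "\<dots> = \<Psi> (replicate n False @ (False # w) @ h1 @ (c # z))"
    by (rule Suc.IH) (use h a in auto)
  finally show ?case by (simp add: h(1) replicate_app_Cons_same)
qed

text \<open>For each copy of the public key, the challenge state is swapped into the half selected by \<open>b\<close>,
  and \<open>gs\<close> prepares the state of the other half.\<close>

definition plant_gates :: "bool \<Rightarrow> gate list \<Rightarrow> nat \<Rightarrow> nat \<Rightarrow> nat \<Rightarrow> nat \<Rightarrow> gate list" where
  "plant_gates b gs q base M t = concat (map (\<lambda>j.
     swap_gates (j * q) (Suc (base + j * Suc (2 * q)) + (if b then q else 0)) q @
     map (ren_gate (Suc (base + j * Suc (2 * q)) + (if b then 0 else q)) q M) gs) [0..<t])"

text \<open>Invariant after \<open>j\<close> rounds: the first \<open>j\<close> challenge blocks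
  have been exchanged for zeros and the first \<open>j\<close> public keys are complete, while
  everything else is untouched. The \<open>r\<close> qubits in between and the \<open>e\<close>
  qubits at the end remain zero throughout.\<close>

lemma apply_plant_gates:
  fixes b :: bool and gs :: "gate list" and q :: nat and \<phi> :: qvec
  defines "\<psi> \<equiv> apply_gates gs (zero_vec q)" and "w \<equiv> Suc (2 * q)"
  defines "pk \<equiv> key_vec q (if b then \<psi> else \<phi>) (if b then \<phi> else \<psi>)"
  assumes base: "base = t * q + r" and M: "M = base + t * w + e"
    and \<Psi>: "\<And>f g p d. length f = t * q \<Longrightarrow> length g = r \<Longrightarrow> length p = t * w \<Longrightarrow> length d = e \<Longrightarrow>
      \<Psi> (f @ g @ p @ d) = power_vec q \<phi> t f * zero_vec r g * zero_vec (t * w) p * zero_vec e d"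
    and j: "j \<le> t" and len: "length f1 = j * q" "length f2 = (t - j) * q" "length g = r"
      "length p1 = j * w" "length p2 = (t - j) * w" "length d = e"
  shows "apply_gates (plant_gates b gs q base M j) \<Psi> (f1 @ f2 @ g @ p1 @ p2 @ d) =
    zero_vec (j * q) f1 * power_vec q \<phi> (t - j) f2 * zero_vec r g * power_vec w pk j p1 *
      zero_vec ((t - j) * w) p2 * zero_vec e d"
  using j len
proof (induction j arbitrary: f1 f2 p1 p2)
  case 0
  then show ?case using \<Psi>[of f2 g p2 d] by (simp add: plant_gates_def)
next
  case (Suc j)
  define n where "n = t - Suc j"
  have t: "t - j = Suc n" using Suc.prems(1) by (simp add: n_def)
  define f0 fa where "f0 = take (j * q) f1" and "fa = drop (j * q) f1"
  have f: "f1 = f0 @ fa" "length f0 = j * q" "length fa = q"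
    using Suc.prems(2) by (auto simp: f0_def fa_def)
  define p0 pw where "p0 = take (j * w) p1" and "pw = drop (j * w) p1"
  have p: "p1 = p0 @ pw" "length p0 = j * w" "length pw = w"
    using Suc.prems(5) by (auto simp: p0_def pw_def)
  obtain c where c: "pw = c # tl pw" using p(3) by (cases pw) (auto simp: w_def)
  define xa xb where "xa = take q (tl pw)" and "xb = drop q (tl pw)"
  have x: "pw = c # xa @ xb" "length xa = q" "length xb = q"
    using c p(3) by (auto simp: xa_def xb_def w_def)
  have f2: "length f2 = n * q" and p2: "length p2 = n * w"
    using Suc.prems by (simp_all add: n_def)
  have tq: "t * q = j * q + q + n * q" and tw: "t * w = j * w + w + n * w"
  proof -
    have "t = Suc (j + n)" using Suc.prems(1) by (simp add: n_def)
    then show "t * q = j * q + q + n * q" "t * w = j * w + w + n * w" by (simp_all add: algebra_simps)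
  qed
  let ?o = "Suc (base + j * w)"
  let ?\<Psi> = "apply_gates (plant_gates b gs q base M j) \<Psi>"
  let ?sw = "swap_gates (j * q) (?o + (if b then q else 0)) q"
  let ?\<Psi>' = "apply_gates ?sw ?\<Psi>"
  \<comment> \<open>The invariant, with the next challenge copy \<open>y\<close> and the two halves
    \<open>y1\<close>, \<open>y2\<close> of the next public key split off.\<close>
  have IH: "?\<Psi> (f0 @ (y @ f2) @ g @ p0 @ (c # y1 @ y2 @ p2) @ d) = zero_vec (j * q) f0 * (\<phi> y * power_vec q \<phi> n f2) *
      zero_vec r g * power_vec w pk j p0 * (if c then 0 else zero_vec q y1 * zero_vec q y2 * zero_vec (n * w) p2) * zero_vec e d"
    if y: "length y = q" "length y1 = q" "length y2 = q" for y y1 y2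
  proof -
    have "?\<Psi> (f0 @ (y @ f2) @ g @ p0 @ (c # y1 @ y2 @ p2) @ d) = zero_vec (j * q) f0 * power_vec q \<phi> (t - j) (y @ f2) * zero_vec r g * power_vec w pk j p0 *
      zero_vec ((t - j) * w) (c # y1 @ y2 @ p2) * zero_vec e d"
      by (rule Suc.IH) (use Suc.prems f p f2 p2 y t in \<open>auto simp: w_def\<close>)
    moreover have "power_vec q \<phi> (t - j) (y @ f2) = \<phi> y * power_vec q \<phi> n f2"
      unfolding t by (rule power_vec_append[OF y(1)])
    moreover have "(t - j) * w = Suc (q + (q + n * w))" unfolding t by (simp add: w_def)
    then have "zero_vec ((t - j) * w) (c # y1 @ y2 @ p2) = (if c then 0 else zero_vec q y1 * zero_vec q y2 * zero_vec (n * w) p2)"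
      using y by (simp add: zero_vec_Cons zero_vec_append)
    ultimately show ?thesis by simp
  qed
  have g: "plant_gates b gs q base M (Suc j) = plant_gates b gs q base M j @ ?sw @
      map (ren_gate (?o + (if b then 0 else q)) q M) gs"
    by (simp add: plant_gates_def w_def)
  have z: "zero_vec (Suc j * q) f1 = zero_vec (j * q) f0 * zero_vec q fa"
    unfolding f(1) using zero_vec_append[OF f(2), of q fa] by (simp add: add.commute)
  have pw: "power_vec w pk (Suc j) p1 = power_vec w pk j p0 * pk pw"
    unfolding p(1) using p by (intro power_vec_snoc) auto
  have "apply_gates (plant_gates b gs q base M (Suc j)) \<Psi> (f1 @ f2 @ g @ p1 @ p2 @ d) =
    zero_vec (j * q) f0 * zero_vec q fa * power_vec q \<phi> n f2 * zero_vec r g * (power_vec w pk j p0 * pk pw) *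
      zero_vec (n * w) p2 * zero_vec e d"
  proof (cases b)
    case False
    \<comment> \<open>After the swap, what depends on the block that \<open>gs\<close> acts on is
      just \<open>zero_vec q y\<close>; all else is a constant that linearity moves out.\<close>
    have sw: "?\<Psi>' (f0 @ fa @ (f2 @ g @ p0 @ [c]) @ xa @ (y @ p2 @ d)) =
        (zero_vec (j * q) f0 * zero_vec q fa * \<phi> xa * power_vec q \<phi> n f2 *
      zero_vec r g * power_vec w pk j p0 * (if c then 0 else zero_vec (n * w) p2) * zero_vec e d) * zero_vec q y"
      if y: "length y = q" for y
    proof -
      have "?\<Psi>' (f0 @ fa @ (f2 @ g @ p0 @ [c]) @ xa @ (y @ p2 @ d)) =
          ?\<Psi> (f0 @ xa @ (f2 @ g @ p0 @ [c]) @ fa @ (y @ p2 @ d))"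
        by (rule apply_swap_gates) (use f x p f2 \<open>length g = r\<close> False base tq in auto)
      then show ?thesis using IH[of xa fa y] x f y by simp
    qed
    let ?u = "f0 @ fa @ f2 @ g @ p0 @ c # xa"
    have "apply_gates (plant_gates b gs q base M (Suc j)) \<Psi> (f1 @ f2 @ g @ p1 @ p2 @ d) =
        apply_gates (map (ren_gate (?o + q) q M) gs) ?\<Psi>' (?u @ xb @ (p2 @ d))"
      unfolding g f(1) p(1) x(1) using False by simp
    also have "\<dots> = apply_gates gs (\<lambda>y. ?\<Psi>' (?u @ y @ (p2 @ d))) xb"
      by (rule apply_ren_gates) (use f x p f2 p2 Suc.prems base tq tw M in \<open>auto simp: w_def\<close>)
    also have "\<dots> = apply_gates gs (\<lambda>y. (zero_vec (j * q) f0 * zero_vec q fa * \<phi> xa * power_vec q \<phi> n f2 *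
      zero_vec r g * power_vec w pk j p0 * (if c then 0 else zero_vec (n * w) p2) * zero_vec e d) * zero_vec q y) xb"
      by (rule apply_gates_cong) (use sw x in simp)
    also have "\<dots> = (zero_vec (j * q) f0 * zero_vec q fa * \<phi> xa * power_vec q \<phi> n f2 *
      zero_vec r g * power_vec w pk j p0 * (if c then 0 else zero_vec (n * w) p2) * zero_vec e d) * \<psi> xb"
      unfolding apply_gates_scale \<psi>_def ..
    finally show ?thesis using x False by (simp add: pk_def key_vec_append)
  next
    case True
    have sw: "?\<Psi>' (f0 @ fa @ (f2 @ g @ p0 @ c # y) @ xb @ (p2 @ d)) =
        (zero_vec (j * q) f0 * zero_vec q fa * \<phi> xb * power_vec q \<phi> n f2 *
      zero_vec r g * power_vec w pk j p0 * (if c then 0 else zero_vec (n * w) p2) * zero_vec e d) * zero_vec q y"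
      if y: "length y = q" for y
    proof -
      have "?\<Psi>' (f0 @ fa @ (f2 @ g @ p0 @ c # y) @ xb @ (p2 @ d)) =
          ?\<Psi> (f0 @ xb @ (f2 @ g @ p0 @ c # y) @ fa @ (p2 @ d))"
        by (rule apply_swap_gates) (use f x p f2 \<open>length g = r\<close> True base tq y in auto)
      then show ?thesis using IH[of xb y fa] x f y by simp
    qed
    let ?u = "f0 @ fa @ f2 @ g @ p0 @ [c]"
    have "apply_gates (plant_gates b gs q base M (Suc j)) \<Psi> (f1 @ f2 @ g @ p1 @ p2 @ d) =
        apply_gates (map (ren_gate ?o q M) gs) ?\<Psi>' (?u @ xa @ (xb @ p2 @ d))"
      unfolding g f(1) p(1) x(1) using True by simp
    also have "\<dots> = apply_gates gs (\<lambda>y. ?\<Psi>' (?u @ y @ (xb @ p2 @ d))) xa"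
      by (rule apply_ren_gates) (use f x p f2 p2 Suc.prems base tq tw M in \<open>auto simp: w_def\<close>)
    also have "\<dots> = apply_gates gs (\<lambda>y. (zero_vec (j * q) f0 * zero_vec q fa * \<phi> xb * power_vec q \<phi> n f2 *
      zero_vec r g * power_vec w pk j p0 * (if c then 0 else zero_vec (n * w) p2) * zero_vec e d) * zero_vec q y) xa"
      by (rule apply_gates_cong) (use sw x in simp)
    also have "\<dots> = (zero_vec (j * q) f0 * zero_vec q fa * \<phi> xb * power_vec q \<phi> n f2 *
      zero_vec r g * power_vec w pk j p0 * (if c then 0 else zero_vec (n * w) p2) * zero_vec e d) * \<psi> xa"
      unfolding apply_gates_scale \<psi>_def ..
    finally show ?thesis using x True by (simp add: pk_def key_vec_append)
  qed
  then show ?case unfolding z pw n_def[symmetric] .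
qed

text \<open>The register consists of the \<open>T q\<close> challenge qubits, \<open>n\<close> zeros, one more zero, and from \<open>base\<close> on
  the simulated register of the forger. The first \<open>Cnot\<close> takes the place of the measurement of the
  message. There is no need to check its outcome: the runs with outcome \<open>\<not> b\<close> alone give the lower
  bound below. After the swaps the challenge qubits are zero, so the final gates copy the candidate
  preimage onto zeros.\<close>

definition reduction_circ :: "(bits \<Rightarrow> circ) \<Rightarrow> nat poly \<Rightarrow> sig_adv \<Rightarrow> bits \<Rightarrow> bits \<Rightarrow> circ" where
  "reduction_circ G t A u r =
     (let n = length u; b = (r \<noteq> [] \<and> hd r); k = take n (tl r); r' = drop n (tl r);
          q = ancillas (G k); T = poly t n;
          C = stage1 A [u, r']; D = stage2 A [u, r', [\<not> b], k];
          N1 = T * Suc (2 * q) + ancillas C; N2 = N1 + ancillas D;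
          base = T * q + Suc n; M = base + N2
      in Circ (Suc n + N2) n
        (plant_gates b (gates (G k)) q base M T @ map (ren_gate base N1 M) (gates C) @
         Cnot base (T * q + n) # map (ren_gate base N2 M) (gates D) @ copy_gates (Suc base) n))"

text \<open>One coin for the guess, \<open>n\<close> coins for the key that the reduction chooses
  itself, and then the coins of the forger.\<close>

definition reduction :: "(bits \<Rightarrow> circ) \<Rightarrow> nat poly \<Rightarrow> sig_adv \<Rightarrow> qalg" where
  "reduction G t A = \<lparr>coins = [:1, 1:] + adv_coins A, circuit = (\<lambda>xs. reduction_circ G t A (xs ! 0) (xs ! 1))\<rparr>"

lemma poly_gates_swap:
  "poly_nat k a \<Longrightarrow> poly_nat k b \<Longrightarrow> poly_nat k q \<Longrightarrow> poly_gates k (\<lambda>xs. swap_gates (a xs) (b xs) (q xs))"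
  unfolding swap_gates_def
  by (intro poly_gates_concat_upt poly_gates_Cnot poly_gates_Nil poly_nat_add
      poly_nat_tl_args poly_nat_length poly_time_nth zero_less_Suc)

lemma poly_gates_copy:
  "poly_nat k a \<Longrightarrow> poly_nat k n \<Longrightarrow> poly_gates k (\<lambda>xs. copy_gates (a xs) (n xs))"
  unfolding copy_gates_def
  by (intro poly_gates_concat_upt poly_gates_Cnot poly_gates_Nil poly_nat_add
      poly_nat_tl_args poly_nat_length poly_time_nth zero_less_Suc)

lemma poly_gates_plant:
  "poly_pred k b \<Longrightarrow> poly_gates k gs \<Longrightarrow> poly_nat k q \<Longrightarrow> poly_nat k base \<Longrightarrow> poly_nat k M \<Longrightarrow> poly_nat k t \<Longrightarrow>
    poly_gates k (\<lambda>xs. plant_gates (b xs) (gs xs) (q xs) (base xs) (M xs) (t xs))"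
  unfolding plant_gates_def
  by (intro poly_gates_concat_upt poly_gates_append poly_gates_swap poly_gates_ren poly_nat_add poly_nat_mult poly_nat_Suc
      poly_nat_if poly_nat_const poly_gates_tl_args poly_pred_tl_args
      poly_nat_tl_args poly_nat_length poly_time_nth zero_less_Suc)

lemma circ_gen_reduction_circ:
  assumes G: "circ_gen 1 (\<lambda>xs. G (hd xs))" and A: "circ_gen 2 (stage1 A)" "circ_gen 4 (stage2 A)"
  shows "circ_gen 2 (\<lambda>xs. reduction_circ G t A (xs ! 0) (xs ! 1))"
proof -
  have 1: "circ_gen k (\<lambda>xs. stage1 A [f xs, g xs])" if "poly_time k f" "poly_time k g" for k f g
    using poly_time_comp2[OF A(1)[unfolded circ_gen_def] that] by (simp add: circ_gen_def)
  have 2: "circ_gen k (\<lambda>xs. stage2 A [f xs, g xs, [P xs], h xs])"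
    if "poly_time k f" "poly_time k g" "poly_pred k P" "poly_time k h" for k f g h P
    using poly_time_comp4[OF A(2)[unfolded circ_gen_def] that(1,2) that(3)[unfolded poly_pred_def] that(4)]
    by (simp add: circ_gen_def)
  have z: "(0::nat) < 2" "(1::nat) < 2" by simp_all
  show ?thesis
    unfolding reduction_circ_def Let_def
    by (intro circ_gen_Circ poly_nat_add poly_nat_mult poly_nat_Suc poly_nat_length poly_nat_const poly_nat_poly poly_nat_ancillas
        poly_gates_append poly_gates_plant poly_gates_ren poly_gates_gates poly_gates_Cnot poly_gates_copy
        poly_pred_not poly_pred_hd 1 2 circ_gen_comp1[OF G] poly_time_take poly_time_drop poly_time_tl poly_time_nth z)
qed

context one_way_generator
begin

text \<open>The inequality comes from discarding nonnegative terms. Among the outcomes of the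
  reduction that yield \<open>s\<close> are those in which the message qubit reads
  \<open>\<not> b\<close>, the forger outputs \<open>b # s\<close>, and the remaining qubits in
  front are zero; their amplitudes are those of the forger after its measurement gave
  \<open>\<not> b\<close>.\<close>

lemma outcome_prob_reduction:
  fixes t :: "nat poly" and A :: sig_adv and n :: nat and k k' r' s :: bits and b :: bool
  assumes k: "length k = n" "length k' = n" and s: "length s = n"
  defines "q \<equiv> qubits n" and "T \<equiv> poly t n" and "w \<equiv> Suc (2 * qubits n)"
  defines "C \<equiv> stage1 A [unary n, r']" and "D \<equiv> stage2 A [unary n, r', [\<not> b], k']"
  defines "pk \<equiv> key_vec q (owsg_vec G (if b then k' else k)) (owsg_vec G (if b then k else k'))"
  defines "q' \<equiv> T * w + ancillas C"
  assumes D: "out_size q' D = Suc n"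
  shows "outcome_prob (out_circ q' D (measure_first (\<not> b) (run_circ (T * w) C (proj_op (power_vec w pk T))))) (b # s)
    \<le> outcome_prob (out_circ (T * q) (reduction_circ G t A (unary n) (b # k' @ r')) (proj_op (power_vec q (owsg_vec G k) T))) s"
proof -
  define N2 where "N2 = q' + ancillas D"
  define base where "base = T * q + Suc n"
  define M where "M = base + N2"
  define R where "R = reduction_circ G t A (unary n) (b # k' @ r')"
  have R: "R = Circ (Suc n + N2) n
        (plant_gates b (gates (G k')) q base M T @ map (ren_gate base q' M) (gates C) @
         Cnot base (T * q + n) # map (ren_gate base N2 M) (gates D) @ copy_gates (Suc base) n)"
  proof -
    have "length (unary n) = n" "(b # k' @ r' \<noteq> [] \<and> hd (b # k' @ r')) = b"
      "take n (tl (b # k' @ r')) = k'" "drop n (tl (b # k' @ r')) = r'" "ancillas (G k') = qubits n"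
      using k by (simp_all add: ancillas_G)
    then show ?thesis
      by (simp only: R_def reduction_circ_def Let_def T_def C_def D_def q'_def w_def N2_def base_def M_def q_def)
  qed
  define \<Phi> where "\<Phi> = apply_gates (gates C) (tensor_vec (T * w) (power_vec w pk T) (zero_vec (ancillas C)))"
  define first where "first = (\<lambda>x :: bits. x \<noteq> [] \<and> hd x)"
  define \<Phi>m where "\<Phi>m = (\<lambda>e x. if first x = e then \<Phi> x else 0)"
  define \<chi> where "\<chi> = (\<lambda>e. apply_gates (gates D) (tensor_vec q' (\<Phi>m e) (zero_vec (ancillas D))))"
  define \<Psi>0 where "\<Psi>0 = tensor_vec (T * q) (power_vec q (owsg_vec G k) T) (zero_vec (Suc n + N2))"
  define \<Psi>1 where "\<Psi>1 = apply_gates (plant_gates b (gates (G k')) q base M T) \<Psi>0"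
  define \<Psi>2 where "\<Psi>2 = apply_gates (map (ren_gate base q' M) (gates C)) \<Psi>1"
  define \<Psi>3 where "\<Psi>3 = apply_gate (Cnot base (T * q + n)) \<Psi>2"
  define \<Psi>4 where "\<Psi>4 = apply_gates (map (ren_gate base N2 M) (gates D)) \<Psi>3"
  define \<Psi>5 where "\<Psi>5 = apply_gates (copy_gates (Suc base) n) \<Psi>4"
  have zk': "apply_gates (gates (G k')) (zero_vec q) = owsg_vec G k'"
    by (simp add: owsg_vec_def ancillas_G k q_def)
  have w: "w = Suc (2 * q)" by (simp add: w_def q_def)
  have nle: "Suc n \<le> N2" using D by (simp add: out_size_def N2_def)
  have \<Psi>1: "\<Psi>1 (h @ [e] @ v @ d) = (zero_vec (T * q + n) h * (if e then 0 else 1) * zero_vec (ancillas D) d) *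
      tensor_vec (T * w) (power_vec w pk T) (zero_vec (ancillas C)) v"
    if l: "length h = T * q + n" "length v = q'" "length d = ancillas D" for h e v d
  proof -
    define f g p c where "f = take (T * q) h" and "g = drop (T * q) h @ [e]" and "p = take (T * w) v" and "c = drop (T * w) v"
    have len: "length f = T * q" "length g = Suc n" "length p = T * w" "length (c @ d) = ancillas C + ancillas D"
      and eq: "h @ [e] @ v @ d = f @ [] @ g @ p @ [] @ (c @ d)"
      using l by (auto simp: f_def g_def p_def c_def q'_def simp flip: append_assoc)
    have "\<Psi>1 (f @ [] @ g @ p @ [] @ (c @ d)) = zero_vec (T * q) f * power_vec q (owsg_vec G k) (T - T) [] * zero_vec (Suc n) g *
        power_vec (Suc (2 * q)) (key_vec q (if b then apply_gates (gates (G k')) (zero_vec q) else owsg_vec G k)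
          (if b then owsg_vec G k else apply_gates (gates (G k')) (zero_vec q))) T p *
        zero_vec ((T - T) * Suc (2 * q)) [] * zero_vec (ancillas C + ancillas D) (c @ d)"
      unfolding \<Psi>1_def
    proof (rule apply_plant_gates)
      show "base = T * q + Suc n" "M = base + T * Suc (2 * q) + (ancillas C + ancillas D)"
        by (simp_all add: base_def M_def N2_def q'_def w)
      fix f g p d :: bits
      assume l: "length f = T * q" "length g = Suc n" "length p = T * Suc (2 * q)" "length d = ancillas C + ancillas D"
      have "Suc n + N2 = Suc n + (T * Suc (2 * q) + (ancillas C + ancillas D))"
        by (simp add: N2_def q'_def w)
      then show "\<Psi>0 (f @ g @ p @ d) = power_vec q (owsg_vec G k) T f * zero_vec (Suc n) g *
          zero_vec (T * Suc (2 * q)) p * zero_vec (ancillas C + ancillas D) d"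
        using l by (simp only: \<Psi>0_def tensor_vec_def) (simp add: zero_vec_append del: add_Suc mult_Suc_right)
    qed (use len w in auto)
    moreover have "key_vec q (if b then apply_gates (gates (G k')) (zero_vec q) else owsg_vec G k)
          (if b then owsg_vec G k else apply_gates (gates (G k')) (zero_vec q)) = pk"
      by (simp add: pk_def zk')
    moreover have "zero_vec (T * q) f * zero_vec (Suc n) g = zero_vec (T * q + n) h * (if e then 0 else 1)"
    proof -
      have "zero_vec (T * q) f * zero_vec (Suc n) g = zero_vec (T * q + Suc n) (f @ g)"
        using len by (simp only: zero_vec_append)
      also have "\<dots> = zero_vec ((T * q + n) + Suc 0) (h @ [e])"
        by (simp add: f_def g_def flip: append_assoc)
      also have "\<dots> = zero_vec (T * q + n) h * (if e then 0 else 1)"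
        using l by (simp only: zero_vec_append zero_vec_Cons zero_vec_Nil)
      finally show ?thesis .
    qed
    moreover have "zero_vec (ancillas C + ancillas D) (c @ d) = zero_vec (ancillas C) c * zero_vec (ancillas D) d"
      using l by (intro zero_vec_append) (simp add: c_def q'_def)
    ultimately show ?thesis
      unfolding eq by (simp add: tensor_vec_def p_def c_def w mult_ac)
  qed
  have \<Psi>2: "\<Psi>2 (h @ [e] @ v @ d) = zero_vec (T * q + n) h * (if e then 0 else 1) * zero_vec (ancillas D) d * \<Phi> v"
    if l: "length h = T * q + n" "length v = q'" "length d = ancillas D" for h e v d
  proof -
    have "\<Psi>2 ((h @ [e]) @ v @ d) = apply_gates (gates C) (\<lambda>y. \<Psi>1 ((h @ [e]) @ y @ d)) v"
      unfolding \<Psi>2_def by (rule apply_ren_gates) (use l in \<open>auto simp: base_def M_def N2_def\<close>)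
    also have "\<dots> = apply_gates (gates C) (\<lambda>y. (zero_vec (T * q + n) h * (if e then 0 else 1) * zero_vec (ancillas D) d) *
      tensor_vec (T * w) (power_vec w pk T) (zero_vec (ancillas C)) y) v"
      by (rule apply_gates_cong) (use \<Psi>1 l in simp)
    finally show ?thesis unfolding apply_gates_scale \<Phi>_def by simp
  qed
  have \<Psi>3: "\<Psi>3 (h @ [e] @ y) = zero_vec (T * q + n) h * tensor_vec q' (\<Phi>m e) (zero_vec (ancillas D)) y"
    if l: "length h = T * q + n" "length y = N2" for h e y
  proof -
    define v d where "v = take q' y" and "d = drop q' y"
    have v: "y = v @ d" "length v = q'" "length d = ancillas D" using l by (auto simp: v_def d_def N2_def)
    have b: "(h @ [e] @ y) ! base = y ! 0" "(h @ [e] @ y)[T * q + n := \<not> e] = h @ [\<not> e] @ y"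
      "(h @ [e] @ y) ! (T * q + n) = e"
      using l by (simp_all add: base_def nth_append list_update_append)
    \<comment> \<open>As the target was zero before the \<open>Cnot\<close>, amplitude survives only
      where \<open>e\<close> equals the first qubit of the forger. This is the projection in
      \<open>\<Phi>m e\<close>.\<close>
    have "\<Psi>3 (h @ [e] @ y) = (if y ! 0 then \<Psi>2 (h @ [\<not> e] @ y) else \<Psi>2 (h @ [e] @ y))"
      unfolding \<Psi>3_def apply_gate.simps b using l nle by (simp add: base_def)
    also have "\<dots> = zero_vec (T * q + n) h * \<Phi>m e v * zero_vec (ancillas D) d"
    proof (cases v)
      \<comment> \<open>A forger without qubits sends the message \<open>False\<close> by
        convention. The control of the \<open>Cnot\<close> is then an ancilla of \<open>D\<close>,
        which is still zero, so the copied bit is \<open>False\<close> as well.\<close>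
      case Nil
      then obtain c d' where d: "d = c # d'" using l nle v by (cases d) auto
      have z: "zero_vec (ancillas D) (x # d') = (if x then 0 else zero_vec (length d') d')" for x
        using v(3) d zero_vec_Cons[of "length d'" x d'] by simp
      show ?thesis using l v Nil unfolding v(1) \<Psi>2[OF l(1) v(2,3)] by (simp add: \<Phi>m_def first_def d z)
    next
      case (Cons c v')
      then show ?thesis unfolding v(1) \<Psi>2[OF l(1) v(2,3)] by (simp add: \<Phi>m_def first_def)
    qed
    finally show ?thesis by (simp add: tensor_vec_def v_def d_def)
  qed
  have \<Psi>4: "\<Psi>4 (h @ [e] @ y) = zero_vec (T * q + n) h * \<chi> e y"
    if l: "length h = T * q + n" "length y = N2" for h e y
  proof -
    have "\<Psi>4 ((h @ [e]) @ y @ []) = apply_gates (gates D) (\<lambda>y. \<Psi>3 ((h @ [e]) @ y @ [])) y"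
      unfolding \<Psi>4_def by (rule apply_ren_gates) (use l in \<open>auto simp: base_def M_def\<close>)
    also have "\<dots> = apply_gates (gates D) (\<lambda>y. zero_vec (T * q + n) h * tensor_vec q' (\<Phi>m e) (zero_vec (ancillas D)) y) y"
      by (rule apply_gates_cong) (use \<Psi>3 l in simp)
    finally show ?thesis unfolding apply_gates_scale \<chi>_def by simp
  qed
  have \<Psi>5: "\<Psi>5 (s @ replicate (T * q) False @ [e] @ (b # s) @ z) = \<chi> e ((b # s) @ z)" if z: "length z = N2 - Suc n" for e z
  proof -
    have "\<Psi>5 (s @ (replicate (T * q) False @ [e, b]) @ s @ z) =
        \<Psi>4 (replicate n False @ (replicate (T * q) False @ [e, b]) @ s @ z)"
      unfolding \<Psi>5_def by (rule apply_copy_gates) (use s in \<open>auto simp: base_def\<close>)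
    also have "\<dots> = \<Psi>4 (replicate (T * q + n) False @ [e] @ ((b # s) @ z))"
    proof -
      have "replicate (T * q + n) False = replicate n False @ replicate (T * q) False"
        by (simp add: replicate_add[symmetric] add.commute)
      then show ?thesis by simp
    qed
    also have "\<dots> = \<chi> e ((b # s) @ z)"
      by (subst \<Psi>4) (use s z nle in \<open>auto simp: zero_vec_def\<close>)
    finally show ?thesis by simp
  qed
  have "outcome_prob (out_circ q' D (measure_first (\<not> b) (run_circ (T * w) C (proj_op (power_vec w pk T))))) (b # s) =
      (\<Sum>z\<in>bitstrings (N2 - Suc n). (cmod (\<chi> (\<not> b) ((b # s) @ z)))\<^sup>2)"
    unfolding run_circ_proj_op \<Phi>_def[symmetric] measure_first_proj_op
    using s by (subst outcome_prob_proj_op) (simp_all add: D N2_def \<chi>_def \<Phi>m_def first_def)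
  also have "\<dots> = (\<Sum>z\<in>bitstrings (N2 - Suc n). (cmod (\<Psi>5 (s @ replicate (T * q) False @ [\<not> b] @ (b # s) @ z)))\<^sup>2)"
    by (intro sum.cong refl) (simp add: \<Psi>5[symmetric] bitstrings_def del: append_Cons)
  \<comment> \<open>Distinct \<open>z\<close> give distinct outcomes of the reduction, so the sum is
    part of the sum over all outcomes that begin with \<open>s\<close>.\<close>
  also have "\<dots> = (\<Sum>y\<in>(\<lambda>z. replicate (T * q) False @ [\<not> b] @ (b # s) @ z) ` bitstrings (N2 - Suc n). (cmod (\<Psi>5 (s @ y)))\<^sup>2)"
    by (subst sum.reindex) (auto simp: inj_on_def)
  also have "\<dots> \<le> (\<Sum>y\<in>bitstrings (T * q + (Suc n + N2) - n). (cmod (\<Psi>5 (s @ y)))\<^sup>2)"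
    by (rule sum_mono2[OF finite_bitstrings]) (use s nle in \<open>auto simp: bitstrings_def\<close>)
  also have "\<dots> = outcome_prob (out_circ (T * q) R (proj_op (power_vec q (owsg_vec G k) T))) s"
  proof -
    have "out_size (T * q) R = n" by (simp add: out_size_def R)
    then show ?thesis
      using s by (subst outcome_prob_proj_op) (simp_all add: R \<Psi>5_def \<Psi>4_def \<Psi>3_def \<Psi>2_def \<Psi>1_def \<Psi>0_def)
  qed
  finally show ?thesis unfolding R_def .
qed


section \<open>Well-formedness and perfect correctness\<close>

lemma secret_key_lamport: "secret_key (lamport_scheme G) l r = sk_of l (take l r) (drop l r)"
  by (simp add: secret_key_def lamport_scheme_def sk_of_def)

lemma sig_wf_lamport: "sig_wf (lamport_scheme G)"
proof -
  let ?S = "lamport_scheme G"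
  have z: "(0::nat) < 2" "(1::nat) < 2" "(0::nat) < Suc 1" "(0::nat) < Suc 3" "(1::nat) < Suc 3" "(2::nat) < Suc 3"
    by simp_all
  have "poly_time 2 (\<lambda>xs. xs ! 0 @ False # xs ! 1)"
    by (intro poly_time_append poly_time_Cons poly_time_nth z)
  moreover have "circ_gen (Suc 1) (\<lambda>xs. pk_circ G (xs ! 0))"
    by (intro circ_gen_pk_circ circ_gen_G poly_time_nth z)
  moreover have "poly_time 2 (\<lambda>xs. sig_key (xs ! 0) (xs ! 1 \<noteq> [] \<and> hd (xs ! 1)))"
    by (intro poly_time_sig_key poly_pred_hd poly_time_nth z)
  moreover have "circ_gen (Suc 3) (\<lambda>xs. if length (xs ! 2) = length (xs ! 0)
        then verify_circ G (xs ! 1 \<noteq> [] \<and> hd (xs ! 1)) (xs ! 2) else Circ 0 1 [])"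
    by (intro circ_gen_if poly_pred_eq poly_nat_length circ_gen_verify_circ circ_gen_G poly_pred_hd poly_time_nth
        circ_gen_Circ poly_nat_const poly_gates_Nil z)
  moreover have "out_size 0 (circuit (gen2 ?S) [secret_key ?S l r, r']) = pk_qubits ?S l"
    if r: "r \<in> bitstrings (poly (gen1_coins ?S) l)" for l r r'
  proof -
    have "length (take l r) = l" "length (drop l r) = l"
      using r by (simp_all add: lamport_scheme_def bitstrings_def)
    from pk_circ_sk_of[OF this] show ?thesis
      unfolding secret_key_lamport by (simp add: out_size_def lamport_scheme_def qubits_def)
  qed
  ultimately show ?thesis
    unfolding sig_wf_def by (simp add: lamport_scheme_def qpt_def Let_def)
qed

lemma avg_keys:
  "avg (poly (gen1_coins (lamport_scheme G)) l) f = avg l (\<lambda>k0. avg l (\<lambda>k1. f (k0 @ k1)))"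
proof -
  have "poly (gen1_coins (lamport_scheme G)) l = l + l" by (simp add: lamport_scheme_def)
  then show ?thesis by (simp only: avg_add)
qed

lemma sign_lamport:
  assumes "length k0 = l" "length k1 = l"
  shows "sign (lamport_scheme G) [sk_of l k0 k1, [m]] = (if m then k1 else k0)"
  using assms by (simp add: lamport_scheme_def sig_key_sk_of)

lemma perfectly_correct_lamport: "perfectly_correct (lamport_scheme G)"
  unfolding perfectly_correct_def avg_keys
proof (intro allI)
  fix l m
  have "(let sk = secret_key (lamport_scheme G) l (k0 @ k1) in
      accept_prob (lamport_scheme G) l sk m (sign (lamport_scheme G) [sk, [m]])) = 1"
    if k: "length k0 = l" "length k1 = l" for k0 k1
  proof -
    let ?k = "if m then k1 else k0"
    have l: "length ?k = l" using k by simp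
    have "inner_prod (qubits l) (owsg_vec G ?k) (owsg_vec G ?k) = 1"
      unfolding inner_prod_self norm_owsg_vec[of ?k, unfolded l] by simp
    then show ?thesis
      using k by (simp add: secret_key_lamport Let_def sign_lamport accept_prob_lamport)
  qed
  then have "avg l (\<lambda>k0. avg l (\<lambda>k1. let sk = secret_key (lamport_scheme G) l (k0 @ k1) in
      accept_prob (lamport_scheme G) l sk m (sign (lamport_scheme G) [sk, [m]]))) = avg l (\<lambda>k0. avg l (\<lambda>k1. 1))"
    by (intro avg_cong)
  then show "avg l (\<lambda>k0. avg l (\<lambda>k1. let sk = secret_key (lamport_scheme G) l (k0 @ k1) in
      accept_prob (lamport_scheme G) l sk m (sign (lamport_scheme G) [sk, [m]]))) = 1"
    by simp
qed

end

section \<open>Averages of probabilities; negligible functions\<close>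

lemma Re_avg: "Re (avg n f) = avg n (\<lambda>r. Re (f r))"
proof -
  have "(2 :: complex) ^ n = complex_of_real (2 ^ n)" by simp
  then show ?thesis unfolding avg_def by (simp only: Re_divide_of_real Re_sum)
qed

lemma avg_sum: "avg n (\<lambda>r. \<Sum>i\<in>I. f r i) = (\<Sum>i\<in>I. avg n (\<lambda>r. f r i))"
  unfolding avg_def by (subst sum.swap) (simp add: sum_divide_distrib)

lemma avg_mult_right: "avg n (\<lambda>r. f r * c) = avg n f * c"
  by (simp add: avg_def sum_distrib_right)

lemma avg_divide: "avg n (\<lambda>r. f r / c) = avg n f / c"
  using avg_mult_right[of n f "inverse c"] by (simp add: divide_inverse)

lemma avg_plus: "avg n (\<lambda>r. f r + g r) = avg n f + avg n g"
  by (simp add: avg_def sum.distrib add_divide_distrib)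

lemma avg_swap: "avg m (\<lambda>x. avg n (\<lambda>y. f x y)) = avg n (\<lambda>y. avg m (\<lambda>x. f x y))"
  unfolding avg_def sum_divide_distrib[symmetric] by (subst sum.swap) (simp add: mult.commute)

lemma avg_Suc_0: "avg (Suc 0) f = (f [False] + f [True]) / 2"
  by (simp add: avg_def sum_bitstrings_1)

lemma negligible_double:
  assumes "negligible f"
  shows "negligible (\<lambda>n. 2 * f n)"
  unfolding negligible_def
proof (intro allI impI)
  fix c :: real assume "c > 0"
  \<comment> \<open>The exponent \<open>c + 1\<close> leaves a spare factor \<open>n\<close>, which
    absorbs the 2 as soon as \<open>n \<ge> 2\<close>.\<close>
  then obtain N where N: "\<And>n. n \<ge> N \<Longrightarrow> f n < real n powr (- (c + 1))"
    using assms unfolding negligible_def by (metis add_pos_pos zero_less_one)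
  have "2 * f n < real n powr (- c)" if n: "n \<ge> max N 2" for n
  proof -
    have "real n powr (- c) = real n * real n powr (- (c + 1))"
      using n by (simp add: powr_mult_base)
    moreover have "2 * real n powr (- (c + 1)) \<le> real n * real n powr (- (c + 1))"
      using n by (intro mult_right_mono) auto
    moreover have "f n < real n powr (- (c + 1))" using N n by simp
    ultimately show ?thesis by linarith
  qed
  then show "\<exists>N. \<forall>n\<ge>N. 2 * f n < real n powr (- c)" by blast
qed

context one_way_generator
begin

text \<open>The success probability of the reduction when it plants the challenge \<open>k\<close> as key \<open>b\<close>, chooses the
  other key \<open>k'\<close> itself, and runs the forger with coins \<open>r\<close>.\<close>

definition planted :: "nat poly \<Rightarrow> sig_adv \<Rightarrow> nat \<Rightarrow> bool \<Rightarrow> bits \<Rightarrow> bits \<Rightarrow> bits \<Rightarrow> real" where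
  "planted t A l b k k' r = (\<Sum>s\<in>bitstrings l.
     outcome_prob (out_circ (poly t l * qubits l) (reduction_circ G t A (unary l) (b # k' @ r))
       (proj_op (power_vec (qubits l) (owsg_vec G k) (poly t l)))) s *
     (cmod (inner_prod (qubits l) (owsg_vec G s) (owsg_vec G k)))\<^sup>2)"

text \<open>The first coin is the guess, so averaging over it yields half the sum of the two cases;
  this half is the price of guessing.\<close>

lemma owsg_exp_reduction:
  "owsg_exp G t (reduction G t A) l =
    (avg l (\<lambda>k. avg l (\<lambda>k'. avg (poly (adv_coins A) l) (\<lambda>r. planted t A l False k k' r))) +
     avg l (\<lambda>k. avg l (\<lambda>k'. avg (poly (adv_coins A) l) (\<lambda>r. planted t A l True k k' r)))) / 2"
proof -
  let ?R = "reduction G t A" and ?q = "qubits l" and ?T = "poly t l"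
  let ?P = "\<lambda>k. proj_op (power_vec ?q (owsg_vec G k) ?T)"
  have c: "coin_length ?R [unary l] = Suc 0 + (l + poly (adv_coins A) l)"
    by (simp add: coin_length_def reduction_def)
  have "(\<Sum>s\<in>bitstrings l. outcome_prob (qalg_out ?R [unary l] (?T * ?q) (?P k)) s *
        (cmod (inner_prod ?q (owsg_vec G s) (owsg_vec G k)))\<^sup>2) =
      (avg l (\<lambda>k'. avg (poly (adv_coins A) l) (\<lambda>r. planted t A l False k k' r)) +
       avg l (\<lambda>k'. avg (poly (adv_coins A) l) (\<lambda>r. planted t A l True k k' r))) / 2" for k
  proof -
    have "outcome_prob (qalg_out ?R [unary l] (?T * ?q) (?P k)) s = avg (Suc 0) (\<lambda>x. avg l (\<lambda>k'. avg (poly (adv_coins A) l) (\<lambda>r.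
        outcome_prob (out_circ (?T * ?q) (reduction_circ G t A (unary l) (x @ k' @ r)) (?P k)) s)))" for s
      unfolding outcome_prob_def qalg_out_def c Re_avg avg_add by (simp add: reduction_def)
    then show ?thesis
      unfolding planted_def avg_sum avg_mult_right by (simp add: avg_Suc_0 sum.distrib sum_divide_distrib distrib_right add_divide_distrib)
  qed
  moreover have "owsg_exp G t ?R l = avg l (\<lambda>k. \<Sum>s\<in>bitstrings l. outcome_prob (qalg_out ?R [unary l] (?T * ?q) (?P k)) s *
        (cmod (inner_prod ?q (owsg_vec G s) (owsg_vec G k)))\<^sup>2)"
    unfolding owsg_exp_def by (rule avg_cong) (simp add: Let_def ancillas_G tensor_power_proj_op)
  ultimately show ?thesis
    by (simp add: avg_plus add_divide_distrib avg_divide)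
qed

lemma planted_nonneg: "0 \<le> planted t A l b k k' r"
  unfolding planted_def by (intro sum_nonneg mult_nonneg_nonneg outcome_prob_proj_op_nonneg) simp

text \<open>A forger that asks for a signature on \<open>m\<close> has to forge on
  \<open>\<not> m\<close>. So the key for \<open>\<not> m\<close> plays the challenge, and the key
  for \<open>m\<close> is the one the reduction knows and hands out as signature. If the output has
  not \<open>Suc l\<close> bits, every candidate has the wrong length and the left side is
  zero.\<close>

lemma sig_exp_le_planted:
  fixes t :: "nat poly" and A :: sig_adv and l :: nat and k0 k1 r :: bits and m :: bool
  assumes k: "length k0 = l" "length k1 = l"
  defines "S \<equiv> lamport_scheme G" and "sk \<equiv> sk_of l k0 k1"
  defines "q \<equiv> poly t l * pk_qubits S l" and "C \<equiv> stage1 A [unary l, r]"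
  defines "D \<equiv> stage2 A [unary l, r, [m], sign S [sk, [m]]]"
  defines "q' \<equiv> q + ancillas C"
  defines "\<rho> \<equiv> out_circ q' D (measure_first m
     (run_circ q C (tensor_power (pk_qubits S l) (public_key S sk) (poly t l))))"
  shows "(\<Sum>s\<in>bitstrings (out_size q' D). outcome_prob \<rho> s *
      (case s of [] \<Rightarrow> 0 | m' # \<sigma> \<Rightarrow> if m' \<noteq> m then accept_prob S l sk m' \<sigma> else 0))
    \<le> planted t A l (\<not> m) (if m then k0 else k1) (if m then k1 else k0) r"
proof (cases "out_size q' D = Suc l")
  case True
  let ?k = "if m then k0 else k1" and ?k' = "if m then k1 else k0"
  have pkq: "pk_qubits S l = Suc (2 * qubits l)" by (simp add: S_def lamport_scheme_def qubits_def)
  have "(\<Sum>s\<in>bitstrings (out_size q' D). outcome_prob \<rho> s *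
      (case s of [] \<Rightarrow> 0 | m' # \<sigma> \<Rightarrow> if m' \<noteq> m then accept_prob S l sk m' \<sigma> else 0)) =
      (\<Sum>b\<in>bitstrings (Suc 0). \<Sum>s\<in>bitstrings l. outcome_prob \<rho> (b @ s) *
      (case b @ s of [] \<Rightarrow> 0 | m' # \<sigma> \<Rightarrow> if m' \<noteq> m then accept_prob S l sk m' \<sigma> else 0))"
    unfolding True using sum_bitstrings_add[of _ "Suc 0" l] by simp
  also have "\<dots> = (\<Sum>s\<in>bitstrings l. outcome_prob \<rho> ((\<not> m) # s) * accept_prob S l sk (\<not> m) s)"
    unfolding sum_bitstrings_1 by (cases m) auto
  also have "\<dots> \<le> planted t A l (\<not> m) ?k ?k' r"
    unfolding planted_def
  proof (rule sum_mono)
    fix s assume "s \<in> bitstrings l"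
    then have s: "length s = l" by (simp add: bitstrings_def)
    have D': "D = stage2 A [unary l, r, [\<not> \<not> m], ?k']"
      using k by (simp add: D_def S_def sk_def sign_lamport)
    have "tensor_power (pk_qubits S l) (public_key S sk) (poly t l) =
      proj_op (power_vec (Suc (2 * qubits l)) (key_vec (qubits l) (owsg_vec G (if \<not> m then ?k' else ?k))
        (owsg_vec G (if \<not> m then ?k else ?k'))) (poly t l))"
      using k by (simp add: pkq[unfolded S_def] S_def sk_def public_key_sk_of tensor_power_proj_op)
    then have "outcome_prob \<rho> ((\<not> m) # s) \<le> outcome_prob (out_circ (poly t l * qubits l)
        (reduction_circ G t A (unary l) ((\<not> m) # ?k' @ r)) (proj_op (power_vec (qubits l) (owsg_vec G ?k) (poly t l)))) s"
      using outcome_prob_reduction[of ?k l ?k' s t A r "\<not> m"] True k s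
      unfolding \<rho>_def q'_def q_def C_def D' pkq by simp
    moreover have "accept_prob S l sk (\<not> m) s = (cmod (inner_prod (qubits l) (owsg_vec G s) (owsg_vec G ?k)))\<^sup>2"
      unfolding S_def sk_def accept_prob_lamport[OF k s] by simp
    ultimately show "outcome_prob \<rho> ((\<not> m) # s) * accept_prob S l sk (\<not> m) s \<le>
        outcome_prob (out_circ (poly t l * qubits l) (reduction_circ G t A (unary l) ((\<not> m) # ?k' @ r))
          (proj_op (power_vec (qubits l) (owsg_vec G ?k) (poly t l)))) s *
        (cmod (inner_prod (qubits l) (owsg_vec G s) (owsg_vec G ?k)))\<^sup>2"
      by (simp add: mult_right_mono)
  qed
  finally show ?thesis .
next
  case False
  have "outcome_prob \<rho> s * (case s of [] \<Rightarrow> 0 | m' # \<sigma> \<Rightarrow> if m' \<noteq> m then accept_prob S l sk m' \<sigma> else 0) = 0"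
    if "s \<in> bitstrings (out_size q' D)" for s
  proof (cases s)
    case (Cons c \<sigma>)
    then have "length \<sigma> \<noteq> l" using that False by (auto simp: bitstrings_def)
    then show ?thesis using Cons accept_prob_wrong_length[OF k] by (simp add: S_def sk_def)
  qed simp
  then have "(\<Sum>s\<in>bitstrings (out_size q' D). outcome_prob \<rho> s *
      (case s of [] \<Rightarrow> 0 | m' # \<sigma> \<Rightarrow> if m' \<noteq> m then accept_prob S l sk m' \<sigma> else 0)) = 0"
    by (rule sum.neutral[OF ballI])
  then show ?thesis using planted_nonneg by simp
qed

lemma sig_exp_le_owsg_exp:
  "sig_exp (lamport_scheme G) t A l \<le> 2 * owsg_exp G t (reduction G t A) l"
proof -
  let ?a = "poly (adv_coins A) l"
  have "sig_exp (lamport_scheme G) t A l \<le>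
      avg l (\<lambda>k0. avg l (\<lambda>k1. avg ?a (\<lambda>r. planted t A l True k1 k0 r + planted t A l False k0 k1 r)))"
    unfolding sig_exp_def avg_keys
  proof (intro avg_mono)
    fix k0 k1 r :: bits assume k: "length k0 = l" "length k1 = l"
    have sk: "secret_key (lamport_scheme G) l (k0 @ k1) = sk_of l k0 k1"
      using k by (simp add: secret_key_lamport)
    have sum_bool: "(\<Sum>m\<in>UNIV. f m) = f False + f True" for f :: "bool \<Rightarrow> real"
      by (simp add: UNIV_bool)
    show "(let sk = secret_key (lamport_scheme G) l (k0 @ k1);
           pks = tensor_power (pk_qubits (lamport_scheme G) l) (public_key (lamport_scheme G) sk) (poly t l);
           q = poly t l * pk_qubits (lamport_scheme G) l;
           C = stage1 A [unary l, r];
           \<rho> = run_circ q C pks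
       in \<Sum>m\<in>UNIV.
            let D = stage2 A [unary l, r, [m], sign (lamport_scheme G) [sk, [m]]];
                q' = q + ancillas C;
                \<rho>' = out_circ q' D (measure_first m \<rho>)
            in \<Sum>s\<in>bitstrings (out_size q' D).
                 outcome_prob \<rho>' s *
                 (case s of [] \<Rightarrow> 0
                  | m' # \<sigma>' \<Rightarrow> if m' \<noteq> m then accept_prob (lamport_scheme G) l sk m' \<sigma>' else 0))
        \<le> planted t A l True k1 k0 r + planted t A l False k0 k1 r"
      unfolding Let_def sum_bool sk
      by (rule add_mono[OF sig_exp_le_planted[OF k, of t A r False, unfolded if_False not_False_eq_True]
            sig_exp_le_planted[OF k, of t A r True, unfolded if_True not_True_eq_False]])
  qed
  also have "\<dots> = avg l (\<lambda>k0. avg l (\<lambda>k1. avg ?a (\<lambda>r. planted t A l True k1 k0 r))) +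
      avg l (\<lambda>k0. avg l (\<lambda>k1. avg ?a (\<lambda>r. planted t A l False k0 k1 r)))"
    by (simp only: avg_plus)
  \<comment> \<open>The two keys are independent and uniform, so they may trade places: the planted
    key is averaged first in both summands, as in the one-wayness game.\<close>
  also have "avg l (\<lambda>k0. avg l (\<lambda>k1. avg ?a (\<lambda>r. planted t A l True k1 k0 r))) =
      avg l (\<lambda>k1. avg l (\<lambda>k0. avg ?a (\<lambda>r. planted t A l True k1 k0 r)))"
    by (rule avg_swap)
  finally show ?thesis unfolding owsg_exp_reduction by simp
qed

lemma one_time_secure_lamport: "one_time_secure (lamport_scheme G)"
  unfolding one_time_secure_def
proof (intro allI impI)
  fix t A assume A: "sig_adv_qpt A"
  have "qpt 1 (reduction G t A)"
    using circ_gen_reduction_circ[OF circ_gen_G] A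
    by (simp add: qpt_def reduction_def sig_adv_qpt_def numeral_2_eq_2)
  then obtain \<nu> where \<nu>: "negligible \<nu>" "\<And>n. owsg_exp G t (reduction G t A) n \<le> \<nu> n"
    using owsg unfolding owsg_def by blast
  have "sig_exp (lamport_scheme G) t A l \<le> 2 * \<nu> l" for l
    using sig_exp_le_owsg_exp[of t A l] \<nu>(2)[of l] by linarith
  then show "\<exists>\<nu>. negligible \<nu> \<and> (\<forall>l. sig_exp (lamport_scheme G) t A l \<le> \<nu> l)"
    using negligible_double[OF \<nu>(1)] by blast
qed

end

theorem theorem1p3:
  assumes "\<exists>G. owsg G"
  shows "\<exists>S. sig_wf S \<and> perfectly_correct S \<and> one_time_secure S"
proof -
  from assms obtain G where "owsg G" by blast
  then interpret one_way_generator G by unfold_locales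
  show ?thesis
    using sig_wf_lamport perfectly_correct_lamport one_time_secure_lamport by blast
qed

end
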